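(* Let $H\in[\tfrac12,1]$ and $x_0\in(0,\infty)$. Let $\sigma:\mathbb{R}\to\mathbb{R}$ and $\sigma_n:\mathbb{R}\to\mathbb{R}$ ($n\in\mathbb{N}$) be Borel functions. Suppose that $\|\sigma\|_\infty=\sup_{x\in\mathbb{R}}|\sigma(x)|<\infty$ and that there exists $c_H>0$ such that $|\sigma(x)-\sigma(y)|\le c_H|x-y|^{H}$ for all $x,y\in\mathbb{R}$ with $|x-y|\le 1$. Let $X$ and $X_n$ be solutions, with respect to the same Brownian motion $B$, of $$X(t)-X(0)=\int_0^t\sigma(X(s))\,dB_s,\quad X(0)=x_0,\qquad X_n(t)-X_n(0)=\int_0^t\sigma_n(X_n(s))\,dB_s,\quad X_n(0)=x_0,$$ and suppose that $X_n$ is a strong solution for all $n\in\mathbb{N}$. Put $\Delta_n=\sup_{x\in\mathbb{R}}|\sigma(x)-\sigma_n(x)|$. Then for any $T>0$ there exists $C_2(T,H)>0$, depending on $H$ and $T$, such that for every $n\in\mathbb{N}$ satisfying $\Delta_n<2^{-H}$, $$\mathbb{E}\Big[\big(\sup_{0\le t\le T}|X(t)-X_n(t)|\big)^2\Big]\le C_2(T,H)\times\begin{cases}(-\log\Delta_n)^{-\frac12} & \text{if } H=\tfrac12,\\ \Delta_n^{\,1-1/(2H)} & \text{if } H\in(\tfrac12,1].\end{cases}$$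
   Context: $B$ is a one-dimensional Brownian motion on a filtered probability space. The functions $\sigma$ and $\sigma_n$ and the constant $c_H$ are fixed, so the constant $C_2(T,H)$ may also depend on $c_H$ and $\|\sigma\|_\infty$, but not on $n$. If $\Delta_n=0$, the expression $(-\log\Delta_n)^{-1/2}$ is understood as $0$. *)

theory Defs
  imports "HOL-Probability.Probability"
begin

text \<open>
  Time is modelled by \<^typ>\<open>real\<close>, and only times \<open>t \<ge> 0\<close> matter. A filtration indexed by
  \<open>[0, \<infinity>)\<close> extends to all reals by \<open>F t = F 0\<close> for \<open>t < 0\<close>, so indexing by all reals loses
  nothing. The usual conditions (completeness, right-continuity) are not assumed.
\<close>

locale filtered_prob_space = prob_space M + filtration "space M" F
  for M :: "'a measure" and F :: "real \<Rightarrow> 'a measure" +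
  assumes subalgebra_F: "subalgebra M (F t)"

locale brownian_motion = filtered_prob_space M F
  for M :: "'a measure" and F :: "real \<Rightarrow> 'a measure" and B :: "real \<Rightarrow> 'a \<Rightarrow> real" +
  assumes adapted: "0 \<le> t \<Longrightarrow> B t \<in> borel_measurable (F t)"
    and start_zero: "AE \<omega> in M. B 0 \<omega> = 0"
    and continuous_paths: "AE \<omega> in M. continuous_on {0..} (\<lambda>t. B t \<omega>)"
    and normal_increments: "0 \<le> s \<Longrightarrow> s < t \<Longrightarrow>
      distributed M lborel (\<lambda>\<omega>. B t \<omega> - B s \<omega>) (normal_density 0 (sqrt (t - s)))"
    and indep_increments: "0 \<le> s \<Longrightarrow> s < t \<Longrightarrow>
      indep_set (sets (F s)) (sets (vimage_algebra (space M) (\<lambda>\<omega>. B t \<omega> - B s \<omega>) borel))"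

definition progressively_measurable ::
    "(real \<Rightarrow> 'a measure) \<Rightarrow> (real \<Rightarrow> 'a \<Rightarrow> real) \<Rightarrow> bool" where
  "progressively_measurable F Y \<longleftrightarrow>
     (\<forall>t\<ge>0. (\<lambda>(s, \<omega>). Y s \<omega>) \<in> borel_measurable (restrict_space borel {0..t} \<Otimes>\<^sub>M F t))"

text \<open>
  A triple \<open>(m, p, \<xi>)\<close> represents the simple process that equals \<open>\<xi> i\<close> on the time interval
  \<open>(p i, p (i + 1)]\<close> for \<open>i < m\<close>, and vanishes elsewhere.
\<close>

definition simple_integrand ::
    "(real \<Rightarrow> 'a measure) \<Rightarrow> nat \<Rightarrow> (nat \<Rightarrow> real) \<Rightarrow> (nat \<Rightarrow> 'a \<Rightarrow> real) \<Rightarrow> bool" where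
  "simple_integrand F m p \<xi> \<longleftrightarrow> 0 \<le> p 0 \<and> (\<forall>i<m. p i \<le> p (Suc i)) \<and>
     (\<forall>i<m. \<xi> i \<in> borel_measurable (F (p i)) \<and> bounded (\<xi> i ` space (F (p i))))"

definition simple_process ::
    "nat \<Rightarrow> (nat \<Rightarrow> real) \<Rightarrow> (nat \<Rightarrow> 'a \<Rightarrow> real) \<Rightarrow> real \<Rightarrow> 'a \<Rightarrow> real" where
  "simple_process m p \<xi> s \<omega> = (\<Sum>i<m. \<xi> i \<omega> * indicator {p i<..p (Suc i)} s)"

definition simple_ito_integral ::
    "(real \<Rightarrow> 'a \<Rightarrow> real) \<Rightarrow> real \<Rightarrow> nat \<Rightarrow> (nat \<Rightarrow> real) \<Rightarrow> (nat \<Rightarrow> 'a \<Rightarrow> real) \<Rightarrow> 'a \<Rightarrow> real" where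
  "simple_ito_integral B t m p \<xi> \<omega> =
     (\<Sum>i<m. \<xi> i \<omega> * (B (min t (p (Suc i))) \<omega> - B (min t (p i)) \<omega>))"

text \<open>
  \<open>has_ito_integral M F B t Y Z\<close>: the integrand \<open>Y\<close> is progressively measurable and almost surely
  square integrable on \<open>[0, t]\<close>, and the random variable \<open>Z\<close> is a version of the integral of \<open>Y\<close>
  with respect to \<open>B\<close> over \<open>[0, t]\<close>, i.e. the limit in probability of the integrals of simple
  processes \<open>Y\<^sub>k\<close> for which the integral of \<open>(Y\<^sub>k - Y)\<^sup>2\<close> over \<open>[0, t]\<close> tends to 0 in probability.
  This is the usual extension of the integral from simple processes; \<open>Z\<close> is determined up to
  almost sure equality.
\<close>

definition has_ito_integral ::
    "'a measure \<Rightarrow> (real \<Rightarrow> 'a measure) \<Rightarrow> (real \<Rightarrow> 'a \<Rightarrow> real) \<Rightarrow> real \<Rightarrow>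
     (real \<Rightarrow> 'a \<Rightarrow> real) \<Rightarrow> ('a \<Rightarrow> real) \<Rightarrow> bool" where
  "has_ito_integral M F B t Y Z \<longleftrightarrow>
     progressively_measurable F Y \<and>
     (AE \<omega> in M. (\<integral>\<^sup>+s\<in>{0..t}. ennreal ((Y s \<omega>)\<^sup>2) \<partial>lborel) < \<infinity>) \<and>
     Z \<in> borel_measurable M \<and>
     (\<exists>m p \<xi>. (\<forall>k. simple_integrand F (m k) (p k) (\<xi> k)) \<and>
       (\<forall>\<epsilon>>0. (\<lambda>k. measure M {\<omega>\<in>space M. ennreal \<epsilon> <
           (\<integral>\<^sup>+s\<in>{0..t}. ennreal ((simple_process (m k) (p k) (\<xi> k) s \<omega> - Y s \<omega>)\<^sup>2) \<partial>lborel)})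
         \<longlonglongrightarrow> 0) \<and>
       (\<forall>\<epsilon>>0. (\<lambda>k. measure M {\<omega>\<in>space M.
           \<epsilon> < \<bar>simple_ito_integral B t (m k) (p k) (\<xi> k) \<omega> - Z \<omega>\<bar>}) \<longlonglongrightarrow> 0))"

definition sde_solution ::
    "'a measure \<Rightarrow> (real \<Rightarrow> 'a measure) \<Rightarrow> (real \<Rightarrow> 'a \<Rightarrow> real) \<Rightarrow> (real \<Rightarrow> real) \<Rightarrow> real \<Rightarrow>
     (real \<Rightarrow> 'a \<Rightarrow> real) \<Rightarrow> bool" where
  "sde_solution M F B \<sigma> x0 X \<longleftrightarrow>
     (\<forall>t\<ge>0. X t \<in> borel_measurable (F t)) \<and>
     (AE \<omega> in M. continuous_on {0..} (\<lambda>t. X t \<omega>)) \<and>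
     (AE \<omega> in M. X 0 \<omega> = x0) \<and>
     (\<forall>t\<ge>0. has_ito_integral M F B t (\<lambda>s \<omega>. \<sigma> (X s \<omega>)) (\<lambda>\<omega>. X t \<omega> - X 0 \<omega>))"

text \<open>The filtration generated by \<open>B\<close>, augmented by all subsets of \<open>M\<close>-null sets.\<close>

definition augmented_filtration ::
    "'a measure \<Rightarrow> (real \<Rightarrow> 'a \<Rightarrow> real) \<Rightarrow> real \<Rightarrow> 'a measure" where
  "augmented_filtration M B t = sigma (space M)
     ({B s -` A \<inter> space M | s A. 0 \<le> s \<and> s \<le> t \<and> A \<in> sets borel} \<union>
      {N. \<exists>N'\<in>null_sets M. N \<subseteq> N'})"

definition strong_sde_solution ::
    "'a measure \<Rightarrow> (real \<Rightarrow> 'a measure) \<Rightarrow> (real \<Rightarrow> 'a \<Rightarrow> real) \<Rightarrow> (real \<Rightarrow> real) \<Rightarrow> real \<Rightarrow>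
     (real \<Rightarrow> 'a \<Rightarrow> real) \<Rightarrow> bool" where
  "strong_sde_solution M F B \<sigma> x0 X \<longleftrightarrow> sde_solution M F B \<sigma> x0 X \<and>
     (\<forall>t\<ge>0. X t \<in> borel_measurable (augmented_filtration M B t))"

text \<open>The supremum norm takes values in \<^typ>\<open>ennreal\<close>, since \<open>\<sigma> - \<sigma>\<^sub>n\<close> may be unbounded.\<close>

definition sup_norm :: "(real \<Rightarrow> real) \<Rightarrow> ennreal" where
  "sup_norm f = (SUP x. ennreal \<bar>f x\<bar>)"

definition stability_rate :: "real \<Rightarrow> real \<Rightarrow> real" where
  "stability_rate H d =
     (if H = 1/2 then (if d = 0 then 0 else (- ln d) powr (-1/2))
      else d powr (1 - 1 / (2 * H)))"

end

theory Submission
  imports Defs "HOL-Real_Asymp.Real_Asymp"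
begin

text \<open>
  Let \<open>D = X - X\<^sub>n\<close>, a stochastic integral of \<open>G = \<sigma>(X) - \<sigma>\<^sub>n(X\<^sub>n)\<close>, and let \<open>\<Delta>\<^sub>n \<le> d\<close>. Since \<open>\<sigma>\<close> is bounded
  and locally Hoelder continuous, \<open>G\<^sup>2 \<le> 2 A \<bar>D\<bar>\<^sup>2\<^sup>H + 2 d\<^sup>2\<close>. Following Yamada and Watanabe, take a smooth
  convex approximation \<open>\<phi>\<close> of the absolute value for which \<open>\<phi>''(D) G\<^sup>2\<close> is uniformly small; then
  \<open>E \<bar>D\<^sub>t\<bar>\<close> is small because \<open>E \<phi>(D\<^sub>t)\<close> grows at rate \<open>E (\<phi>''(D\<^sub>t) G\<^sub>t\<^sup>2) / 2\<close>. The Ito isometry and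
  \<open>G\<^sup>2 \<le> 2 A \<bar>D\<bar> + 2 d\<^sup>2\<close> turn this into a bound on \<open>E D\<^sub>T\<^sup>2\<close>, and Doob's inequality into one on the
  supremum. Ito's formula itself is avoided: because \<open>G\<close> is bounded, all that is needed about the
  stochastic integral is the orthogonality of its increments, an upper bound on their conditional
  second moments, and a bound on their fourth moments. These pass to the limit from simple
  processes, whose coefficients can be clipped at the bound of \<open>G\<close>.
\<close>

section \<open>Brownian increments and refinement of partitions\<close>

text \<open>A product \<open>\<phi>2 (D r w) * (G r w)\<^sup>2\<close> is controlled only at equal
  times, whereas a time step from s needs the weight \<open>\<phi>2 (D s)\<close>, known at s. The
  Lipschitz bound for \<open>\<phi>2\<close> bridges the gap at a cost of order sqrt h for a step of
  length h, and fourth moments make the Taylor remainder of order h sqrt h, so both errors disappear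
  as the partition is refined. Fourth moments also turn convergence in probability into convergence
  in L2. The width e of the smoothed absolute value is tuned to d. For H > 1/2 it is sqrt(x^2 + e^2)
  with e = d powr (1/H), which balances the Hoelder part e powr (2H - 1) against the uniform error
  d^2 / e. For H = 1/2 the former is of order 1, and a logarithmic normalisation gains the factor 1
  / (- ln d) instead. Both routes bound the second moment of the supremum by a multiple of d powr (2
  - 1/H) or of 1 / (- ln d). This is the square of the stated rate, which then follows by weakening.
  The case \<Delta> = 0 is a limit of bounds with d > 0.\<close>

context brownian_motion
begin

lemma measurable_F_mono:
  assumes "f \<in> measurable (F s) N" "s \<le> t"
  shows "f \<in> measurable (F t) N"
proof (rule measurable_from_subalg[OF _ assms(1)])
  show "subalgebra (F t) (F s)"
    unfolding subalgebra_def space_F using sets_F_mono[OF assms(2)] by blast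
qed

lemma measurable_F_M: "f \<in> measurable (F s) N \<Longrightarrow> f \<in> measurable M N"
  by (rule measurable_from_subalg[OF subalgebra_F])

lemma measurable_B [measurable]: "0 \<le> t \<Longrightarrow> B t \<in> borel_measurable M"
  by (rule measurable_F_M[OF adapted])

lemma indep_set_mono_left:
  assumes "indep_set A C" "A' \<subseteq> A"
  shows "indep_set A' C"
  using assms by (auto simp: indep_sets2_eq)

lemma indep_increment:
  fixes Z :: "'a \<Rightarrow> real"
  assumes "0 \<le> s" "s < t" and Z: "Z \<in> borel_measurable (F s)"
  shows "indep_var borel Z borel (\<lambda>w. B t w - B s w)"
proof -
  let ?W = "\<lambda>w. B t w - B s w"
  have Zm: "random_variable borel Z"
    by (rule measurable_F_M[OF Z])
  have Wm: "random_variable borel ?W"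
    using assms by (intro borel_measurable_diff measurable_B) auto
  let ?S = "\<lambda>Y :: 'a \<Rightarrow> real. sigma_sets (space M) {Y -` A \<inter> space M | A. A \<in> sets borel}"
  have "?S Z \<subseteq> sets (F s)"
  proof -
    have "{Z -` A \<inter> space (F s) | A. A \<in> sets borel} \<subseteq> sets (F s)"
      by (blast intro: measurable_sets[OF Z])
    from sets.sigma_sets_subset[OF this] show ?thesis
      by (simp only: space_F)
  qed
  moreover have "indep_set (sets (F s)) (?S ?W)"
    using indep_increments[OF assms(1,2)] by (simp only: sets_vimage_algebra)
  ultimately have "indep_set (?S Z) (?S ?W)"
    by (rule indep_set_mono_left[rotated])
  then show ?thesis
    unfolding indep_var_eq by (intro conjI Zm Wm)
qed

text \<open>Moments of the centred normal law with variance \<open>v\<close>: for k = 2j the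
  quotient equals (2j - 1)!! times the j-th power of \<open>v\<close>.\<close>

definition gauss_moment :: "nat \<Rightarrow> real \<Rightarrow> real" where
  "gauss_moment k v = (if even k then fact k * (v / 2) ^ (k div 2) / fact (k div 2) else 0)"

lemma gauss_moment_simps:
  "gauss_moment 0 v = 1" "gauss_moment (Suc 0) v = 0" "gauss_moment 2 v = v" "gauss_moment 3 v = 0"
  "gauss_moment 4 v = 3 * v\<^sup>2"
  by (simp_all add: gauss_moment_def fact_numeral power2_eq_square)

lemma increment_moment:
  assumes "0 \<le> s" "s < t"
  shows "integrable M (\<lambda>w. (B t w - B s w) ^ k)"
    and "(\<integral>w. (B t w - B s w) ^ k \<partial>M) = gauss_moment k (t - s)"
proof -
  let ?\<sigma> = "sqrt (t - s)"
  have pos: "0 < ?\<sigma>"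
    using assms by simp
  note D = normal_increments[OF assms]
  have "integrable lborel (\<lambda>x. normal_density 0 ?\<sigma> x * x ^ k)"
    using integrable_normal_moment[OF pos, of 0 k] by simp
  then show "integrable M (\<lambda>w. (B t w - B s w) ^ k)"
    using distributed_integrable[OF D, of "\<lambda>x. x ^ k"] by simp
  have "(\<integral>w. (B t w - B s w) ^ k \<partial>M) = (\<integral>x. normal_density 0 ?\<sigma> x * x ^ k \<partial>lborel)"
    using distributed_integral[OF D, of "\<lambda>x. x ^ k"] by simp
  also have "\<dots> = gauss_moment k (t - s)"
  proof (cases "even k")
    case True
    then obtain j where "k = 2 * j"
      by blast
    then show ?thesis
      using integral_normal_moment_even[OF pos, of 0 j] assms
      by (simp add: gauss_moment_def power_divide)
  next
    case False
    then obtain j where "k = 2 * j + 1"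
      by (elim oddE)
    then show ?thesis
      using integral_normal_moment_odd[OF pos, of 0 j] False by (simp add: gauss_moment_def)
  qed
  finally show "(\<integral>w. (B t w - B s w) ^ k \<partial>M) = gauss_moment k (t - s)" .
qed

lemma mult_increment_moment:
  fixes Z :: "'a \<Rightarrow> real"
  assumes "0 \<le> s" "s \<le> t" and Z: "Z \<in> borel_measurable (F s)" "integrable M Z"
  shows "integrable M (\<lambda>w. Z w * (B t w - B s w) ^ k)"
    and "(\<integral>w. Z w * (B t w - B s w) ^ k \<partial>M) = (\<integral>w. Z w \<partial>M) * gauss_moment k (t - s)"
proof -
  have "integrable M (\<lambda>w. Z w * (B t w - B s w) ^ k) \<and>
    (\<integral>w. Z w * (B t w - B s w) ^ k \<partial>M) = (\<integral>w. Z w \<partial>M) * gauss_moment k (t - s)"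
  \<comment> \<open>The Brownian increments are described only for \<open>s < t\<close>. For
    \<open>s = t\<close> the increment is 0, and both sides vanish unless
    \<open>k = 0\<close>.\<close>
  proof (cases "s = t")
    case True
    then show ?thesis
      using Z by (cases "k = 0") (auto simp: gauss_moment_def power_0_left div_eq_0_iff)
  next
    case False
    then have st: "s < t"
      using assms by simp
    have ind: "indep_var borel Z borel (\<lambda>w. (B t w - B s w) ^ k)"
      using indep_var_compose[OF indep_increment[OF assms(1) st Z(1)],
          of "\<lambda>x. x" borel "\<lambda>x. x ^ k" borel]
      by (simp add: comp_def)
    show ?thesis
      using indep_var_integrable[OF ind Z(2) increment_moment(1)[OF assms(1) st]]
        indep_var_lebesgue_integral[OF ind Z(2) increment_moment(1)[OF assms(1) st]]
        increment_moment(2)[OF assms(1) st] by simp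
  qed
  then show "integrable M (\<lambda>w. Z w * (B t w - B s w) ^ k)"
    and "(\<integral>w. Z w * (B t w - B s w) ^ k \<partial>M) = (\<integral>w. Z w \<partial>M) * gauss_moment k (t - s)"
    by auto
qed

end

text \<open>A Stieltjes sum of a step function against \<open>g\<close>. A Brownian path as
  \<open>g\<close> gives the stochastic integral, the identity with squared coefficients gives the
  quadratic variation, and \<open>of_bool (s \<le> x)\<close> gives the value of the process at time
  \<open>s\<close>. An identity valid for all \<open>g\<close> therefore transfers to process and
  integral at once.\<close>

definition wsum :: "(real \<Rightarrow> real) \<Rightarrow> nat \<Rightarrow> (nat \<Rightarrow> real) \<Rightarrow> (nat \<Rightarrow> real) \<Rightarrow> real" where
  "wsum g m p c = (\<Sum>i<m. c i * (g (p (Suc i)) - g (p i)))"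

lemma simple_process_eq_wsum:
  assumes "\<And>i. i < m \<Longrightarrow> p i \<le> p (Suc i)"
  shows "simple_process m p \<xi> s w = wsum (\<lambda>x. of_bool (s \<le> x)) m p (\<lambda>i. \<xi> i w)"
  unfolding simple_process_def wsum_def
  using assms by (intro sum.cong refl) (force simp: indicator_def)

lemma simple_ito_integral_eq_wsum:
  "simple_ito_integral B t m p \<xi> w = wsum (\<lambda>x. B (min t x) w) m p (\<lambda>i. \<xi> i w)"
  unfolding simple_ito_integral_def wsum_def ..

text \<open>The selected grid intervals are those whose right end lies in (\<open>q u\<close>,
  \<open>q v\<close>], that is, the indices from \<open>u\<close> to \<open>v - 1\<close>; over
  these the sum telescopes.\<close>

lemma sum_refine:
  fixes q :: "nat \<Rightarrow> real" and g :: "real \<Rightarrow> real"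
  assumes q: "\<And>i j. i < j \<Longrightarrow> j \<le> N \<Longrightarrow> q i < q j" and u: "u \<le> v" "v \<le> N"
  shows "(\<Sum>j<N. of_bool (q u < q (Suc j) \<and> q (Suc j) \<le> q v) * (g (q (Suc j)) - g (q j)))
    = g (q v) - g (q u)"
proof -
  have less: "q i < q j \<longleftrightarrow> i < j" if "i \<le> N" "j \<le> N" for i j
    using q[of i j] q[of j i] that by (metis less_asym linorder_neqE_nat less_irrefl)
  have le: "q i \<le> q j \<longleftrightarrow> i \<le> j" if "i \<le> N" "j \<le> N" for i j
    using less[OF that(2,1)] by linarith
  have "(\<Sum>j<N. of_bool (q u < q (Suc j) \<and> q (Suc j) \<le> q v) * (g (q (Suc j)) - g (q j)))
      = (\<Sum>j<N. if j \<in> {u..<v} then g (q (Suc j)) - g (q j) else 0)"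
    using u by (intro sum.cong refl) (auto simp: less le)
  also have "\<dots> = (\<Sum>j\<in>{u..<v}. g (q (Suc j)) - g (q j))"
    using u by (subst sum.inter_restrict[symmetric]) (auto intro: sum.cong)
  also have "\<dots> = g (q v) - g (q u)"
    using u sum_Suc_diff'[of u v "\<lambda>j. g (q j)"] by simp
  finally show ?thesis .
qed

text \<open>Each interval of \<open>p\<close> is a union of intervals of the finer grid
  \<open>q\<close>, so a fine interval inherits the coefficients of the coarse intervals containing
  it. Empty coarse intervals contribute nothing on either side.\<close>

lemma wsum_refine:
  fixes q :: "nat \<Rightarrow> real"
  assumes q: "\<And>i j. i < j \<Longrightarrow> j \<le> N \<Longrightarrow> q i < q j"
    and p: "\<And>i. i \<le> m \<Longrightarrow> p i \<in> q ` {..N}" "\<And>i. i < m \<Longrightarrow> p i \<le> p (Suc i)"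
  shows "wsum g m p c
    = wsum g N q (\<lambda>j. \<Sum>i<m. c i * of_bool (p i < q (Suc j) \<and> q (Suc j) \<le> p (Suc i)))"
proof -
  have "(\<Sum>j<N. of_bool (p i < q (Suc j) \<and> q (Suc j) \<le> p (Suc i)) * (g (q (Suc j)) - g (q j)))
      = g (p (Suc i)) - g (p i)" if "i < m" for i
  proof -
    obtain u v where uv: "u \<le> N" "v \<le> N" "p i = q u" "p (Suc i) = q v"
      using p(1)[of i] p(1)[of "Suc i"] \<open>i < m\<close> by (metis Suc_leI atMost_iff imageE less_imp_le_nat)
    have "u \<le> v"
      using q[of v u] uv p(2)[OF that] by (cases "v < u") auto
    then show ?thesis
      using sum_refine[where q = q and N = N and u = u and v = v and g = g] q uv by simp
  qed
  then have "wsum g m p c = (\<Sum>i<m. c i * (\<Sum>j<N.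
      of_bool (p i < q (Suc j) \<and> q (Suc j) \<le> p (Suc i)) * (g (q (Suc j)) - g (q j))))"
    unfolding wsum_def by (intro sum.cong) auto
  also have "\<dots> = wsum g N q
      (\<lambda>j. \<Sum>i<m. c i * of_bool (p i < q (Suc j) \<and> q (Suc j) \<le> p (Suc i)))"
    unfolding wsum_def sum_distrib_left sum_distrib_right
    by (subst sum.swap) (simp add: mult.assoc)
  finally show ?thesis .
qed

lemma enumerate_finite_set:
  fixes P :: "real set"
  assumes "finite P" "P \<noteq> {}"
  obtains N and q :: "nat \<Rightarrow> real" where "q ` {..N} = P" "\<And>i j. i < j \<Longrightarrow> j \<le> N \<Longrightarrow> q i < q j"
proof -
  let ?l = "sorted_list_of_set P"
  have "0 < length ?l"
    using assms by (simp add: card_gt_0_iff)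
  then have len: "{..length ?l - 1} = {..<length ?l}"
    by (auto simp: set_eq_iff)
  have "(!) ?l ` {..<length ?l} = set ?l"
    by (auto simp: set_conv_nth)
  then have "(!) ?l ` {..length ?l - 1} = P"
    using len assms by simp
  moreover have "?l ! i < ?l ! j" if "i < j" "j \<le> length ?l - 1" for i j
    using strict_sorted_list_of_set[of P] that \<open>0 < length ?l\<close>
    by (intro sorted_wrt_nth_less[of "(<)"]) auto
  ultimately show thesis
    by (rule that[of "(!) ?l"])
qed

section \<open>Integrals of simple processes\<close>

context brownian_motion
begin

lemma simple_integrandD:
  assumes "simple_integrand F m p \<xi>"
  shows "i \<le> j \<Longrightarrow> j \<le> m \<Longrightarrow> p i \<le> p j" and "i \<le> m \<Longrightarrow> 0 \<le> p i"
    and "i < m \<Longrightarrow> \<xi> i \<in> borel_measurable (F (p i))"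
    and "i < m \<Longrightarrow> \<exists>C\<ge>0. \<forall>w\<in>space M. \<bar>\<xi> i w\<bar> \<le> C"
proof -
  have step: "p k \<le> p (Suc k)" if "k < m" for k
    using assms that by (simp add: simple_integrand_def)
  show mono: "p i \<le> p j" if "i \<le> j" "j \<le> m" for i j
    using that
  proof (induction j rule: dec_induct)
    case (step n)
    with \<open>\<And>k. k < m \<Longrightarrow> p k \<le> p (Suc k)\<close>[of n] show ?case
      by simp
  qed simp
  show "0 \<le> p i" if "i \<le> m"
    using mono[of 0 i] that assms by (simp add: simple_integrand_def)
  show "\<xi> i \<in> borel_measurable (F (p i))" if "i < m"
    using assms that by (simp add: simple_integrand_def)
  show "\<exists>C\<ge>0. \<forall>w\<in>space M. \<bar>\<xi> i w\<bar> \<le> C" if "i < m"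
  proof -
    have "bounded (\<xi> i ` space M)"
      using assms that by (simp add: simple_integrand_def space_F)
    then obtain C where "\<forall>w\<in>space M. \<bar>\<xi> i w\<bar> \<le> C"
      unfolding bounded_iff by auto
    then have "\<forall>w\<in>space M. \<bar>\<xi> i w\<bar> \<le> max C 0"
      by fastforce
    then show ?thesis
      by (intro exI[of _ "max C 0"]) simp
  qed
qed

lemma simple_integrandI:
  assumes "0 \<le> p 0" "\<And>i. i < m \<Longrightarrow> p i \<le> p (Suc i)"
    and "\<And>i. i < m \<Longrightarrow> \<xi> i \<in> borel_measurable (F (p i))"
    and "\<And>i. i < m \<Longrightarrow> \<exists>C. \<forall>w\<in>space M. \<bar>\<xi> i w\<bar> \<le> C"
  shows "simple_integrand F m p \<xi>"
  using assms unfolding simple_integrand_def bounded_iff space_F by auto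

lemma simple_integrand_take:
  assumes "simple_integrand F m p \<xi>" "n \<le> m"
  shows "simple_integrand F n p \<xi>"
  using assms by (simp add: simple_integrand_def)

text \<open>Stopping, weighting and clipping all enlarge coefficients by at most a constant factor,
  so for each of them only adaptedness remains to be checked.\<close>

lemma simple_integrand_cong_bound:
  assumes "simple_integrand F m p \<xi>"
    and "\<And>i. i < m \<Longrightarrow> \<eta> i \<in> borel_measurable (F (p i))"
    and "\<And>i w. i < m \<Longrightarrow> w \<in> space M \<Longrightarrow> \<bar>\<eta> i w\<bar> \<le> c * \<bar>\<xi> i w\<bar>" "0 \<le> c"
  shows "simple_integrand F m p \<eta>"
proof (rule simple_integrandI)
  fix i assume i: "i < m"
  obtain C where C: "\<forall>w\<in>space M. \<bar>\<xi> i w\<bar> \<le> C"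
    using simple_integrandD(4)[OF assms(1) i] by blast
  have "\<bar>\<eta> i w\<bar> \<le> c * C" if "w \<in> space M" for w
    using assms(3)[OF i that] mult_left_mono[OF C[rule_format, OF that] assms(4)] by linarith
  then show "\<exists>C. \<forall>w\<in>space M. \<bar>\<eta> i w\<bar> \<le> C"
    by blast
qed (use assms in \<open>auto simp: simple_integrand_def\<close>)

abbreviation stoch_sum :: "nat \<Rightarrow> (nat \<Rightarrow> real) \<Rightarrow> (nat \<Rightarrow> 'a \<Rightarrow> real) \<Rightarrow> 'a \<Rightarrow> real" where
  "stoch_sum m p \<xi> w \<equiv> wsum (\<lambda>x. B x w) m p (\<lambda>i. \<xi> i w)"

abbreviation quad_sum :: "nat \<Rightarrow> (nat \<Rightarrow> real) \<Rightarrow> (nat \<Rightarrow> 'a \<Rightarrow> real) \<Rightarrow> 'a \<Rightarrow> real" where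
  "quad_sum m p \<xi> w \<equiv> wsum (\<lambda>x. x) m p (\<lambda>i. (\<xi> i w)\<^sup>2)"

lemma wsum_Suc: "wsum g (Suc m) p c = wsum g m p c + c m * (g (p (Suc m)) - g (p m))"
  by (simp add: wsum_def)

lemma wsum_0 [simp]: "wsum g 0 p c = 0"
  by (simp add: wsum_def)

lemma measurable_stoch_sum:
  assumes "simple_integrand F m p \<xi>" "n \<le> m"
  shows "stoch_sum n p \<xi> \<in> borel_measurable (F (p n))"
  using assms(2)
proof (induction n)
  case (Suc n)
  note D = simple_integrandD[OF assms(1)]
  have le: "p n \<le> p (Suc n)" and nn: "0 \<le> p n" "0 \<le> p (Suc n)"
    using D(1)[of n "Suc n"] D(2) Suc.prems by auto
  have [measurable]: "stoch_sum n p \<xi> \<in> borel_measurable (F (p (Suc n)))"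
    using Suc by (intro measurable_F_mono[OF _ le]) simp
  have [measurable]: "\<xi> n \<in> borel_measurable (F (p (Suc n)))"
    using D(3) Suc.prems by (intro measurable_F_mono[OF _ le]) simp
  have [measurable]: "B (p n) \<in> borel_measurable (F (p (Suc n)))"
    by (rule measurable_F_mono[OF adapted le]) fact
  have [measurable]: "B (p (Suc n)) \<in> borel_measurable (F (p (Suc n)))"
    by (rule adapted) fact
  show ?case
    unfolding wsum_Suc by measurable
qed simp

text \<open>The sum includes interval \<open>n\<close>, yet it is known already at the left end
  \<open>p n\<close>. This predictability lets a stopping rule look at the interval about to
  begin.\<close>

lemma measurable_quad_sum:
  assumes "simple_integrand F m p \<xi>" "n < m"
  shows "quad_sum (Suc n) p \<xi> \<in> borel_measurable (F (p n))"
  unfolding wsum_def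
proof (intro borel_measurable_sum borel_measurable_times borel_measurable_power)
  fix i assume "i \<in> {..<Suc n}"
  then have "i \<le> n" "i < m"
    using assms(2) by auto
  then show "\<xi> i \<in> borel_measurable (F (p n))"
    using assms(2) by (intro measurable_F_mono[OF simple_integrandD(3)[OF assms(1)]]
        simple_integrandD(1)[OF assms(1)]) auto
qed simp

lemma quad_sum_mono:
  assumes "simple_integrand F m p \<xi>" "n \<le> k" "k \<le> m"
  shows "quad_sum n p \<xi> w \<le> quad_sum k p \<xi> w"
  unfolding wsum_def using assms simple_integrandD(1)[OF assms(1)]
  by (intro sum_mono2) auto

lemma quad_sum_nonneg:
  assumes "simple_integrand F m p \<xi>"
  shows "0 \<le> quad_sum m p \<xi> w"
  using quad_sum_mono[OF assms, of 0 m] by simp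

lemma quad_sum_le:
  assumes "simple_integrand F m p \<xi>" "\<And>i. i < m \<Longrightarrow> \<bar>\<xi> i w\<bar> \<le> C"
  shows "quad_sum m p \<xi> w \<le> C\<^sup>2 * (p m - p 0)"
proof -
  have "quad_sum m p \<xi> w \<le> (\<Sum>i<m. C\<^sup>2 * (p (Suc i) - p i))"
    unfolding wsum_def
  proof (intro sum_mono mult_right_mono)
    fix i assume "i \<in> {..<m}"
    then show "(\<xi> i w)\<^sup>2 \<le> C\<^sup>2" "0 \<le> p (Suc i) - p i"
      using assms(2)[of i] simple_integrandD(1)[OF assms(1), of i "Suc i"] abs_le_square_iff[of "\<xi> i w" C]
      by auto
  qed
  also have "\<dots> = C\<^sup>2 * (p m - p 0)"
    by (simp add: sum_distrib_left[symmetric] sum_lessThan_telescope)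
  finally show ?thesis .
qed

lemma integrable_mult_bounded:
  fixes X Y :: "'a \<Rightarrow> real"
  assumes "integrable M X" "Y \<in> borel_measurable M" "\<And>w. w \<in> space M \<Longrightarrow> \<bar>Y w\<bar> \<le> C"
  shows "integrable M (\<lambda>w. X w * Y w)"
proof (rule Bochner_Integration.integrable_bound)
  show "integrable M (\<lambda>w. C * X w)"
    using assms(1) by simp
  show "(\<lambda>w. X w * Y w) \<in> borel_measurable M"
    using assms(1,2) by measurable
  have "\<bar>X w * Y w\<bar> \<le> \<bar>C * X w\<bar>" if "w \<in> space M" for w
  proof -
    have "\<bar>X w * Y w\<bar> = \<bar>X w\<bar> * \<bar>Y w\<bar>"
      by (simp add: abs_mult)
    also have "\<dots> \<le> \<bar>X w\<bar> * \<bar>C\<bar>"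
      using assms(3)[OF that] by (intro mult_left_mono) auto
    finally show ?thesis
      by (simp add: abs_mult mult.commute)
  qed
  then show "AE w in M. norm (X w * Y w) \<le> norm (C * X w)"
    by simp
qed

lemma power_le_1_plus_power4:
  fixes x :: real
  assumes "j \<le> 4"
  shows "\<bar>x ^ j\<bar> \<le> 1 + x ^ 4"
proof (cases "\<bar>x\<bar> \<le> 1")
  case True
  have "\<bar>x ^ j\<bar> \<le> 1"
    using True by (simp add: power_abs power_le_one)
  moreover have "0 \<le> x ^ 4"
    by simp
  ultimately show ?thesis
    by linarith
next
  case False
  then have "\<bar>x\<bar> ^ j \<le> \<bar>x\<bar> ^ 4"
    using assms by (intro power_increasing) auto
  then show ?thesis
    by (simp add: power_abs)
qed

lemma integrable_power_le_4:
  fixes X :: "'a \<Rightarrow> real"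
  assumes X: "X \<in> borel_measurable M" "integrable M (\<lambda>w. X w ^ 4)" and "j \<le> 4"
  shows "integrable M (\<lambda>w. X w ^ j)"
proof (rule Bochner_Integration.integrable_bound)
  show "integrable M (\<lambda>w. 1 + X w ^ 4)"
    using X by simp
  show "AE w in M. norm (X w ^ j) \<le> norm (1 + X w ^ 4)"
    using power_le_1_plus_power4[OF assms(3), of "X _"] by (auto simp: abs_of_nonneg)
qed (use X in measurable)

lemma integrable_power_mult_bounded:
  fixes X Y :: "'a \<Rightarrow> real"
  assumes "X \<in> borel_measurable M" "integrable M (\<lambda>w. X w ^ 4)" "j \<le> 4"
    and "Y \<in> borel_measurable M" "\<And>w. w \<in> space M \<Longrightarrow> \<bar>Y w\<bar> \<le> C"
  shows "integrable M (\<lambda>w. X w ^ j * Y w ^ l)"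
proof (rule integrable_mult_bounded)
  show "integrable M (\<lambda>w. X w ^ j)"
    by (rule integrable_power_le_4) fact+
  show "\<bar>Y w ^ l\<bar> \<le> C ^ l" if "w \<in> space M" for w
    unfolding power_abs using assms(5)[OF that] by (rule power_mono) simp
qed (use assms in measurable)

lemma measurable_stoch_sum_M:
  assumes "simple_integrand F m p \<xi>"
  shows "stoch_sum m p \<xi> \<in> borel_measurable M"
  using measurable_F_M[OF measurable_stoch_sum[OF assms order_refl]] .

lemma measurable_quad_sum_M:
  assumes "simple_integrand F m p \<xi>"
  shows "quad_sum m p \<xi> \<in> borel_measurable M"
  using measurable_F_M[OF measurable_quad_sum[OF assms]] by (cases m) auto

lemma uniform_bound:
  assumes "simple_integrand F m p \<xi>"
  obtains C where "0 \<le> C" "\<And>i w. i < m \<Longrightarrow> w \<in> space M \<Longrightarrow> \<bar>\<xi> i w\<bar> \<le> C"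
proof -
  obtain c where c: "\<And>i. i < m \<Longrightarrow> 0 \<le> c i \<and> (\<forall>w\<in>space M. \<bar>\<xi> i w\<bar> \<le> c i)"
    using simple_integrandD(4)[OF assms] by metis
  have "\<bar>\<xi> i w\<bar> \<le> (\<Sum>i<m. c i)" if "i < m" "w \<in> space M" for i w
    using c that member_le_sum[of i "{..<m}" c] by (meson finite_lessThan lessThan_iff DiffE order_trans)
  moreover have "0 \<le> (\<Sum>i<m. c i)"
    using c by (intro sum_nonneg) auto
  ultimately show thesis
    using that by blast
qed

lemma integrable_quad_sum:
  assumes "simple_integrand F m p \<xi>"
  shows "integrable M (quad_sum m p \<xi>)"
proof -
  obtain C where "0 \<le> C" "\<And>i w. i < m \<Longrightarrow> w \<in> space M \<Longrightarrow> \<bar>\<xi> i w\<bar> \<le> C"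
    using uniform_bound[OF assms] by blast
  then show ?thesis
    using quad_sum_le[OF assms] quad_sum_nonneg[OF assms] measurable_quad_sum_M[OF assms]
    by (intro integrable_const_bound[where B="C\<^sup>2 * (p m - p 0)"]) auto
qed

text \<open>Induction on the number of intervals. The new sum is a + x * d with a and x known at
  \<open>p m\<close> and d the next Brownian increment; by independence the powers of d factor out
  of the expectations, and the odd ones have mean zero.\<close>

lemma stoch_sum_moments:
  assumes "simple_integrand F m p \<xi>"
  shows "integrable M (\<lambda>w. stoch_sum m p \<xi> w ^ 4)"
    and "(\<integral>w. stoch_sum m p \<xi> w \<partial>M) = 0"
    and "(\<integral>w. (stoch_sum m p \<xi> w)\<^sup>2 \<partial>M) = (\<integral>w. quad_sum m p \<xi> w \<partial>M)"
    and "(\<And>i w. i < m \<Longrightarrow> w \<in> space M \<Longrightarrow> \<bar>\<xi> i w\<bar> \<le> C) \<Longrightarrow>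
      (\<integral>w. stoch_sum m p \<xi> w ^ 4 \<partial>M) \<le> 3 * C ^ 4 * (p m - p 0)\<^sup>2"
proof -
  have "integrable M (\<lambda>w. stoch_sum m p \<xi> w ^ 4) \<and>
      (\<integral>w. stoch_sum m p \<xi> w \<partial>M) = 0 \<and>
      (\<integral>w. (stoch_sum m p \<xi> w)\<^sup>2 \<partial>M) = (\<integral>w. quad_sum m p \<xi> w \<partial>M) \<and>
      ((\<forall>i<m. \<forall>w\<in>space M. \<bar>\<xi> i w\<bar> \<le> C) \<longrightarrow>
        (\<integral>w. stoch_sum m p \<xi> w ^ 4 \<partial>M) \<le> 3 * C ^ 4 * (p m - p 0)\<^sup>2)"
    using assms
  proof (induction m)
    case (Suc m)
    have si: "simple_integrand F m p \<xi>"
      using simple_integrand_take[OF Suc.prems, of m] by simp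
    note D = simple_integrandD[OF Suc.prems]
    define a where "a = stoch_sum m p \<xi>"
    define x where "x = \<xi> m"
    define d where "d w = B (p (Suc m)) w - B (p m) w" for w
    define v where "v = p (Suc m) - p m"
    have le: "0 \<le> p m" "p m \<le> p (Suc m)" and v: "0 \<le> v"
      using D(1)[of m "Suc m"] D(2)[of m] by (auto simp: v_def)
    have aF: "a \<in> borel_measurable (F (p m))" and aM: "a \<in> borel_measurable M"
      unfolding a_def by (rule measurable_stoch_sum[OF si order_refl], rule measurable_stoch_sum_M[OF si])
    have xF: "x \<in> borel_measurable (F (p m))"
      unfolding x_def using D(3) by simp
    have xM: "x \<in> borel_measurable M"
      by (rule measurable_F_M[OF xF])
    obtain C' where C': "\<And>w. w \<in> space M \<Longrightarrow> \<bar>x w\<bar> \<le> C'"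
      using D(4)[of m] by (auto simp: x_def)
    have IH: "integrable M (\<lambda>w. a w ^ 4)" "(\<integral>w. a w \<partial>M) = 0"
      "(\<integral>w. (a w)\<^sup>2 \<partial>M) = (\<integral>w. quad_sum m p \<xi> w \<partial>M)"
      "(\<forall>i<m. \<forall>w\<in>space M. \<bar>\<xi> i w\<bar> \<le> C) \<Longrightarrow> (\<integral>w. a w ^ 4 \<partial>M) \<le> 3 * C ^ 4 * (p m - p 0)\<^sup>2"
      using Suc.IH[OF si] by (auto simp: a_def)
    have int: "integrable M (\<lambda>w. a w ^ j * x w ^ l)" if "j \<le> 4" for j l
      by (rule integrable_power_mult_bounded[OF aM IH(1) that xM C'])
    have mF: "(\<lambda>w. a w ^ j * x w ^ l) \<in> borel_measurable (F (p m))" for j l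
      using aF xF by measurable
    have I: "integrable M (\<lambda>w. a w ^ j * x w ^ l * d w ^ k)"
      "(\<integral>w. a w ^ j * x w ^ l * d w ^ k \<partial>M) = (\<integral>w. a w ^ j * x w ^ l \<partial>M) * gauss_moment k v"
      if "j \<le> 4" for j l k
      unfolding d_def v_def by (intro mult_increment_moment le mF int that)+
    have hb: "has_bochner_integral M (\<lambda>w. a w ^ j * x w ^ l * d w ^ k)
        ((\<integral>w. a w ^ j * x w ^ l \<partial>M) * gauss_moment k v)" if "j \<le> 4" for j l k
      using I[OF that, of l k] by (simp add: has_bochner_integral_iff)
    have hb_mult: "has_bochner_integral M (\<lambda>w. c * f w) (c * r)"
      if "has_bochner_integral M f r" for f and c r :: real
      using that by (intro has_bochner_integral_mult_right) auto
    have eq: "stoch_sum (Suc m) p \<xi> w = a w + x w * d w" for w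
      by (simp add: wsum_Suc a_def x_def d_def)
    \<comment> \<open>The trivial powers are written out so that every summand is an instance of
      \<open>hb\<close>.\<close>
    have e2: "(a w + x w * d w)\<^sup>2 = a w ^ 2 * x w ^ 0 * d w ^ 0 + 2 * (a w ^ 1 * x w ^ 1 * d w ^ 1)
        + a w ^ 0 * x w ^ 2 * d w ^ 2" for w
      by (simp add: power2_eq_square algebra_simps)
    have e4: "(a w + x w * d w) ^ 4 = a w ^ 4 * x w ^ 0 * d w ^ 0 + 4 * (a w ^ 3 * x w ^ 1 * d w ^ 1)
        + 6 * (a w ^ 2 * x w ^ 2 * d w ^ 2) + 4 * (a w ^ 1 * x w ^ 3 * d w ^ 3)
        + a w ^ 0 * x w ^ 4 * d w ^ 4" for w
      by (simp add: power4_eq_xxxx power2_eq_square power3_eq_cube algebra_simps)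
    have E1: "has_bochner_integral M (\<lambda>w. a w ^ 1 * x w ^ 0 * d w ^ 0 + a w ^ 0 * x w ^ 1 * d w ^ 1)
       ((\<integral>w. a w ^ 1 * x w ^ 0 \<partial>M) * gauss_moment 0 v + (\<integral>w. a w ^ 0 * x w ^ 1 \<partial>M) * gauss_moment 1 v)"
      by (intro has_bochner_integral_add hb) auto
    have E2: "has_bochner_integral M (\<lambda>w. (a w + x w * d w)\<^sup>2)
       ((\<integral>w. a w ^ 2 * x w ^ 0 \<partial>M) * gauss_moment 0 v
        + 2 * ((\<integral>w. a w ^ 1 * x w ^ 1 \<partial>M) * gauss_moment 1 v)
        + (\<integral>w. a w ^ 0 * x w ^ 2 \<partial>M) * gauss_moment 2 v)"
      unfolding e2 by (intro has_bochner_integral_add hb_mult hb) auto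
    have E4: "has_bochner_integral M (\<lambda>w. (a w + x w * d w) ^ 4)
       ((\<integral>w. a w ^ 4 * x w ^ 0 \<partial>M) * gauss_moment 0 v
        + 4 * ((\<integral>w. a w ^ 3 * x w ^ 1 \<partial>M) * gauss_moment 1 v)
        + 6 * ((\<integral>w. a w ^ 2 * x w ^ 2 \<partial>M) * gauss_moment 2 v)
        + 4 * ((\<integral>w. a w ^ 1 * x w ^ 3 \<partial>M) * gauss_moment 3 v)
        + (\<integral>w. a w ^ 0 * x w ^ 4 \<partial>M) * gauss_moment 4 v)"
      unfolding e4 by (intro has_bochner_integral_add hb_mult hb) auto
    have i4: "integrable M (\<lambda>w. stoch_sum (Suc m) p \<xi> w ^ 4)"
      unfolding eq using E4 by (rule integrable.intros)
    have m1: "(\<integral>w. stoch_sum (Suc m) p \<xi> w \<partial>M) = 0"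
      unfolding eq using has_bochner_integral_integral_eq[OF E1] IH(2)
      by (simp add: gauss_moment_simps)
    have m2: "(\<integral>w. (stoch_sum (Suc m) p \<xi> w)\<^sup>2 \<partial>M) = (\<integral>w. quad_sum (Suc m) p \<xi> w \<partial>M)"
    proof -
      have "integrable M (\<lambda>w. (x w)\<^sup>2)"
        using int[of 0 2] by simp
      then have "(\<integral>w. quad_sum (Suc m) p \<xi> w \<partial>M)
          = (\<integral>w. quad_sum m p \<xi> w \<partial>M) + (\<integral>w. (x w)\<^sup>2 \<partial>M) * v"
        unfolding wsum_Suc x_def[symmetric] v_def[symmetric]
        using integrable_quad_sum[OF si] by (simp add: x_def)
      then show ?thesis
        unfolding eq using has_bochner_integral_integral_eq[OF E2] IH(3)
        by (simp add: gauss_moment_simps)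
    qed
    have m4: "(\<integral>w. stoch_sum (Suc m) p \<xi> w ^ 4 \<partial>M) \<le> 3 * C ^ 4 * (p (Suc m) - p 0)\<^sup>2"
      if C: "\<forall>i<Suc m. \<forall>w\<in>space M. \<bar>\<xi> i w\<bar> \<le> C"
    proof -
      let ?r = "p m - p 0"
      have x2: "(x w)\<^sup>2 \<le> C\<^sup>2" if "w \<in> space M" for w
        using C that by (metis abs_ge_zero lessI power2_abs power_mono x_def)
      have x4: "x w ^ 4 \<le> C ^ 4" if "w \<in> space M" for w
        using power_mono[OF x2[OF that], of 2] by (simp add: power_mult[symmetric])
      \<comment> \<open>The mixed term: \<open>x\<close> squared is at most
        \<open>C\<^sup>2\<close>, and by the isometry the second moment of \<open>a\<close> is at
        most \<open>C\<^sup>2 * ?r\<close>.\<close>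
      have "(\<integral>w. a w ^ 2 * x w ^ 2 \<partial>M) \<le> (\<integral>w. C\<^sup>2 * (a w)\<^sup>2 \<partial>M)"
        using x2 int[of 2 2] int[of 2 0]
        by (intro integral_mono) (auto simp: mult.commute[of "C\<^sup>2"] intro: mult_left_mono)
      also have "\<dots> \<le> C\<^sup>2 * (C\<^sup>2 * ?r)"
      proof -
        have "(\<integral>w. quad_sum m p \<xi> w \<partial>M) \<le> (\<integral>w. C\<^sup>2 * ?r \<partial>M)"
          using C by (intro integral_mono integrable_quad_sum[OF si] quad_sum_le[OF si]) auto
        then have "(\<integral>w. quad_sum m p \<xi> w \<partial>M) \<le> C\<^sup>2 * ?r"
          by (simp add: prob_space)
        from mult_left_mono[OF this, of "C\<^sup>2"] show ?thesis
          using IH(3) by simp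
      qed
      finally have "(\<integral>w. a w ^ 2 * x w ^ 2 \<partial>M) \<le> C ^ 4 * ?r"
        by (simp add: power4_eq_xxxx power2_eq_square mult.assoc)
      then have "6 * v * (\<integral>w. a w ^ 2 * x w ^ 2 \<partial>M) \<le> 6 * v * (C ^ 4 * ?r)"
        using v by (intro mult_left_mono) auto
      moreover have "(\<integral>w. x w ^ 4 \<partial>M) \<le> (\<integral>w. C ^ 4 \<partial>M)"
        using int[of 0 4] by (intro integral_mono x4) auto
      then have "3 * v\<^sup>2 * (\<integral>w. x w ^ 4 \<partial>M) \<le> 3 * v\<^sup>2 * C ^ 4"
        by (intro mult_left_mono) (auto simp: prob_space)
      moreover have "(\<integral>w. stoch_sum (Suc m) p \<xi> w ^ 4 \<partial>M) = (\<integral>w. a w ^ 4 \<partial>M)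
          + 6 * v * (\<integral>w. a w ^ 2 * x w ^ 2 \<partial>M) + 3 * v\<^sup>2 * (\<integral>w. x w ^ 4 \<partial>M)"
        unfolding eq using has_bochner_integral_integral_eq[OF E4]
        by (simp add: gauss_moment_simps)
      moreover have "(\<integral>w. a w ^ 4 \<partial>M) \<le> 3 * C ^ 4 * ?r\<^sup>2"
        using IH(4) C by simp
      \<comment> \<open>The coefficients 3, 6, 3 complete a square, so the bound with factor 3
        reproduces itself in the induction.\<close>
      moreover have "3 * C ^ 4 * ?r\<^sup>2 + 6 * v * (C ^ 4 * ?r) + 3 * v\<^sup>2 * C ^ 4
          = 3 * C ^ 4 * (p (Suc m) - p 0)\<^sup>2"
        by (simp add: v_def power2_eq_square algebra_simps)
      ultimately show ?thesis
        by linarith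
    qed
    show ?case
      using i4 m1 m2 m4 by blast
  qed simp
  then show "integrable M (\<lambda>w. stoch_sum m p \<xi> w ^ 4)"
    and "(\<integral>w. stoch_sum m p \<xi> w \<partial>M) = 0"
    and "(\<integral>w. (stoch_sum m p \<xi> w)\<^sup>2 \<partial>M) = (\<integral>w. quad_sum m p \<xi> w \<partial>M)"
    and "(\<And>i w. i < m \<Longrightarrow> w \<in> space M \<Longrightarrow> \<bar>\<xi> i w\<bar> \<le> C) \<Longrightarrow>
      (\<integral>w. stoch_sum m p \<xi> w ^ 4 \<partial>M) \<le> 3 * C ^ 4 * (p m - p 0)\<^sup>2"
    by auto
qed

lemma simple_integrand_weight:
  assumes si: "simple_integrand F m p \<xi>" and s: "s \<le> p 0"
    and \<zeta>: "\<zeta> \<in> borel_measurable (F s)" "\<And>w. w \<in> space M \<Longrightarrow> \<bar>\<zeta> w\<bar> \<le> c" "0 \<le> c"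
  shows "simple_integrand F m p (\<lambda>i w. \<zeta> w * \<xi> i w)"
proof (rule simple_integrand_cong_bound[OF si _ _ \<zeta>(3)])
  fix i assume i: "i < m"
  have "s \<le> p i"
    using s simple_integrandD(1)[OF si, of 0 i] i by simp
  then show "(\<lambda>w. \<zeta> w * \<xi> i w) \<in> borel_measurable (F (p i))"
    by (intro borel_measurable_times measurable_F_mono[OF \<zeta>(1)] simple_integrandD(3)[OF si i])
  show "\<bar>\<zeta> w * \<xi> i w\<bar> \<le> c * \<bar>\<xi> i w\<bar>" if "w \<in> space M" for w
    unfolding abs_mult using \<zeta>(2)[OF that] by (intro mult_right_mono) auto
qed

lemma wsum_scale: "wsum g m p (\<lambda>i. c * a i) = c * wsum g m p a"
  by (simp add: wsum_def sum_distrib_left mult.assoc)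

text \<open>Conditional versions of the mean and of the isometry: a weight known at time
  \<open>s\<close>, before the first partition point, may be absorbed into the coefficients. In the
  isometry the absorbed factor is sqrt \<zeta>, whence the sign condition.\<close>

lemma stoch_sum_weighted:
  assumes si: "simple_integrand F m p \<xi>" and s: "s \<le> p 0"
    and \<zeta>: "\<zeta> \<in> borel_measurable (F s)" "\<And>w. w \<in> space M \<Longrightarrow> \<bar>\<zeta> w\<bar> \<le> c"
  shows "(\<integral>w. \<zeta> w * stoch_sum m p \<xi> w \<partial>M) = 0"
    and "(\<And>w. w \<in> space M \<Longrightarrow> 0 \<le> \<zeta> w) \<Longrightarrow>
      (\<integral>w. \<zeta> w * (stoch_sum m p \<xi> w)\<^sup>2 \<partial>M) = (\<integral>w. \<zeta> w * quad_sum m p \<xi> w \<partial>M)"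
proof -
  obtain w0 where "w0 \<in> space M"
    using not_empty by blast
  then have c: "0 \<le> c"
    using \<zeta>(2)[of w0] by linarith
  show "(\<integral>w. \<zeta> w * stoch_sum m p \<xi> w \<partial>M) = 0"
    using stoch_sum_moments(2)[OF simple_integrand_weight[OF si s \<zeta> c]] by (simp add: wsum_scale)
  assume nonneg: "\<And>w. w \<in> space M \<Longrightarrow> 0 \<le> \<zeta> w"
  have m: "(\<lambda>w. sqrt (\<zeta> w)) \<in> borel_measurable (F s)"
    using \<zeta>(1) by measurable
  have b: "\<bar>sqrt (\<zeta> w)\<bar> \<le> sqrt c" if "w \<in> space M" for w
    using nonneg[OF that] \<zeta>(2)[OF that] by simp
  have "(\<integral>w. (sqrt (\<zeta> w) * stoch_sum m p \<xi> w)\<^sup>2 \<partial>M)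
      = (\<integral>w. (sqrt (\<zeta> w))\<^sup>2 * quad_sum m p \<xi> w \<partial>M)"
    using stoch_sum_moments(3)[OF simple_integrand_weight[OF si s m b]] c
    by (simp add: wsum_scale power_mult_distrib)
  also have "(\<integral>w. (sqrt (\<zeta> w) * stoch_sum m p \<xi> w)\<^sup>2 \<partial>M)
      = (\<integral>w. \<zeta> w * (stoch_sum m p \<xi> w)\<^sup>2 \<partial>M)"
    using nonneg by (intro Bochner_Integration.integral_cong) (auto simp: power_mult_distrib)
  also have "(\<integral>w. (sqrt (\<zeta> w))\<^sup>2 * quad_sum m p \<xi> w \<partial>M)
      = (\<integral>w. \<zeta> w * quad_sum m p \<xi> w \<partial>M)"
    using nonneg by (intro Bochner_Integration.integral_cong) auto
  finally show "(\<integral>w. \<zeta> w * (stoch_sum m p \<xi> w)\<^sup>2 \<partial>M) = (\<integral>w. \<zeta> w * quad_sum m p \<xi> w \<partial>M)" .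
qed

text \<open>The coefficients are switched off as soon as the quadratic sum exceeds \<open>\<eta>\<close>; since they are
  fixed at the left end of each interval, the truncated process is adapted.\<close>

lemma stoch_sum_tail:
  assumes si: "simple_integrand F m p \<xi>" and "0 < \<epsilon>" "0 < \<eta>"
  shows "prob {w\<in>space M. \<epsilon> < \<bar>stoch_sum m p \<xi> w\<bar>}
    \<le> prob {w\<in>space M. \<eta> < quad_sum m p \<xi> w} + \<eta> / \<epsilon>\<^sup>2"
proof -
  define \<xi>' where "\<xi>' i w = of_bool (quad_sum (Suc i) p \<xi> w \<le> \<eta>) * \<xi> i w" for i w
  have si': "simple_integrand F m p \<xi>'"
  proof (rule simple_integrand_cong_bound[OF si])
    fix i assume i: "i < m"
    have [measurable]: "quad_sum (Suc i) p \<xi> \<in> borel_measurable (F (p i))" "\<xi> i \<in> borel_measurable (F (p i))"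
      by (rule measurable_quad_sum[OF si i], rule simple_integrandD(3)[OF si i])
    show "\<xi>' i \<in> borel_measurable (F (p i))"
      unfolding \<xi>'_def by measurable
    show "\<bar>\<xi>' i w\<bar> \<le> 1 * \<bar>\<xi> i w\<bar>" for w
      by (simp add: \<xi>'_def)
  qed simp
  have quad': "quad_sum n p \<xi>' w \<le> min \<eta> (quad_sum n p \<xi> w)" if "n \<le> m" for n w
    using that
  proof (induction n)
    case 0
    then show ?case
      using \<open>0 < \<eta>\<close> by simp
  next
    case (Suc n)
    have "quad_sum n p \<xi> w \<le> quad_sum (Suc n) p \<xi> w"
      using Suc.prems by (intro quad_sum_mono[OF si]) auto
    then show ?case
      using Suc by (auto simp: wsum_Suc \<xi>'_def)
  qed
  have eq: "stoch_sum m p \<xi>' w = stoch_sum m p \<xi> w" if "quad_sum m p \<xi> w \<le> \<eta>" for w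
  proof -
    have "\<xi>' i w = \<xi> i w" if "i < m" for i
      using quad_sum_mono[OF si, of "Suc i" m w] that \<open>quad_sum m p \<xi> w \<le> \<eta>\<close> by (simp add: \<xi>'_def)
    then show ?thesis
      by (simp add: wsum_def)
  qed
  note [measurable] = measurable_stoch_sum_M[OF si] measurable_stoch_sum_M[OF si'] measurable_quad_sum_M[OF si]
  \<comment> \<open>Where the quadratic sum stays below \<open>\<eta>\<close>, the original and the
    truncated sum coincide. Chebyshev's inequality is applied only to the truncated one, whose
    second moment is at most \<open>\<eta>\<close> by \<open>quad'\<close> and the isometry.\<close>
  have "prob {w\<in>space M. \<epsilon> < \<bar>stoch_sum m p \<xi> w\<bar>}
      \<le> prob ({w\<in>space M. \<eta> < quad_sum m p \<xi> w} \<union> {w\<in>space M. \<epsilon>\<^sup>2 \<le> (stoch_sum m p \<xi>' w)\<^sup>2})"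
  proof (intro finite_measure_mono subsetI)
    fix w assume w: "w \<in> {w\<in>space M. \<epsilon> < \<bar>stoch_sum m p \<xi> w\<bar>}"
    show "w \<in> {w\<in>space M. \<eta> < quad_sum m p \<xi> w} \<union> {w\<in>space M. \<epsilon>\<^sup>2 \<le> (stoch_sum m p \<xi>' w)\<^sup>2}"
    proof (cases "quad_sum m p \<xi> w \<le> \<eta>")
      case True
      have "\<epsilon>\<^sup>2 \<le> \<bar>stoch_sum m p \<xi> w\<bar>\<^sup>2"
        using w \<open>0 < \<epsilon>\<close> by (intro power_mono) auto
      then show ?thesis
        using w eq[OF True] by simp
    qed (use w in auto)
  qed measurable
  also have "\<dots> \<le> prob {w\<in>space M. \<eta> < quad_sum m p \<xi> w} + prob {w\<in>space M. \<epsilon>\<^sup>2 \<le> (stoch_sum m p \<xi>' w)\<^sup>2}"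
    by (intro measure_Un_le) measurable
  also have "prob {w\<in>space M. \<epsilon>\<^sup>2 \<le> (stoch_sum m p \<xi>' w)\<^sup>2} \<le> \<eta> / \<epsilon>\<^sup>2"
  proof -
    have "prob {w\<in>space M. \<epsilon>\<^sup>2 \<le> (stoch_sum m p \<xi>' w)\<^sup>2} \<le> (\<integral>w. (stoch_sum m p \<xi>' w)\<^sup>2 \<partial>M) / \<epsilon>\<^sup>2"
    proof (rule integral_Markov_inequality_measure[where A = "{}"])
      show "integrable M (\<lambda>w. (stoch_sum m p \<xi>' w)\<^sup>2)"
        by (rule integrable_power_le_4[OF measurable_stoch_sum_M[OF si'] stoch_sum_moments(1)[OF si']]) simp
    qed (use \<open>0 < \<epsilon>\<close> in simp_all)
    also have "(\<integral>w. (stoch_sum m p \<xi>' w)\<^sup>2 \<partial>M) = (\<integral>w. quad_sum m p \<xi>' w \<partial>M)"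
      by (rule stoch_sum_moments(3)[OF si'])
    also have "\<dots> / \<epsilon>\<^sup>2 \<le> (\<integral>w. \<eta> \<partial>M) / \<epsilon>\<^sup>2"
      using quad'[OF order_refl]
      by (intro divide_right_mono integral_mono integrable_quad_sum[OF si']) auto
    finally show ?thesis
      by (simp add: prob_space)
  qed
  finally show ?thesis
    by simp
qed

end

section \<open>Operations on simple processes: maps, L2 norms, differences and restriction in
  time\<close>

lemma wsum_diff: "wsum g m p (\<lambda>i. a i - b i) = wsum g m p a - wsum g m p b"
  by (simp add: wsum_def sum_subtractf left_diff_distrib)

lemma wsum_cong:
  assumes "\<And>i. i < m \<Longrightarrow> a i * (g (p (Suc i)) - g (p i)) = b i * (h (q (Suc i)) - h (q i))"
  shows "wsum g m p a = wsum h m q b"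
  unfolding wsum_def using assms by (intro sum.cong) auto

lemma wsum_diff_left: "wsum (\<lambda>x. g x - h x) m p a = wsum g m p a - wsum h m p a"
  by (simp add: wsum_def sum_subtractf[symmetric] algebra_simps)

text \<open>The intervals are disjoint, so at each time at most one summand is nonzero, and
  \<open>f\<close> with \<open>f 0 = 0\<close> acts on that summand alone. The induction carries
  along that the process vanishes after its last partition point.\<close>

lemma simple_process_map:
  assumes mono: "\<And>i. i < m \<Longrightarrow> p i \<le> p (Suc i)" and "f 0 = 0"
  shows "simple_process m p (\<lambda>i w. f (\<xi> i w)) r w = f (simple_process m p \<xi> r w)"
proof -
  have "(p m < r \<longrightarrow> (\<forall>\<zeta> :: nat \<Rightarrow> 'a \<Rightarrow> real. simple_process m p \<zeta> r w = 0)) \<and>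
    simple_process m p (\<lambda>i w. f (\<xi> i w)) r w = f (simple_process m p \<xi> r w)"
    using mono
  proof (induction m)
    case (Suc m)
    have le: "p m \<le> p (Suc m)" and IH: "p m < r \<longrightarrow> (\<forall>\<zeta> :: nat \<Rightarrow> 'a \<Rightarrow> real. simple_process m p \<zeta> r w = 0)"
      "simple_process m p (\<lambda>i w. f (\<xi> i w)) r w = f (simple_process m p \<xi> r w)"
      using Suc.IH Suc.prems by simp_all
    have step: "simple_process (Suc m) p \<zeta> r w
        = simple_process m p \<zeta> r w + \<zeta> m w * indicator {p m<..p (Suc m)} r"
      for \<zeta> :: "nat \<Rightarrow> 'a \<Rightarrow> real"
      by (simp add: simple_process_def)
    show ?case
      unfolding step using IH le assms(2) by (auto simp: indicator_def)
  qed (simp add: simple_process_def assms(2))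
  then show ?thesis
    by blast
qed

lemma simple_process_outside:
  assumes "\<And>i. i \<le> m \<Longrightarrow> s \<le> p i \<and> p i \<le> t" "r \<notin> {s..t}"
  shows "simple_process m p \<xi> r w = 0"
  unfolding simple_process_def
proof (rule sum.neutral, intro ballI)
  fix i assume "i \<in> {..<m}"
  then show "\<xi> i w * indicator {p i<..p (Suc i)} r = 0"
    using assms(1)[of i] assms(1)[of "Suc i"] assms(2) by (auto simp: indicator_def)
qed

context brownian_motion
begin

lemma simple_process_wsum:
  assumes "simple_integrand F m p \<xi>"
  shows "simple_process m p \<xi> r w = wsum (\<lambda>x. of_bool (r \<le> x)) m p (\<lambda>i. \<xi> i w)"
  using simple_integrandD(1)[OF assms] by (intro simple_process_eq_wsum) simp

text \<open>Disjointness of the intervals kills the mixed terms of the square. The identity converts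
  closeness of processes in L2 of time into smallness of quadratic sums.\<close>

lemma nn_integral_simple_process_sq:
  assumes si: "simple_integrand F m p \<xi>"
  shows "(\<integral>\<^sup>+r. ennreal ((simple_process m p \<xi> r w)\<^sup>2) \<partial>lborel) = ennreal (quad_sum m p \<xi> w)"
proof -
  note mono = simple_integrandD(1)[OF si]
  have "(\<integral>\<^sup>+r. ennreal ((simple_process m p \<xi> r w)\<^sup>2) \<partial>lborel)
      = (\<integral>\<^sup>+r. (\<Sum>i<m. ennreal ((\<xi> i w)\<^sup>2) * indicator {p i<..p (Suc i)} r) \<partial>lborel)"
  proof (rule nn_integral_cong)
    fix r
    have "(simple_process m p \<xi> r w)\<^sup>2 = simple_process m p (\<lambda>i w. (\<xi> i w)\<^sup>2) r w"
      using mono by (subst simple_process_map[where f = "\<lambda>x. x\<^sup>2"]) auto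
    also have "ennreal \<dots> = (\<Sum>i<m. ennreal ((\<xi> i w)\<^sup>2) * indicator {p i<..p (Suc i)} r)"
      unfolding simple_process_def
      by (subst sum_ennreal[symmetric]) (auto simp: indicator_def intro!: sum.cong)
    finally show "ennreal ((simple_process m p \<xi> r w)\<^sup>2)
      = (\<Sum>i<m. ennreal ((\<xi> i w)\<^sup>2) * indicator {p i<..p (Suc i)} r)" .
  qed
  also have "\<dots> = (\<Sum>i<m. ennreal ((\<xi> i w)\<^sup>2) * emeasure lborel {p i<..p (Suc i)})"
    by (subst nn_integral_sum) (auto simp: nn_integral_cmult)
  also have "\<dots> = (\<Sum>i<m. ennreal ((\<xi> i w)\<^sup>2 * (p (Suc i) - p i)))"
    using mono by (intro sum.cong) (auto simp: ennreal_mult)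
  also have "\<dots> = ennreal (quad_sum m p \<xi> w)"
    unfolding wsum_def using mono by (intro sum_ennreal) auto
  finally show ?thesis .
qed

text \<open>Both processes are rewritten on the common refinement of their partitions. Since the
  identity holds for every \<open>g\<close>, it describes the difference process and its stochastic
  sum simultaneously.\<close>

lemma simple_integrand_difference:
  assumes si: "simple_integrand F m p \<xi>" and si': "simple_integrand F m' p' \<xi>'"
    and A: "\<And>i. i \<le> m \<Longrightarrow> p i \<in> A" "\<And>i. i \<le> m' \<Longrightarrow> p' i \<in> A"
  shows "\<exists>n q \<eta>. simple_integrand F n q \<eta> \<and> (\<forall>i\<le>n. q i \<in> A) \<and>
    (\<forall>g w. wsum g n q (\<lambda>i. \<eta> i w) = wsum g m p (\<lambda>i. \<xi> i w) - wsum g m' p' (\<lambda>i. \<xi>' i w))"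
proof -
  let ?P = "p ` {..m} \<union> p' ` {..m'}"
  obtain n and q :: "nat \<Rightarrow> real" where q: "q ` {..n} = ?P" "\<And>i j. i < j \<Longrightarrow> j \<le> n \<Longrightarrow> q i < q j"
    by (rule enumerate_finite_set[of ?P]) auto
  have qP: "q i \<in> ?P" if "i \<le> n" for i
    using q(1) that by (metis atMost_iff imageI)
  define \<psi> where "\<psi> m p \<xi> j w = (\<Sum>i<m. \<xi> i w * of_bool (p i < q (Suc j) \<and> q (Suc j) \<le> p (Suc i)))"
    for m p and \<xi> :: "nat \<Rightarrow> 'a \<Rightarrow> real" and j w
  have \<psi>: "\<psi> m p \<xi> j \<in> borel_measurable (F (q j))" "\<exists>C. \<forall>w\<in>space M. \<bar>\<psi> m p \<xi> j w\<bar> \<le> C"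
    if si: "simple_integrand F m p \<xi>" and P: "p ` {..m} \<subseteq> ?P" and j: "j < n" for m p \<xi> j
  proof -
    show "\<psi> m p \<xi> j \<in> borel_measurable (F (q j))"
      unfolding \<psi>_def
    proof (rule borel_measurable_sum)
      fix i assume i: "i \<in> {..<m}"
      show "(\<lambda>w. \<xi> i w * of_bool (p i < q (Suc j) \<and> q (Suc j) \<le> p (Suc i))) \<in> borel_measurable (F (q j))"
      proof (cases "p i < q (Suc j)")
        case True
        have "p i \<in> q ` {..n}"
          unfolding q(1) using i by (intro subsetD[OF P] imageI) simp
        then obtain l where l: "l \<le> n" "p i = q l"
          by auto
        \<comment> \<open>Adaptedness: \<open>p i\<close> is itself a grid point, so lying before
          \<open>q (Suc j)\<close> it lies at or before \<open>q j\<close>, and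
          \<open>\<xi> i\<close> is known there.\<close>
        have "l \<le> j"
        proof (rule ccontr)
          assume "\<not> l \<le> j"
          then have "q (Suc j) \<le> q l"
            using q(2)[of "Suc j" l] l(1) by (cases "l = Suc j") auto
          then show False
            using True l by simp
        qed
        then have "p i \<le> q j"
          using q(2)[of l j] j l by (cases "l = j") auto
        moreover have "\<xi> i \<in> borel_measurable (F (p i))"
          using i by (intro simple_integrandD(3)[OF si]) simp
        ultimately show ?thesis
          by (intro borel_measurable_times borel_measurable_const) (rule measurable_F_mono)
      qed simp
    qed
    obtain C where C: "0 \<le> C" "\<And>i w. i < m \<Longrightarrow> w \<in> space M \<Longrightarrow> \<bar>\<xi> i w\<bar> \<le> C"
      using uniform_bound[OF si] by blast
    have "\<bar>\<psi> m p \<xi> j w\<bar> \<le> (\<Sum>i<m. C)" if "w \<in> space M" for w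
      unfolding \<psi>_def using C that by (intro order_trans[OF sum_abs] sum_mono) (auto simp: abs_mult)
    then show "\<exists>C. \<forall>w\<in>space M. \<bar>\<psi> m p \<xi> j w\<bar> \<le> C"
      by blast
  qed
  have refine: "wsum g m p (\<lambda>i. \<xi> i w) = wsum g n q (\<lambda>j. \<psi> m p \<xi> j w)"
    if si: "simple_integrand F m p \<xi>" and P: "p ` {..m} \<subseteq> ?P" for m p \<xi> g w
    unfolding \<psi>_def
  proof (rule wsum_refine[OF q(2)])
    show "p i \<in> q ` {..n}" if "i \<le> m" for i
      unfolding q(1) using that by (intro subsetD[OF P] imageI) simp
    show "p i \<le> p (Suc i)" if "i < m" for i
      using simple_integrandD(1)[OF si, of i "Suc i"] that by simp
  qed
  let ?\<eta> = "\<lambda>j w. \<psi> m p \<xi> j w - \<psi> m' p' \<xi>' j w"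
  have "simple_integrand F n q ?\<eta>"
  proof (rule simple_integrandI)
    show "0 \<le> q 0"
      using qP[of 0] simple_integrandD(2)[OF si] simple_integrandD(2)[OF si'] by auto
    show "q i \<le> q (Suc i)" if "i < n" for i
      using q(2)[of i "Suc i"] that by simp
    fix j assume j: "j < n"
    show "?\<eta> j \<in> borel_measurable (F (q j))"
      by (intro borel_measurable_diff \<psi>(1)[OF si _ j] \<psi>(1)[OF si' _ j]) auto
    obtain C C' where "\<forall>w\<in>space M. \<bar>\<psi> m p \<xi> j w\<bar> \<le> C" "\<forall>w\<in>space M. \<bar>\<psi> m' p' \<xi>' j w\<bar> \<le> C'"
      using \<psi>(2)[OF si _ j] \<psi>(2)[OF si' _ j] by blast
    then have "\<forall>w\<in>space M. \<bar>?\<eta> j w\<bar> \<le> C + C'"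
      by (fastforce intro: order_trans[OF abs_triangle_ineq4])
    then show "\<exists>C. \<forall>w\<in>space M. \<bar>?\<eta> j w\<bar> \<le> C"
      by blast
  qed
  moreover have "\<forall>i\<le>n. q i \<in> A"
  proof (intro allI impI)
    fix i assume "i \<le> n"
    from qP[OF this] show "q i \<in> A"
      by (auto intro: A)
  qed
  moreover have "wsum g n q (\<lambda>i. ?\<eta> i w) = wsum g m p (\<lambda>i. \<xi> i w) - wsum g m' p' (\<lambda>i. \<xi>' i w)" for g w
    using refine[OF si, of g w] refine[OF si', of g w] by (simp add: wsum_diff)
  ultimately show ?thesis
    by (intro exI[of _ n] exI[of _ q] exI[of _ ?\<eta>]) simp
qed

lemma simple_integrand_restrict:
  assumes si: "simple_integrand F m p \<xi>" and st: "0 \<le> s" "s \<le> t"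
  shows "\<exists>n q \<eta>. simple_integrand F n q \<eta> \<and> (\<forall>i\<le>n. q i \<in> {s..t}) \<and>
    (\<forall>w. stoch_sum n q \<eta> w = simple_ito_integral B t m p \<xi> w - simple_ito_integral B s m p \<xi> w) \<and>
    (\<forall>r w. simple_process n q \<eta> r w = indicator {s<..t} r * simple_process m p \<xi> r w)"
proof -
  define q where "q i = max s (min t (p i))" for i
  \<comment> \<open>Intervals starting at or after \<open>t\<close> collapse to length zero, but
    their coefficients need not be measurable at time \<open>t\<close>; setting them to 0 restores
    adaptedness.\<close>
  define \<eta> where "\<eta> i w = of_bool (p i < t) * \<xi> i w" for i w
  note D = simple_integrandD[OF si]
  have mono: "p i \<le> p (Suc i)" if "i < m" for i
    using D(1)[of i "Suc i"] that by simp
  have si': "simple_integrand F m q \<eta>"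
  proof (rule simple_integrandI)
    show "0 \<le> q 0"
      using st by (simp add: q_def)
    fix i assume i: "i < m"
    show "q i \<le> q (Suc i)"
      using mono[OF i] unfolding q_def by (intro max.mono min.mono order_refl)
    show "\<eta> i \<in> borel_measurable (F (q i))"
    proof (cases "p i < t")
      case True
      then have "p i \<le> q i"
        by (simp add: q_def)
      then show ?thesis
        unfolding \<eta>_def by (intro borel_measurable_times measurable_F_mono[OF D(3)[OF i]]) auto
    qed (simp add: \<eta>_def[abs_def])
    obtain C where "\<forall>w\<in>space M. \<bar>\<xi> i w\<bar> \<le> C" "0 \<le> C"
      using D(4)[OF i] by blast
    then show "\<exists>C. \<forall>w\<in>space M. \<bar>\<eta> i w\<bar> \<le> C"
      by (intro exI[of _ C]) (auto simp: \<eta>_def)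
  qed
  have *: "wsum g m q (\<lambda>i. \<eta> i w) = wsum (\<lambda>x. g (max s (min t x))) m p (\<lambda>i. \<xi> i w)" for g w
  proof (rule wsum_cong)
    fix i assume i: "i < m"
    show "\<eta> i w * (g (q (Suc i)) - g (q i))
        = \<xi> i w * (g (max s (min t (p (Suc i)))) - g (max s (min t (p i))))"
      using mono[OF i] by (cases "p i < t") (auto simp: \<eta>_def q_def min_def)
  qed
  have "stoch_sum m q \<eta> w = simple_ito_integral B t m p \<xi> w - simple_ito_integral B s m p \<xi> w" for w
    unfolding * simple_ito_integral_eq_wsum wsum_diff_left[symmetric]
    using st by (intro wsum_cong arg_cong2[where f="(*)"] refl) (auto simp: max_def min_def)
  moreover have "simple_process m q \<eta> r w = indicator {s<..t} r * simple_process m p \<xi> r w" for r w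
    unfolding simple_process_wsum[OF si'] * simple_process_wsum[OF si] wsum_scale[symmetric]
    by (intro wsum_cong) (auto simp: max_def min_def indicator_def)
  ultimately show ?thesis
    using si' st by (intro exI[of _ m] exI[of _ q] exI[of _ \<eta>]) (auto simp: q_def)
qed

end

section \<open>Limits in probability of simple integrals\<close>

lemma ennreal_sq_diff_le:
  fixes a b c :: real
  shows "ennreal ((a - b)\<^sup>2) \<le> 2 * ennreal ((a - c)\<^sup>2) + 2 * ennreal ((b - c)\<^sup>2)"
proof -
  have "(a - b)\<^sup>2 \<le> 2 * (a - c)\<^sup>2 + 2 * (b - c)\<^sup>2"
    using sum_squares_ge_zero[of "a + b - 2 * c" 0] by (simp add: power2_eq_square algebra_simps)
  then have "ennreal ((a - b)\<^sup>2) \<le> ennreal (2 * (a - c)\<^sup>2 + 2 * (b - c)\<^sup>2)"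
    by (rule ennreal_leI)
  also have "\<dots> = 2 * ennreal ((a - c)\<^sup>2) + 2 * ennreal ((b - c)\<^sup>2)"
    by (simp add: ennreal_plus ennreal_mult)
  finally show ?thesis .
qed

context brownian_motion
begin

lemma prob_tendsto_0_union:
  assumes "\<And>k. A k \<subseteq> D k \<union> E k" "\<And>k. D k \<in> events" "\<And>k. E k \<in> events"
    and "(\<lambda>k. prob (D k)) \<longlonglongrightarrow> 0" "(\<lambda>k. prob (E k)) \<longlonglongrightarrow> 0"
  shows "(\<lambda>k. prob (A k)) \<longlonglongrightarrow> 0"
proof (rule tendsto_sandwich[where f = "\<lambda>_. 0"])
  show "\<forall>\<^sub>F k in sequentially. prob (A k) \<le> prob (D k) + prob (E k)"
  proof (intro always_eventually allI)
    fix k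
    have "prob (A k) \<le> prob (D k \<union> E k)"
      using assms by (intro finite_measure_mono) auto
    also have "\<dots> \<le> prob (D k) + prob (E k)"
      using assms by (intro measure_Un_le)
    finally show "prob (A k) \<le> prob (D k) + prob (E k)" .
  qed
  show "(\<lambda>k. prob (D k) + prob (E k)) \<longlonglongrightarrow> 0"
    using tendsto_add[OF assms(4,5)] by simp
qed auto

lemma prob_tendsto_0_mono:
  assumes "\<And>k. A k \<subseteq> D k" "\<And>k. D k \<in> events" "(\<lambda>k. prob (D k)) \<longlonglongrightarrow> 0"
  shows "(\<lambda>k. prob (A k)) \<longlonglongrightarrow> 0"
  using assms by (intro prob_tendsto_0_union[of A D D]) auto

definition null_in_prob :: "(nat \<Rightarrow> 'a \<Rightarrow> real) \<Rightarrow> bool" where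
  "null_in_prob U \<longleftrightarrow> (\<forall>\<epsilon>>0. (\<lambda>k. prob {w\<in>space M. \<epsilon> < \<bar>U k w\<bar>}) \<longlonglongrightarrow> 0)"

text \<open>The squared errors over a time interval may be infinite for some sample points, so they
  are kept in \<open>ennreal\<close>.\<close>

definition null_in_prob_ennreal :: "(nat \<Rightarrow> 'a \<Rightarrow> ennreal) \<Rightarrow> bool" where
  "null_in_prob_ennreal U \<longleftrightarrow> (\<forall>\<epsilon>>0. (\<lambda>k. prob {w\<in>space M. ennreal \<epsilon> < U k w}) \<longlonglongrightarrow> 0)"

lemma null_in_prob_diff:
  assumes "null_in_prob U" "null_in_prob V"
    and [measurable]: "\<And>k. U k \<in> borel_measurable M" "\<And>k. V k \<in> borel_measurable M"
  shows "null_in_prob (\<lambda>k w. U k w - V k w)"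
  unfolding null_in_prob_def
proof (intro allI impI)
  fix \<epsilon> :: real assume "0 < \<epsilon>"
  then have "0 < \<epsilon> / 2"
    by simp
  then have "(\<lambda>k. prob {w\<in>space M. \<epsilon> / 2 < \<bar>U k w\<bar>}) \<longlonglongrightarrow> 0" "(\<lambda>k. prob {w\<in>space M. \<epsilon> / 2 < \<bar>V k w\<bar>}) \<longlonglongrightarrow> 0"
    using assms(1,2) unfolding null_in_prob_def by blast+
  then show "(\<lambda>k. prob {w\<in>space M. \<epsilon> < \<bar>U k w - V k w\<bar>}) \<longlonglongrightarrow> 0"
    by (rule prob_tendsto_0_union[rotated 3]) auto
qed

text \<open>The factors 2 are those of \<open>ennreal_sq_diff_le\<close>, the squared form of the
  triangle inequality.\<close>

lemma null_in_prob_ennreal_le: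
  assumes "null_in_prob_ennreal U" "null_in_prob_ennreal V"
    and le: "\<And>k w. w \<in> space M \<Longrightarrow> W k w \<le> 2 * U k w + 2 * V k w"
    and [measurable]: "\<And>k. U k \<in> borel_measurable M" "\<And>k. V k \<in> borel_measurable M"
  shows "null_in_prob_ennreal W"
  unfolding null_in_prob_ennreal_def
proof (intro allI impI)
  fix \<epsilon> :: real assume "0 < \<epsilon>"
  then have "0 < \<epsilon> / 4"
    by simp
  then have lim: "(\<lambda>k. prob {w\<in>space M. ennreal (\<epsilon> / 4) < U k w}) \<longlonglongrightarrow> 0"
      "(\<lambda>k. prob {w\<in>space M. ennreal (\<epsilon> / 4) < V k w}) \<longlonglongrightarrow> 0"
    using assms(1,2) unfolding null_in_prob_ennreal_def by blast+
  have *: "ennreal (\<epsilon> / 4) < U k w \<or> ennreal (\<epsilon> / 4) < V k w"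
    if w: "w \<in> space M" "ennreal \<epsilon> < W k w" for k w
  proof (rule ccontr)
    assume "\<not> (ennreal (\<epsilon> / 4) < U k w \<or> ennreal (\<epsilon> / 4) < V k w)"
    then have "2 * U k w + 2 * V k w \<le> 2 * ennreal (\<epsilon> / 4) + 2 * ennreal (\<epsilon> / 4)"
      by (intro add_mono mult_left_mono) auto
    also have "\<dots> = ennreal \<epsilon>"
      using \<open>0 < \<epsilon>\<close> by (simp add: ennreal_mult'[symmetric] ennreal_plus[symmetric] flip: ennreal_numeral)
    finally show False
      using le[OF w(1), of k] w(2) by simp
  qed
  show "(\<lambda>k. prob {w\<in>space M. ennreal \<epsilon> < W k w}) \<longlonglongrightarrow> 0"
    by (rule prob_tendsto_0_union[OF _ _ _ lim]) (use * in auto)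
qed

lemma null_in_prob_ennreal_mono:
  assumes "null_in_prob_ennreal U" "\<And>k w. w \<in> space M \<Longrightarrow> W k w \<le> U k w" "\<And>k. U k \<in> borel_measurable M"
  shows "null_in_prob_ennreal W"
proof (rule null_in_prob_ennreal_le[OF assms(1) assms(1) _ assms(3) assms(3)])
  fix k w assume "w \<in> space M"
  then have "W k w \<le> U k w"
    by (rule assms(2))
  also have "U k w \<le> 2 * U k w + 2 * U k w"
    by (simp add: mult_2 add_increasing2)
  finally show "W k w \<le> 2 * U k w + 2 * U k w" .
qed

text \<open>The expectations of the quadratic sums are not controlled, so the isometry cannot be
  applied directly; \<open>stoch_sum_tail\<close> replaces it by smallness in probability.\<close>

lemma null_in_prob_stoch_sum:
  assumes si: "\<And>k. simple_integrand F (m k) (p k) (\<xi> k)"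
    and lim: "null_in_prob_ennreal (\<lambda>k w. ennreal (quad_sum (m k) (p k) (\<xi> k) w))"
  shows "null_in_prob (\<lambda>k. stoch_sum (m k) (p k) (\<xi> k))"
  unfolding null_in_prob_def
proof (intro allI impI)
  fix \<epsilon> :: real assume \<epsilon>: "0 < \<epsilon>"
  show "(\<lambda>k. prob {w\<in>space M. \<epsilon> < \<bar>stoch_sum (m k) (p k) (\<xi> k) w\<bar>}) \<longlonglongrightarrow> 0"
  proof (rule LIMSEQ_I)
    fix r :: real assume r: "0 < r"
    \<comment> \<open>This level makes the second term of \<open>stoch_sum_tail\<close> equal to r /
      2.\<close>
    define \<eta> where "\<eta> = r / 2 * \<epsilon>\<^sup>2"
    have \<eta>: "0 < \<eta>" "\<eta> / \<epsilon>\<^sup>2 = r / 2"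
      using \<epsilon> r by (auto simp: \<eta>_def)
    have eq: "{w\<in>space M. ennreal \<eta> < ennreal (quad_sum (m k) (p k) (\<xi> k) w)}
        = {w\<in>space M. \<eta> < quad_sum (m k) (p k) (\<xi> k) w}" for k
      using quad_sum_nonneg[OF si] \<eta> by (auto simp: ennreal_less_iff)
    have "(\<lambda>k. prob {w\<in>space M. \<eta> < quad_sum (m k) (p k) (\<xi> k) w}) \<longlonglongrightarrow> 0"
      using lim[unfolded null_in_prob_ennreal_def, rule_format, OF \<eta>(1)] unfolding eq .
    then obtain N where N: "\<And>k. N \<le> k \<Longrightarrow> prob {w\<in>space M. \<eta> < quad_sum (m k) (p k) (\<xi> k) w} < r / 2"
      using LIMSEQ_D[of "\<lambda>k. prob {w\<in>space M. \<eta> < quad_sum (m k) (p k) (\<xi> k) w}" 0 "r / 2"] r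
      by auto
    show "\<exists>N. \<forall>k\<ge>N. norm (prob {w\<in>space M. \<epsilon> < \<bar>stoch_sum (m k) (p k) (\<xi> k) w\<bar>} - 0) < r"
    proof (intro exI[of _ N] allI impI)
      fix k assume "N \<le> k"
      from N[OF this] stoch_sum_tail[OF si \<epsilon> \<eta>(1), of k]
      show "norm (prob {w\<in>space M. \<epsilon> < \<bar>stoch_sum (m k) (p k) (\<xi> k) w\<bar>} - 0) < r"
        unfolding \<eta>(2) by simp
    qed
  qed
qed

text \<open>Measurability on the product with the full time axis, sample point first: the form in
  which integrals over time are measurable in the sample point and Tonelli's theorem
  applies.\<close>

definition jointly_measurable :: "(real \<Rightarrow> 'a \<Rightarrow> real) \<Rightarrow> bool" where
  "jointly_measurable Y \<longleftrightarrow> (\<lambda>(w, r). Y r w) \<in> borel_measurable (M \<Otimes>\<^sub>M borel)"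

lemma jointly_measurable_simple_process:
  assumes si: "simple_integrand F m p \<xi>"
  shows "jointly_measurable (simple_process m p \<xi>)"
  unfolding jointly_measurable_def simple_process_def case_prod_beta
proof (intro borel_measurable_sum borel_measurable_times)
  fix i assume "i \<in> {..<m}"
  then have [measurable]: "\<xi> i \<in> borel_measurable M"
    using measurable_F_M[OF simple_integrandD(3)[OF si]] by simp
  show "(\<lambda>x. \<xi> i (fst x)) \<in> borel_measurable (M \<Otimes>\<^sub>M borel)"
    by measurable
  show "(\<lambda>x. indicator {p i<..p (Suc i)} (snd x) :: real) \<in> borel_measurable (M \<Otimes>\<^sub>M borel)"
    by measurable
qed

lemma jointly_measurable_diff:
  "jointly_measurable Y \<Longrightarrow> jointly_measurable Z \<Longrightarrow> jointly_measurable (\<lambda>r w. Y r w - Z r w)"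
  unfolding jointly_measurable_def case_prod_beta by (rule borel_measurable_diff)

lemma measurable_nn_integral_sq:
  assumes "jointly_measurable Y"
  shows "(\<lambda>w. \<integral>\<^sup>+r\<in>{s..t}. ennreal ((Y r w)\<^sup>2) \<partial>lborel) \<in> borel_measurable M"
proof (rule lborel.borel_measurable_nn_integral)
  have [measurable]: "(\<lambda>(w, r). Y r w) \<in> borel_measurable (M \<Otimes>\<^sub>M lborel)"
    using assms unfolding jointly_measurable_def
    by (simp cong: measurable_cong_sets sets_pair_measure_cong)
  show "(\<lambda>(w, r). ennreal ((Y r w)\<^sup>2) * indicator {s..t} r) \<in> borel_measurable (M \<Otimes>\<^sub>M lborel)"
    by measurable
qed

abbreviation sq_error ::
    "nat \<Rightarrow> (nat \<Rightarrow> real) \<Rightarrow> (nat \<Rightarrow> 'a \<Rightarrow> real) \<Rightarrow> (real \<Rightarrow> 'a \<Rightarrow> real) \<Rightarrow> real \<Rightarrow> real \<Rightarrow> 'a \<Rightarrow> ennreal" where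
  "sq_error m p \<xi> Y s t w \<equiv> \<integral>\<^sup>+r\<in>{s..t}. ennreal ((simple_process m p \<xi> r w - Y r w)\<^sup>2) \<partial>lborel"

lemma measurable_sq_error:
  assumes "simple_integrand F m p \<xi>" "jointly_measurable Y"
  shows "sq_error m p \<xi> Y s t \<in> borel_measurable M"
  using measurable_nn_integral_sq[OF jointly_measurable_diff[OF jointly_measurable_simple_process[OF assms(1)] assms(2)]] .

lemma measurable_simple_process_right:
  "(\<lambda>r. simple_process m p \<xi> r w) \<in> borel_measurable borel"
  unfolding simple_process_def by measurable

lemma measurable_jointly_right:
  assumes "jointly_measurable Y" "w \<in> space M"
  shows "(\<lambda>r. Y r w) \<in> borel_measurable borel"
  using measurable_compose[OF measurable_Pair1'[OF assms(2)] assms(1)[unfolded jointly_measurable_def]]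
  by (simp add: comp_def)

text \<open>In contrast to \<open>has_ito_integral\<close>, the approximating processes have all
  partition points in \<open>{s..t}\<close>. A weight known at time \<open>s\<close> can then be
  absorbed into their coefficients.\<close>

definition approximable :: "real \<Rightarrow> real \<Rightarrow> (real \<Rightarrow> 'a \<Rightarrow> real) \<Rightarrow> ('a \<Rightarrow> real) \<Rightarrow> bool" where
  "approximable s t Y Z \<longleftrightarrow> (\<exists>m p \<xi>.
     (\<forall>k. simple_integrand F (m k) (p k) (\<xi> k) \<and> (\<forall>i\<le>m k. p k i \<in> {s..t})) \<and>
     null_in_prob_ennreal (\<lambda>k. sq_error (m k) (p k) (\<xi> k) Y s t) \<and>
     null_in_prob (\<lambda>k w. stoch_sum (m k) (p k) (\<xi> k) w - Z w))"

lemma quad_sum_difference_le: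
  assumes si: "simple_integrand F n q \<eta>" "simple_integrand F m p \<xi>" "simple_integrand F m' p' \<xi>'"
    and Y: "jointly_measurable Y" "w \<in> space M"
    and eq: "\<And>r. simple_process n q \<eta> r w
      = indicator {s<..t} r * (simple_process m p \<xi> r w - simple_process m' p' \<xi>' r w)"
  shows "ennreal (quad_sum n q \<eta> w) \<le> 2 * sq_error m p \<xi> Y s t w + 2 * sq_error m' p' \<xi>' Y s t w"
proof -
  let ?f = "\<lambda>m p \<xi> r. ennreal ((simple_process m p \<xi> r w - Y r w)\<^sup>2) * indicator {s..t} r"
  have [measurable]: "(\<lambda>r. Y r w) \<in> borel_measurable lborel"
    using measurable_jointly_right[OF Y] by simp
  have [measurable]: "(\<lambda>r. simple_process m p \<xi> r w) \<in> borel_measurable lborel" for m p \<xi>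
    using measurable_simple_process_right by simp
  have "ennreal (quad_sum n q \<eta> w) = (\<integral>\<^sup>+r. ennreal ((simple_process n q \<eta> r w)\<^sup>2) \<partial>lborel)"
    by (rule nn_integral_simple_process_sq[OF si(1), symmetric])
  also have "\<dots> \<le> (\<integral>\<^sup>+r. 2 * ?f m p \<xi> r + 2 * ?f m' p' \<xi>' r \<partial>lborel)"
  proof (rule nn_integral_mono)
    fix r
    show "ennreal ((simple_process n q \<eta> r w)\<^sup>2) \<le> 2 * ?f m p \<xi> r + 2 * ?f m' p' \<xi>' r"
      using ennreal_sq_diff_le[of "simple_process m p \<xi> r w" "simple_process m' p' \<xi>' r w" "Y r w"]
      by (simp add: eq indicator_def)
  qed
  also have "\<dots> = 2 * sq_error m p \<xi> Y s t w + 2 * sq_error m' p' \<xi>' Y s t w"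
    by (subst nn_integral_add; simp add: nn_integral_cmult)
  finally show ?thesis .
qed

text \<open>The integrals up to \<open>t\<close> and up to \<open>s\<close> come with unrelated
  approximating sequences. The first sequence is restricted to (s, t]; that its integrals up to
  \<open>s\<close> converge to \<open>Zs\<close> follows by comparison with the second, since both
  approximate the integrand on [0, s] and the stochastic sums of their difference tend to 0 in
  probability. \<open>Y'\<close> stands for a jointly measurable replacement of
  \<open>Y\<close>.\<close>

lemma approximable_increment:
  assumes t: "has_ito_integral M F B t Y Zt" and s: "has_ito_integral M F B s Y Zs"
    and st: "0 \<le> s" "s \<le> t"
    and Y': "jointly_measurable Y'" "\<And>r w. r \<in> {0..t} \<Longrightarrow> w \<in> space M \<Longrightarrow> Y' r w = Y r w"
  shows "approximable s t Y' (\<lambda>w. Zt w - Zs w)"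
proof -
  have err: "sq_error m p \<xi> Y' 0 u w = sq_error m p \<xi> Y 0 u w"
    if "w \<in> space M" "u \<le> t" for m p \<xi> u w
    using that Y'(2)[OF _ that(1)] by (intro nn_integral_cong) (auto simp: indicator_def)
  have approx: "\<exists>m p \<xi>. (\<forall>k. simple_integrand F (m k) (p k) (\<xi> k)) \<and>
      null_in_prob_ennreal (\<lambda>k. sq_error (m k) (p k) (\<xi> k) Y' 0 u) \<and>
      null_in_prob (\<lambda>k w. simple_ito_integral B u (m k) (p k) (\<xi> k) w - Z w)"
    if "has_ito_integral M F B u Y Z" "u \<le> t" for u Z
  proof -
    have eq: "{w\<in>space M. ennreal \<epsilon> < sq_error m p \<xi> Y' 0 u w}
        = {w\<in>space M. ennreal \<epsilon> < sq_error m p \<xi> Y 0 u w}" for \<epsilon> m p \<xi>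
      using err[OF _ that(2)] by auto
    show ?thesis
      using that(1) unfolding has_ito_integral_def null_in_prob_def null_in_prob_ennreal_def eq by fast
  qed
  obtain m p \<xi> where a: "\<And>k. simple_integrand F (m k) (p k) (\<xi> k)"
      "null_in_prob_ennreal (\<lambda>k. sq_error (m k) (p k) (\<xi> k) Y' 0 t)"
      "null_in_prob (\<lambda>k w. simple_ito_integral B t (m k) (p k) (\<xi> k) w - Zt w)"
    using approx[OF t order_refl] by (elim exE conjE) (rule that; (erule spec | assumption))
  obtain m' p' \<xi>' where a': "\<And>k. simple_integrand F (m' k) (p' k) (\<xi>' k)"
      "null_in_prob_ennreal (\<lambda>k. sq_error (m' k) (p' k) (\<xi>' k) Y' 0 s)"
      "null_in_prob (\<lambda>k w. simple_ito_integral B s (m' k) (p' k) (\<xi>' k) w - Zs w)"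
    using approx[OF s st(2)] by (elim exE conjE) (rule that; (erule spec | assumption))
  let ?I = "\<lambda>u k. simple_ito_integral B u (m k) (p k) (\<xi> k)"
    and ?I' = "\<lambda>u k. simple_ito_integral B u (m' k) (p' k) (\<xi>' k)"
  let ?P = "\<lambda>k. simple_process (m k) (p k) (\<xi> k)"
    and ?P' = "\<lambda>k. simple_process (m' k) (p' k) (\<xi>' k)"
  let ?E = "\<lambda>u k. sq_error (m k) (p k) (\<xi> k) Y' 0 u"
    and ?E' = "\<lambda>u k. sq_error (m' k) (p' k) (\<xi>' k) Y' 0 u"
  have Zm [measurable]: "Zt \<in> borel_measurable M" "Zs \<in> borel_measurable M"
    using s t by (auto simp: has_ito_integral_def)
  have Im [measurable]: "simple_ito_integral B u m p \<xi> \<in> borel_measurable M"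
    if "simple_integrand F m p \<xi>" "0 \<le> u" for u m p \<xi>
    unfolding simple_ito_integral_def
  proof (intro borel_measurable_sum borel_measurable_times borel_measurable_diff)
    fix i assume "i \<in> {..<m}"
    then have i: "i < m"
      by simp
    show "\<xi> i \<in> borel_measurable M"
      by (rule measurable_F_M[OF simple_integrandD(3)[OF that(1) i]])
    show "B (min u (p (Suc i))) \<in> borel_measurable M" "B (min u (p i)) \<in> borel_measurable M"
      using simple_integrandD(2)[OF that(1), of i] simple_integrandD(2)[OF that(1), of "Suc i"] i that(2)
      by (auto intro: measurable_B)
  qed
  have restrict: "\<forall>k. \<exists>n q \<eta>. simple_integrand F n q \<eta> \<and> (\<forall>i\<le>n. q i \<in> {s..t}) \<and>
      (\<forall>w. stoch_sum n q \<eta> w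
        = ?I t k w - ?I s k w) \<and>
      (\<forall>r w. simple_process n q \<eta> r w = indicator {s<..t} r * ?P k r w)"
    by (intro allI simple_integrand_restrict[OF a(1) st])
  obtain n q \<eta> where R: "\<And>k. simple_integrand F (n k) (q k) (\<eta> k) \<and> (\<forall>i\<le>n k. q k i \<in> {s..t}) \<and>
      (\<forall>w. stoch_sum (n k) (q k) (\<eta> k) w
        = ?I t k w - ?I s k w) \<and>
      (\<forall>r w. simple_process (n k) (q k) (\<eta> k) r w = indicator {s<..t} r * ?P k r w)"
    using restrict[unfolded choice_iff] by (elim exE) (rule that, erule spec)
  note r = conjunct1[OF R] conjunct2[OF R, THEN conjunct1, rule_format]
    conjunct2[OF R, THEN conjunct2, THEN conjunct1, rule_format]
    conjunct2[OF R, THEN conjunct2, THEN conjunct2, rule_format]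
  \<comment> \<open>With this, restricting a simple process to (0, s] yields exactly its integral up
    to \<open>s\<close>.\<close>
  have I0: "simple_ito_integral B 0 m p \<xi> w = 0" if "simple_integrand F m p \<xi>" for m p \<xi> w
    unfolding simple_ito_integral_def
    using simple_integrandD(2)[OF that] by (intro sum.neutral) (auto simp: min_absorb1)
  have difference: "\<forall>k. \<exists>n q \<eta>. simple_integrand F n q \<eta> \<and> (\<forall>w. stoch_sum n q \<eta> w
        = ?I s k w - ?I' s k w) \<and>
      (\<forall>r w. simple_process n q \<eta> r w = indicator {0<..s} r *
        (?P k r w - ?P' k r w))"
  proof
    fix k
    obtain n1 q1 \<eta>1 where 1: "simple_integrand F n1 q1 \<eta>1"
      "\<And>g w. wsum g n1 q1 (\<lambda>i. \<eta>1 i w) = wsum g (m k) (p k) (\<lambda>i. \<xi> k i w) - wsum g (m' k) (p' k) (\<lambda>i. \<xi>' k i w)"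
      using simple_integrand_difference[OF a(1)[of k] a'(1)[of k], of UNIV] by auto
    obtain n2 q2 \<eta>2 where 2: "simple_integrand F n2 q2 \<eta>2"
      "\<And>w. stoch_sum n2 q2 \<eta>2 w = simple_ito_integral B s n1 q1 \<eta>1 w - simple_ito_integral B 0 n1 q1 \<eta>1 w"
      "\<And>r w. simple_process n2 q2 \<eta>2 r w = indicator {0<..s} r * simple_process n1 q1 \<eta>1 r w"
      using simple_integrand_restrict[OF 1(1) order_refl st(1)] by auto
    show "\<exists>n q \<eta>. simple_integrand F n q \<eta> \<and> (\<forall>w. stoch_sum n q \<eta> w
        = ?I s k w - ?I' s k w) \<and>
      (\<forall>r w. simple_process n q \<eta> r w = indicator {0<..s} r *
        (?P k r w - ?P' k r w))"
      using 2 I0[OF 1(1)] unfolding simple_ito_integral_eq_wsum simple_process_wsum[OF 1(1)]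
        simple_process_wsum[OF a(1)] simple_process_wsum[OF a'(1)] 1(2)
      by (intro exI[of _ n2] exI[of _ q2] exI[of _ \<eta>2]) simp
  qed
  obtain n' q' \<eta>' where R': "\<And>k. simple_integrand F (n' k) (q' k) (\<eta>' k) \<and> (\<forall>w. stoch_sum (n' k) (q' k) (\<eta>' k) w
        = ?I s k w - ?I' s k w) \<and>
      (\<forall>r w. simple_process (n' k) (q' k) (\<eta>' k) r w = indicator {0<..s} r *
        (?P k r w - ?P' k r w))"
    using difference[unfolded choice_iff] by (elim exE) (rule that, erule spec)
  note r' = conjunct1[OF R'] conjunct2[OF R', THEN conjunct1, rule_format]
    conjunct2[OF R', THEN conjunct2, rule_format]
  have mono: "sq_error m p \<xi> Y' 0 s w \<le> sq_error m p \<xi> Y' 0 t w" for m p \<xi> w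
    using st by (intro nn_integral_mono) (auto simp: indicator_def)
  have "null_in_prob_ennreal (\<lambda>k w. ennreal (quad_sum (n' k) (q' k) (\<eta>' k) w))"
  proof (rule null_in_prob_ennreal_le[OF a(2) a'(2)])
    fix k w assume w: "w \<in> space M"
    have "ennreal (quad_sum (n' k) (q' k) (\<eta>' k) w)
        \<le> 2 * ?E s k w + 2 * ?E' s k w"
      by (rule quad_sum_difference_le[OF r'(1) a(1) a'(1) Y'(1) w r'(3)])
    also have "\<dots> \<le> 2 * ?E t k w + 2 * ?E' s k w"
      by (intro add_mono mult_left_mono mono) auto
    finally show "ennreal (quad_sum (n' k) (q' k) (\<eta>' k) w)
        \<le> 2 * ?E t k w + 2 * ?E' s k w" .
  qed (intro measurable_sq_error a a' Y')+
  then have J': "null_in_prob (\<lambda>k. stoch_sum (n' k) (q' k) (\<eta>' k))"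
    by (rule null_in_prob_stoch_sum[OF r'(1)])
  have "null_in_prob_ennreal (\<lambda>k. sq_error (n k) (q k) (\<eta> k) Y' s t)"
  proof (rule null_in_prob_ennreal_mono[OF a(2)])
    fix k w
    \<comment> \<open>The restricted process is 0 at time \<open>s\<close> itself, since its
      intervals are open on the left, so the errors compare only outside that single time.\<close>
    have "AE x in lborel. x \<noteq> s"
      by (rule AE_lborel_singleton)
    then show "sq_error (n k) (q k) (\<eta> k) Y' s t w \<le> ?E t k w"
      using st by (intro nn_integral_mono_AE) (auto elim!: eventually_mono simp: r(4) indicator_def)
  qed (intro measurable_sq_error a Y')
  moreover have "null_in_prob (\<lambda>k w. stoch_sum (n k) (q k) (\<eta> k) w - (Zt w - Zs w))"
  proof -
    \<comment> \<open>The error of the increment is split into the error at \<open>t\<close>, the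
      discrepancy of the two sequences at \<open>s\<close>, and the error of the second sequence at
      \<open>s\<close>.\<close>
    have "null_in_prob (\<lambda>k w. ?I t k w - Zt w
        - stoch_sum (n' k) (q' k) (\<eta>' k) w
        - (?I' s k w - Zs w))"
      by (intro null_in_prob_diff a(3) a'(3) J' borel_measurable_diff Im a(1) a'(1) Zm
          measurable_stoch_sum_M r'(1) st(1) order_trans[OF st])
    moreover have "?I t k w - Zt w
        - stoch_sum (n' k) (q' k) (\<eta>' k) w
        - (?I' s k w - Zs w)
      = stoch_sum (n k) (q k) (\<eta> k) w - (Zt w - Zs w)" for k w
      unfolding r(3) r'(2) by simp
    ultimately show ?thesis
      by simp
  qed
  ultimately show ?thesis
    unfolding approximable_def using r(1,2) by (intro exI[of _ n] exI[of _ q] exI[of _ \<eta>]) simp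
qed

text \<open>Linearity of the limit: the difference of the approximating processes lives on a common
  partition of points in \<open>{s..t}\<close>, and its squared error is at most twice the sum of
  the two squared errors.\<close>

lemma approximable_diff:
  assumes a: "approximable s t Y Z" and a': "approximable s t Y' Z'"
    and Y: "jointly_measurable Y" "jointly_measurable Y'"
    and Z: "Z \<in> borel_measurable M" "Z' \<in> borel_measurable M"
  shows "approximable s t (\<lambda>r w. Y r w - Y' r w) (\<lambda>w. Z w - Z' w)"
proof -
  obtain m p \<xi> where a: "\<And>k. simple_integrand F (m k) (p k) (\<xi> k)" "\<And>k i. i \<le> m k \<Longrightarrow> p k i \<in> {s..t}"
      "null_in_prob_ennreal (\<lambda>k. sq_error (m k) (p k) (\<xi> k) Y s t)"
      "null_in_prob (\<lambda>k w. stoch_sum (m k) (p k) (\<xi> k) w - Z w)"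
    using a unfolding approximable_def
    by (elim exE conjE) (rule that; (assumption | blast))
  obtain m' p' \<xi>' where a': "\<And>k. simple_integrand F (m' k) (p' k) (\<xi>' k)" "\<And>k i. i \<le> m' k \<Longrightarrow> p' k i \<in> {s..t}"
      "null_in_prob_ennreal (\<lambda>k. sq_error (m' k) (p' k) (\<xi>' k) Y' s t)"
      "null_in_prob (\<lambda>k w. stoch_sum (m' k) (p' k) (\<xi>' k) w - Z' w)"
    using a' unfolding approximable_def
    by (elim exE conjE) (rule that; (assumption | blast))
  have difference: "\<forall>k. \<exists>n q \<eta>. simple_integrand F n q \<eta> \<and> (\<forall>i\<le>n. q i \<in> {s..t}) \<and>
      (\<forall>g w. wsum g n q (\<lambda>i. \<eta> i w) = wsum g (m k) (p k) (\<lambda>i. \<xi> k i w) - wsum g (m' k) (p' k) (\<lambda>i. \<xi>' k i w))"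
    by (intro allI simple_integrand_difference[OF a(1) a'(1) a(2) a'(2)])
  obtain n q \<eta> where "\<And>k. simple_integrand F (n k) (q k) (\<eta> k) \<and> (\<forall>i\<le>n k. q k i \<in> {s..t}) \<and>
      (\<forall>g w. wsum g (n k) (q k) (\<lambda>i. \<eta> k i w)
        = wsum g (m k) (p k) (\<lambda>i. \<xi> k i w) - wsum g (m' k) (p' k) (\<lambda>i. \<xi>' k i w))"
    using difference[unfolded choice_iff] by (elim exE) (rule that, erule spec)
  then have d: "\<And>k. simple_integrand F (n k) (q k) (\<eta> k)" "\<And>k i. i \<le> n k \<Longrightarrow> q k i \<in> {s..t}"
      "\<And>k g w. wsum g (n k) (q k) (\<lambda>i. \<eta> k i w)
        = wsum g (m k) (p k) (\<lambda>i. \<xi> k i w) - wsum g (m' k) (p' k) (\<lambda>i. \<xi>' k i w)"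
    by blast+
  have [measurable]: "(\<lambda>r. Y r w) \<in> borel_measurable lborel" "(\<lambda>r. Y' r w) \<in> borel_measurable lborel"
    if "w \<in> space M" for w
    using measurable_jointly_right[OF _ that] Y by auto
  have [measurable]: "(\<lambda>r. simple_process m p \<xi> r w) \<in> borel_measurable lborel" for m p \<xi> w
    using measurable_simple_process_right by simp
  have "null_in_prob_ennreal (\<lambda>k. sq_error (n k) (q k) (\<eta> k) (\<lambda>r w. Y r w - Y' r w) s t)"
  proof (rule null_in_prob_ennreal_le[OF a(3) a'(3)])
    fix k w assume w [measurable]: "w \<in> space M"
    let ?f = "\<lambda>m p \<xi> Y r. ennreal ((simple_process m p \<xi> r w - Y r w)\<^sup>2) * indicator {s..t} r"
    have "sq_error (n k) (q k) (\<eta> k) (\<lambda>r w. Y r w - Y' r w) s t w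
        \<le> (\<integral>\<^sup>+r. 2 * ?f (m k) (p k) (\<xi> k) Y r + 2 * ?f (m' k) (p' k) (\<xi>' k) Y' r \<partial>lborel)"
    proof (rule nn_integral_mono)
      fix r
      have "simple_process (n k) (q k) (\<eta> k) r w
          = simple_process (m k) (p k) (\<xi> k) r w - simple_process (m' k) (p' k) (\<xi>' k) r w"
        unfolding simple_process_wsum[OF d(1)] simple_process_wsum[OF a(1)] simple_process_wsum[OF a'(1)]
        by (rule d(3))
      then have eq: "simple_process (n k) (q k) (\<eta> k) r w - (Y r w - Y' r w)
          = (simple_process (m k) (p k) (\<xi> k) r w - Y r w) - (simple_process (m' k) (p' k) (\<xi>' k) r w - Y' r w)"
        by simp
      show "?f (n k) (q k) (\<eta> k) (\<lambda>r w. Y r w - Y' r w) r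
          \<le> 2 * ?f (m k) (p k) (\<xi> k) Y r + 2 * ?f (m' k) (p' k) (\<xi>' k) Y' r"
        using ennreal_sq_diff_le[of "simple_process (m k) (p k) (\<xi> k) r w - Y r w"
            "simple_process (m' k) (p' k) (\<xi>' k) r w - Y' r w" 0]
        unfolding eq by (simp add: indicator_def)
    qed
    also have "\<dots> = 2 * sq_error (m k) (p k) (\<xi> k) Y s t w + 2 * sq_error (m' k) (p' k) (\<xi>' k) Y' s t w"
      using w by (subst nn_integral_add; simp add: nn_integral_cmult)
    finally show "sq_error (n k) (q k) (\<eta> k) (\<lambda>r w. Y r w - Y' r w) s t w
        \<le> 2 * sq_error (m k) (p k) (\<xi> k) Y s t w + 2 * sq_error (m' k) (p' k) (\<xi>' k) Y' s t w" .
  qed (intro measurable_sq_error a a' Y)+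
  moreover have "null_in_prob (\<lambda>k w. stoch_sum (n k) (q k) (\<eta> k) w - (Z w - Z' w))"
  proof -
    have "null_in_prob (\<lambda>k w. stoch_sum (m k) (p k) (\<xi> k) w - Z w
        - (stoch_sum (m' k) (p' k) (\<xi>' k) w - Z' w))"
      by (intro null_in_prob_diff a(4) a'(4) borel_measurable_diff Z measurable_stoch_sum_M a(1) a'(1))
    then show ?thesis
      unfolding d(3) by (simp add: algebra_simps)
  qed
  ultimately show ?thesis
    unfolding approximable_def using d(1,2) by (intro exI[of _ n] exI[of _ q] exI[of _ \<eta>]) simp
qed

end

section \<open>Clipping of the approximations and passage of moments to the limit\<close>

lemma sq_add_le_weighted:
  fixes a b \<kappa> :: real
  assumes "0 < \<kappa>"
  shows "(a + b)\<^sup>2 \<le> (1 + \<kappa>) * a\<^sup>2 + (1 + 1 / \<kappa>) * b\<^sup>2"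
proof -
  have "0 \<le> (\<kappa> * a - b)\<^sup>2 / \<kappa>"
    using assms by simp
  also have "\<dots> = \<kappa> * a\<^sup>2 - 2 * a * b + b\<^sup>2 / \<kappa>"
    using assms by (simp add: power2_diff power2_eq_square field_simps)
  finally show ?thesis
    by (simp add: power2_sum algebra_simps)
qed

lemma power4_add_le:
  fixes a b :: real
  shows "(a + b) ^ 4 \<le> 8 * a ^ 4 + 8 * b ^ 4"
proof -
  have "(a + b) ^ 4 = ((a + b)\<^sup>2)\<^sup>2"
    by simp
  also have "\<dots> \<le> (2 * a\<^sup>2 + 2 * b\<^sup>2)\<^sup>2"
    using sq_add_le_weighted[of 1 a b] by (intro power_mono) auto
  also have "\<dots> \<le> 2 * (2 * a\<^sup>2)\<^sup>2 + 2 * (2 * b\<^sup>2)\<^sup>2"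
    using sq_add_le_weighted[of 1 "2 * a\<^sup>2" "2 * b\<^sup>2"] by simp
  also have "\<dots> = 8 * a ^ 4 + 8 * b ^ 4"
    by (simp add: power_mult_distrib)
  finally show ?thesis .
qed

definition clip :: "real \<Rightarrow> real \<Rightarrow> real" where
  "clip K x = max (-K) (min K x)"

text \<open>Clipping is the projection onto [-K, K]. The last two clauses serve integrands with
  values in that interval: the part cut off is bounded by the approximation error, and clipping
  never increases that error.\<close>

lemma clip_props:
  assumes "0 \<le> K"
  shows "clip K 0 = 0" "\<bar>clip K x\<bar> \<le> K" "\<bar>clip K x\<bar> \<le> \<bar>x\<bar>"
    and "\<bar>y\<bar> \<le> K \<Longrightarrow> \<bar>x - clip K x\<bar> \<le> \<bar>x - y\<bar>"
    and "\<bar>y\<bar> \<le> K \<Longrightarrow> \<bar>clip K x - y\<bar> \<le> \<bar>x - y\<bar>"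
  using assms by (auto simp: clip_def max_def min_def)

lemma measurable_clip [measurable]: "clip K \<in> borel_measurable borel"
  unfolding clip_def by measurable

context brownian_motion
begin

text \<open>Bounded fourth moments make the squares uniformly integrable, so convergence to 0 in
  probability becomes convergence to 0 in L2.\<close>

lemma expectation_sq_tendsto_0:
  assumes U: "null_in_prob U" and Um [measurable]: "\<And>k. U k \<in> borel_measurable M"
    and int: "\<And>k. integrable M (\<lambda>w. U k w ^ 4)" "\<And>k. (\<integral>w. U k w ^ 4 \<partial>M) \<le> c"
  shows "(\<lambda>k. \<integral>w. (U k w)\<^sup>2 \<partial>M) \<longlonglongrightarrow> 0"
proof (rule LIMSEQ_I)
  fix r :: real assume r: "0 < r"
  define \<epsilon> where "\<epsilon> = sqrt (r / 4)"
  let ?A = "\<lambda>k. {w\<in>space M. \<epsilon> < \<bar>U k w\<bar>}"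
  \<comment> \<open>The budget \<open>r\<close> is split into quarters: \<epsilon>^2 is one,
    \<open>l\<close> times the fourth moment is at most one, and an event of probability below l * r
    costs at most one.\<close>
  define l where "l = r / (4 * (\<bar>c\<bar> + 1))"
  have \<epsilon>: "0 < \<epsilon>" "\<epsilon>\<^sup>2 = r / 4" and l: "0 < l"
    using r by (auto simp: \<epsilon>_def l_def)
  have lc: "l * c \<le> r / 4"
  proof -
    have "l * c \<le> l * (\<bar>c\<bar> + 1)"
      using l by (intro mult_left_mono) auto
    also have "\<dots> = r / 4"
      by (simp add: l_def field_simps add_nonneg_eq_0_iff)
    finally show ?thesis .
  qed
  \<comment> \<open>Beyond \<epsilon> the bound comes from completing the square in l u^4 - u^2 +
    1/(4 l).\<close>
  have pt: "u\<^sup>2 \<le> \<epsilon>\<^sup>2 + l * u ^ 4 + 1 / (4 * l) * of_bool (\<epsilon> < \<bar>u\<bar>)" for u :: real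
  proof (cases "\<epsilon> < \<bar>u\<bar>")
    case True
    have "0 \<le> l * (u\<^sup>2 - 1 / (2 * l))\<^sup>2"
      using l by simp
    also have "\<dots> = l * u ^ 4 - u\<^sup>2 + 1 / (4 * l)"
      using l by (simp add: power2_diff field_simps power2_eq_square power4_eq_xxxx)
    finally have "u\<^sup>2 \<le> \<epsilon>\<^sup>2 + l * u ^ 4 + 1 / (4 * l) * 1"
      using zero_le_power2[of \<epsilon>] by linarith
    then show ?thesis
      using True by simp
  next
    case False
    have "u\<^sup>2 = \<bar>u\<bar>\<^sup>2"
      by simp
    also have "\<dots> \<le> \<epsilon>\<^sup>2"
      using False by (intro power_mono) auto
    finally show ?thesis
      using False l by (simp add: add_increasing2)
  qed
  have bound: "(\<integral>w. (U k w)\<^sup>2 \<partial>M) \<le> r / 2 + 1 / (4 * l) * prob (?A k)" for k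
  proof -
    have ind: "(\<integral>w. (of_bool (\<epsilon> < \<bar>U k w\<bar>) :: real) \<partial>M) = prob (?A k)"
      "integrable M (\<lambda>w. of_bool (\<epsilon> < \<bar>U k w\<bar>) :: real)"
    proof -
      have "(\<integral>w. (of_bool (\<epsilon> < \<bar>U k w\<bar>) :: real) \<partial>M) = (\<integral>w. indicator (?A k) w \<partial>M)"
        by (intro Bochner_Integration.integral_cong refl) (simp add: indicator_def)
      then show "(\<integral>w. (of_bool (\<epsilon> < \<bar>U k w\<bar>) :: real) \<partial>M) = prob (?A k)"
        by simp
      show "integrable M (\<lambda>w. of_bool (\<epsilon> < \<bar>U k w\<bar>) :: real)"
        by (intro integrable_const_bound[where B=1]) auto
    qed
    have "(\<integral>w. (U k w)\<^sup>2 \<partial>M)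
        \<le> (\<integral>w. \<epsilon>\<^sup>2 + l * U k w ^ 4 + 1 / (4 * l) * of_bool (\<epsilon> < \<bar>U k w\<bar>) \<partial>M)"
    proof (rule integral_mono)
      show "integrable M (\<lambda>w. (U k w)\<^sup>2)"
        by (rule integrable_power_le_4[OF Um int(1)]) simp
      show "integrable M (\<lambda>w. \<epsilon>\<^sup>2 + l * U k w ^ 4 + 1 / (4 * l) * of_bool (\<epsilon> < \<bar>U k w\<bar>))"
        using int(1) ind(2) by simp
    qed (rule pt)
    also have "\<dots> = \<epsilon>\<^sup>2 + l * (\<integral>w. U k w ^ 4 \<partial>M) + 1 / (4 * l) * prob (?A k)"
      using int(1) ind by (simp add: prob_space)
    also have "l * (\<integral>w. U k w ^ 4 \<partial>M) \<le> l * c"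
      using int(2)[of k] l by (intro mult_left_mono) auto
    finally show ?thesis
      using lc \<epsilon>(2) by simp
  qed
  have "(\<lambda>k. prob (?A k)) \<longlonglongrightarrow> 0"
    using U \<epsilon>(1) unfolding null_in_prob_def by blast
  from LIMSEQ_D[OF this, of "l * r"] obtain N
    where N: "\<And>k. N \<le> k \<Longrightarrow> prob (?A k) < l * r"
    using l r by auto
  show "\<exists>N. \<forall>k\<ge>N. norm ((\<integral>w. (U k w)\<^sup>2 \<partial>M) - 0) < r"
  proof (intro exI[of _ N] allI impI)
    fix k assume "N \<le> k"
    have "1 / (4 * l) * prob (?A k) \<le> 1 / (4 * l) * (l * r)"
      using N[OF \<open>N \<le> k\<close>] l by (intro mult_left_mono) auto
    also have "\<dots> = r / 4"
      using l by simp
    finally have "(\<integral>w. (U k w)\<^sup>2 \<partial>M) < r"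
      using bound[of k] r by linarith
    moreover have "0 \<le> (\<integral>w. (U k w)\<^sup>2 \<partial>M)"
      by simp
    ultimately show "norm ((\<integral>w. (U k w)\<^sup>2 \<partial>M) - 0) < r"
      by simp
  qed
qed

text \<open>A Fatou argument under convergence in probability. Outside a small event \<bar>Z\<bar>
  exceeds \<bar>J\<bar> by at most \<epsilon>, and truncating at n makes that event harmless; then n
  tends to infinity. The factor 8 stems from \<open>power4_add_le\<close>.\<close>

lemma moment4_limit:
  assumes U: "null_in_prob (\<lambda>k w. J k w - Z w)"
    and [measurable]: "\<And>k. J k \<in> borel_measurable M" "Z \<in> borel_measurable M"
    and int: "\<And>k. integrable M (\<lambda>w. J k w ^ 4)" "\<And>k. (\<integral>w. J k w ^ 4 \<partial>M) \<le> c"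
  shows "integrable M (\<lambda>w. Z w ^ 4)" "(\<integral>w. Z w ^ 4 \<partial>M) \<le> 8 * c"
proof -
  let ?Z = "\<lambda>n w. min \<bar>Z w\<bar> (real n)"
  have trunc_int: "integrable M (\<lambda>w. ?Z n w ^ 4)" for n
    by (intro integrable_const_bound[where B="real n ^ 4"]) (auto intro!: power_mono AE_I2)
  have trunc: "(\<integral>w. ?Z n w ^ 4 \<partial>M) \<le> 8 * c" for n
  proof (rule field_le_epsilon)
    fix e :: real assume e: "0 < e"
    define \<epsilon> where "\<epsilon> = min 1 (e / 8)"
    have \<epsilon>: "0 < \<epsilon>" "\<epsilon> \<le> 1" "\<epsilon> \<le> e / 8"
      using e by (auto simp: \<epsilon>_def)
    have "\<epsilon> ^ 4 \<le> \<epsilon>"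
      using \<epsilon> power_decreasing[of 1 4 \<epsilon>] by simp
    then have \<epsilon>4: "8 * \<epsilon> ^ 4 \<le> e"
      using \<epsilon>(3) by linarith
    let ?A = "\<lambda>k. {w\<in>space M. \<epsilon> < \<bar>J k w - Z w\<bar>}"
    have "(\<integral>w. ?Z n w ^ 4 \<partial>M) \<le> 8 * c + 8 * \<epsilon> ^ 4 + real n ^ 4 * prob (?A k)" for k
    proof -
      have ind: "integrable M (indicator (?A k) :: 'a \<Rightarrow> real)"
        by (intro integrable_real_indicator) (auto simp: less_top[symmetric])
      have "(\<integral>w. ?Z n w ^ 4 \<partial>M)
          \<le> (\<integral>w. 8 * J k w ^ 4 + 8 * \<epsilon> ^ 4 + real n ^ 4 * indicator (?A k) w \<partial>M)"
      proof (intro integral_mono trunc_int Bochner_Integration.integrable_add integrable_mult_right int(1))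
        fix w assume w: "w \<in> space M"
        show "?Z n w ^ 4 \<le> 8 * J k w ^ 4 + 8 * \<epsilon> ^ 4 + real n ^ 4 * indicator (?A k) w"
        proof (cases "w \<in> ?A k")
          case True
          have "?Z n w ^ 4 \<le> real n ^ 4"
            by (intro power_mono) auto
          then show ?thesis
            using True by (simp add: add_increasing)
        next
          case False
          then have "min \<bar>Z w\<bar> (real n) \<le> \<bar>J k w\<bar> + \<epsilon>"
            using w by auto
          then have "?Z n w ^ 4 \<le> (\<bar>J k w\<bar> + \<epsilon>) ^ 4"
            by (intro power_mono) auto
          also have "\<dots> \<le> 8 * J k w ^ 4 + 8 * \<epsilon> ^ 4"
            using power4_add_le[of "\<bar>J k w\<bar>" \<epsilon>] by simp
          finally show ?thesis
            using False by simp
        qed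
      qed (use ind in auto)
      also have "\<dots> = 8 * (\<integral>w. J k w ^ 4 \<partial>M) + 8 * \<epsilon> ^ 4 + real n ^ 4 * prob (?A k)"
        using int(1) ind by (simp add: prob_space)
      finally show ?thesis
        using int(2)[of k] by simp
    qed
    moreover have "(\<lambda>k. 8 * c + 8 * \<epsilon> ^ 4 + real n ^ 4 * prob (?A k)) \<longlonglongrightarrow> 8 * c + 8 * \<epsilon> ^ 4 + real n ^ 4 * 0"
      using U \<epsilon>(1) unfolding null_in_prob_def by (intro tendsto_intros) blast
    ultimately have "(\<integral>w. ?Z n w ^ 4 \<partial>M) \<le> 8 * c + 8 * \<epsilon> ^ 4 + real n ^ 4 * 0"
      by (intro LIMSEQ_le_const) auto
    then show "(\<integral>w. ?Z n w ^ 4 \<partial>M) \<le> 8 * c + e"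
      using \<epsilon>4 by simp
  qed
  have c: "0 \<le> c"
    using order_trans[OF _ int(2)[of 0], of 0] by simp
  have "(\<lambda>n. \<integral>\<^sup>+w. ennreal (?Z n w ^ 4) \<partial>M) \<longlonglongrightarrow> (\<integral>\<^sup>+w. ennreal (Z w ^ 4) \<partial>M)"
  proof (rule nn_integral_LIMSEQ)
    show "incseq (\<lambda>n w. ennreal (?Z n w ^ 4))"
      by (auto simp: incseq_def le_fun_def intro!: ennreal_leI power_mono)
    show "(\<lambda>n. ennreal (?Z n w ^ 4)) \<longlonglongrightarrow> ennreal (Z w ^ 4)" for w
    proof (rule tendsto_eventually)
      obtain N where "\<bar>Z w\<bar> \<le> real N"
        using real_arch_simple by blast
      then have "\<forall>n\<ge>N. ennreal (?Z n w ^ 4) = ennreal (Z w ^ 4)"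
        by (auto simp: min_absorb1 power_even_abs)
      then show "\<forall>\<^sub>F n in sequentially. ennreal (?Z n w ^ 4) = ennreal (Z w ^ 4)"
        unfolding eventually_sequentially by blast
    qed
  qed measurable
  moreover have "(\<integral>\<^sup>+w. ennreal (?Z n w ^ 4) \<partial>M) \<le> ennreal (8 * c)" for n
    using trunc_int trunc by (subst nn_integral_eq_integral) (auto intro!: ennreal_leI)
  ultimately have le: "(\<integral>\<^sup>+w. ennreal (Z w ^ 4) \<partial>M) \<le> ennreal (8 * c)"
    by (intro LIMSEQ_le_const2) auto
  show int: "integrable M (\<lambda>w. Z w ^ 4)"
    using le by (intro integrableI_nonneg) (auto intro: le_less_trans)
  show "(\<integral>w. Z w ^ 4 \<partial>M) \<le> 8 * c"
    using le c by (subst (asm) nn_integral_eq_integral[OF int]) auto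
qed

text \<open>Clipping the coefficients at the bound of the integrand leaves the limit unchanged: the
  part cut off has quadratic sums below the approximation errors, so its stochastic sums vanish in
  probability. The error is stated through its square root so that
  \<open>expectation_sq_tendsto_0\<close> applies to it.\<close>

lemma approximable_bounded:
  assumes a: "approximable s t Y Z" and Zm: "Z \<in> borel_measurable M" and Y: "jointly_measurable Y"
    and K: "0 \<le> K" "\<And>r w. r \<in> {s..t} \<Longrightarrow> w \<in> space M \<Longrightarrow> \<bar>Y r w\<bar> \<le> K" and st: "s \<le> t"
  obtains m p \<xi> where "\<And>k. simple_integrand F (m k) (p k) (\<xi> k)" "\<And>k i. i \<le> m k \<Longrightarrow> p k i \<in> {s..t}"
    "\<And>k i w. \<bar>\<xi> k i w\<bar> \<le> K" "null_in_prob (\<lambda>k w. stoch_sum (m k) (p k) (\<xi> k) w - Z w)"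
    "null_in_prob (\<lambda>k w. sqrt (enn2real (sq_error (m k) (p k) (\<xi> k) Y s t w)))"
    "\<And>k w. w \<in> space M \<Longrightarrow> sq_error (m k) (p k) (\<xi> k) Y s t w \<le> ennreal (4 * K\<^sup>2 * (t - s))"
proof -
  obtain m p \<xi> where a: "\<And>k. simple_integrand F (m k) (p k) (\<xi> k)" "\<And>k i. i \<le> m k \<Longrightarrow> p k i \<in> {s..t}"
      "null_in_prob_ennreal (\<lambda>k. sq_error (m k) (p k) (\<xi> k) Y s t)"
      "null_in_prob (\<lambda>k w. stoch_sum (m k) (p k) (\<xi> k) w - Z w)"
    using a unfolding approximable_def by (elim exE conjE) (rule that; (assumption | blast))
  define \<eta> where "\<eta> k i w = clip K (\<xi> k i w)" for k i w
  let ?\<delta> = "\<lambda>k i w. \<xi> k i w - \<eta> k i w"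
  let ?E\<xi> = "\<lambda>k. sq_error (m k) (p k) (\<xi> k) Y s t"
    and ?E\<eta> = "\<lambda>k. sq_error (m k) (p k) (\<eta> k) Y s t"
  let ?P = "\<lambda>k. simple_process (m k) (p k) (\<xi> k)"
  have mono: "p k i \<le> p k (Suc i)" if "i < m k" for k i
    using simple_integrandD(1)[OF a(1), of i "Suc i"] that by simp
  have xm: "\<xi> k i \<in> borel_measurable (F (p k i))" if "i < m k" for k i
    by (rule simple_integrandD(3)[OF a(1) that])
  have si: "simple_integrand F (m k) (p k) (\<eta> k)" for k
  proof (rule simple_integrand_cong_bound[OF a(1)])
    fix i assume "i < m k"
    from xm[OF this] show "\<eta> k i \<in> borel_measurable (F (p k i))"
      unfolding \<eta>_def by measurable
    show "\<bar>\<eta> k i w\<bar> \<le> 1 * \<bar>\<xi> k i w\<bar>" for w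
      using clip_props(3)[OF K(1)] by (simp add: \<eta>_def)
  qed simp
  have si_diff: "simple_integrand F (m k) (p k) (?\<delta> k)" for k
  proof (rule simple_integrand_cong_bound[OF a(1)])
    fix i assume "i < m k"
    from xm[OF this] show "(\<lambda>w. \<xi> k i w - \<eta> k i w) \<in> borel_measurable (F (p k i))"
      unfolding \<eta>_def by measurable
    show "\<bar>\<xi> k i w - \<eta> k i w\<bar> \<le> 1 * \<bar>\<xi> k i w\<bar>" for w
      using clip_props(4)[OF K(1), of 0 "\<xi> k i w"] K(1) by (simp add: \<eta>_def)
  qed simp
  have proc: "simple_process (m k) (p k) (\<eta> k) r w = clip K (?P k r w)" for k r w
    using simple_process_map[where f = "clip K" and m = "m k" and p = "p k" and \<xi> = "\<xi> k"] mono clip_props(1)[OF K(1)]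
    by (simp add: \<eta>_def[abs_def])
  have proc_diff: "simple_process (m k) (p k) (?\<delta> k) r w
      = ?P k r w - clip K (?P k r w)" for k r w
    using simple_process_map[where f = "\<lambda>x. x - clip K x" and m = "m k" and p = "p k" and \<xi> = "\<xi> k"]
      mono clip_props(1)[OF K(1)]
    by (simp add: \<eta>_def[abs_def])
  have sq_mono: "ennreal (x\<^sup>2) \<le> ennreal (y\<^sup>2)" if "\<bar>x\<bar> \<le> \<bar>y\<bar>" for x y :: real
    using that by (intro ennreal_leI) (simp add: abs_le_square_iff)
  have quad: "ennreal (quad_sum (m k) (p k) (?\<delta> k) w)
      \<le> ?E\<xi> k w" if w: "w \<in> space M" for k w
    unfolding nn_integral_simple_process_sq[OF si_diff, symmetric]
  proof (rule nn_integral_mono)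
    fix r
    show "ennreal ((simple_process (m k) (p k) (?\<delta> k) r w)\<^sup>2)
      \<le> ennreal ((?P k r w - Y r w)\<^sup>2) * indicator {s..t} r"
    proof (cases "r \<in> {s..t}")
      case True
      have "ennreal ((simple_process (m k) (p k) (?\<delta> k) r w)\<^sup>2)
          \<le> ennreal ((?P k r w - Y r w)\<^sup>2)"
        unfolding proc_diff by (intro sq_mono clip_props(4)[OF K(1) K(2)[OF True w]])
      then show ?thesis
        using True by simp
    next
      case False
      then show ?thesis
        using simple_process_outside[of "m k" s "p k" t r "?\<delta> k" w] a(2)[of _ k] by simp
    qed
  qed
  have err: "?E\<eta> k w \<le> ?E\<xi> k w"
    if w: "w \<in> space M" for k w
  proof (rule nn_integral_mono)
    fix r
    show "ennreal ((simple_process (m k) (p k) (\<eta> k) r w - Y r w)\<^sup>2) * indicator {s..t} r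
        \<le> ennreal ((?P k r w - Y r w)\<^sup>2) * indicator {s..t} r"
    proof (cases "r \<in> {s..t}")
      case True
      then show ?thesis
        unfolding proc by (intro mult_right_mono sq_mono clip_props(5)[OF K(1) K(2)[OF True w]]) auto
    qed simp
  qed
  have err_le: "?E\<eta> k w \<le> ennreal (4 * K\<^sup>2 * (t - s))"
    if w: "w \<in> space M" for k w
  proof -
    have "?E\<eta> k w \<le> (\<integral>\<^sup>+r\<in>{s..t}. ennreal ((2 * K)\<^sup>2) \<partial>lborel)"
    proof (rule nn_integral_mono)
      fix r
      show "ennreal ((simple_process (m k) (p k) (\<eta> k) r w - Y r w)\<^sup>2) * indicator {s..t} r
          \<le> ennreal ((2 * K)\<^sup>2) * indicator {s..t} r"
      proof (cases "r \<in> {s..t}")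
        case True
        have "\<bar>simple_process (m k) (p k) (\<eta> k) r w - Y r w\<bar> \<le> 2 * K"
          unfolding proc using clip_props(2)[OF K(1), of "?P k r w"] K(2)[OF True w]
          by linarith
        then show ?thesis
          using K(1) by (intro mult_right_mono sq_mono) auto
      qed simp
    qed
    also have "\<dots> = ennreal ((2 * K)\<^sup>2) * emeasure lborel {s..t}"
      by (simp add: nn_integral_cmult)
    also have "\<dots> = ennreal (4 * K\<^sup>2 * (t - s))"
      using st by (simp add: ennreal_mult power_mult_distrib)
    finally show ?thesis .
  qed
  note Jm = measurable_stoch_sum_M
  have "null_in_prob_ennreal (\<lambda>k w. ennreal (quad_sum (m k) (p k) (?\<delta> k) w))"
    by (rule null_in_prob_ennreal_mono[OF a(3) quad measurable_sq_error[OF a(1) Y]])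
  then have "null_in_prob (\<lambda>k. stoch_sum (m k) (p k) (?\<delta> k))"
    by (rule null_in_prob_stoch_sum[OF si_diff])
  then have "null_in_prob (\<lambda>k w. stoch_sum (m k) (p k) (\<xi> k) w - Z w
      - stoch_sum (m k) (p k) (?\<delta> k) w)"
    by (intro null_in_prob_diff a(4) borel_measurable_diff Jm[OF a(1)] Jm[OF si_diff] Zm)
  then have 4: "null_in_prob (\<lambda>k w. stoch_sum (m k) (p k) (\<eta> k) w - Z w)"
    by (simp add: wsum_diff algebra_simps)
  have N: "null_in_prob_ennreal (\<lambda>k. ?E\<eta> k)"
    by (rule null_in_prob_ennreal_mono[OF a(3) err measurable_sq_error[OF a(1) Y]])
  have 5: "null_in_prob (\<lambda>k w. sqrt (enn2real (?E\<eta> k w)))"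
    unfolding null_in_prob_def
  proof (intro allI impI)
    fix \<epsilon> :: real assume \<epsilon>: "0 < \<epsilon>"
    have *: "ennreal (\<epsilon>\<^sup>2) < x" if "\<epsilon> < \<bar>sqrt (enn2real x)\<bar>" for x
    proof (cases x)
      case (real u)
      then have "\<epsilon>\<^sup>2 < u"
        using that \<epsilon> power_strict_mono[of \<epsilon> "sqrt u" 2] by simp
      then show ?thesis
        using real by (simp add: ennreal_less_iff)
    qed simp
    show "(\<lambda>k. prob {w\<in>space M. \<epsilon> < \<bar>sqrt (enn2real (?E\<eta> k w))\<bar>}) \<longlonglongrightarrow> 0"
    proof (rule prob_tendsto_0_mono)
      show "(\<lambda>k. prob {w\<in>space M. ennreal (\<epsilon>\<^sup>2) < ?E\<eta> k w}) \<longlonglongrightarrow> 0"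
        using N \<epsilon> unfolding null_in_prob_ennreal_def by simp
      show "{w\<in>space M. ennreal (\<epsilon>\<^sup>2) < ?E\<eta> k w} \<in> events" for k
        using measurable_sq_error[OF si Y] by measurable
    qed (use * in blast)
  qed
  show thesis
    by (rule that[OF si a(2) _ 4 5 err_le]) (auto simp: \<eta>_def clip_props(2)[OF K(1)])
qed

lemma null_in_prob_uminus: "null_in_prob U \<Longrightarrow> null_in_prob (\<lambda>k w. - U k w)"
  by (simp add: null_in_prob_def)

text \<open>Everything later used about stochastic integrals. The last clause is a conditional form
  of the isometry as an upper bound: instead of the time integral of the weighted second moment of
  the integrand, it takes a bound \<open>b\<close> valid at each time.\<close>

theorem approximable_moments:
  assumes a: "approximable s t Y Z" and Zm: "Z \<in> borel_measurable M" and Y: "jointly_measurable Y"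
    and K: "0 \<le> K" "\<And>r w. r \<in> {s..t} \<Longrightarrow> w \<in> space M \<Longrightarrow> \<bar>Y r w\<bar> \<le> K" and st: "0 \<le> s" "s \<le> t"
  shows "integrable M (\<lambda>w. Z w ^ 4)"
    and "(\<integral>w. Z w ^ 4 \<partial>M) \<le> 24 * K ^ 4 * (t - s)\<^sup>2"
    and "\<And>\<zeta> c. \<zeta> \<in> borel_measurable (F s) \<Longrightarrow> (\<And>w. w \<in> space M \<Longrightarrow> \<bar>\<zeta> w\<bar> \<le> c) \<Longrightarrow>
      (\<integral>w. \<zeta> w * Z w \<partial>M) = 0"
    and "\<And>\<zeta> c b. \<zeta> \<in> borel_measurable (F s) \<Longrightarrow> (\<And>w. w \<in> space M \<Longrightarrow> 0 \<le> \<zeta> w \<and> \<zeta> w \<le> c) \<Longrightarrow>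
      (\<And>r. r \<in> {s..t} \<Longrightarrow> (\<integral>w. \<zeta> w * (Y r w)\<^sup>2 \<partial>M) \<le> b) \<Longrightarrow>
      (\<integral>w. \<zeta> w * (Z w)\<^sup>2 \<partial>M) \<le> b * (t - s)"
proof -
  obtain m p \<xi> where si: "\<And>k. simple_integrand F (m k) (p k) (\<xi> k)"
    and pst: "\<And>k i. i \<le> m k \<Longrightarrow> p k i \<in> {s..t}" and le_K: "\<And>k i w. \<bar>\<xi> k i w\<bar> \<le> K"
    and lim: "null_in_prob (\<lambda>k w. stoch_sum (m k) (p k) (\<xi> k) w - Z w)"
    and err: "null_in_prob (\<lambda>k w. sqrt (enn2real (sq_error (m k) (p k) (\<xi> k) Y s t w)))"
    and err_le: "\<And>k w. w \<in> space M \<Longrightarrow> sq_error (m k) (p k) (\<xi> k) Y s t w \<le> ennreal (4 * K\<^sup>2 * (t - s))"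
    by (rule approximable_bounded[OF a Zm Y K(1) _ st(2)]) (erule (1) K(2), rule that)
  define J where "J k = stoch_sum (m k) (p k) (\<xi> k)" for k
  define Q where "Q k w = enn2real (sq_error (m k) (p k) (\<xi> k) Y s t w)" for k w
  have Jm [measurable]: "J k \<in> borel_measurable M" for k
    unfolding J_def by (rule measurable_stoch_sum_M[OF si])
  have Qm [measurable]: "Q k \<in> borel_measurable M" for k
    unfolding Q_def using measurable_sq_error[OF si Y, of k s t] by measurable
  note Zm [measurable]
  have J4: "integrable M (\<lambda>w. J k w ^ 4)" for k
    unfolding J_def by (rule stoch_sum_moments(1)[OF si])
  have EJ4: "(\<integral>w. J k w ^ 4 \<partial>M) \<le> 3 * K ^ 4 * (t - s)\<^sup>2" for k
  proof -
    have "(\<integral>w. J k w ^ 4 \<partial>M) \<le> 3 * K ^ 4 * (p k (m k) - p k 0)\<^sup>2"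
      unfolding J_def by (rule stoch_sum_moments(4)[OF si le_K])
    also have "\<dots> \<le> 3 * K ^ 4 * (t - s)\<^sup>2"
      using pst[of 0 k] pst[of "m k" k] simple_integrandD(1)[OF si, of 0 "m k" k] K(1)
      by (intro mult_left_mono power_mono) auto
    finally show ?thesis .
  qed
  have limJ: "null_in_prob (\<lambda>k w. J k w - Z w)"
    using lim by (simp add: J_def)
  show Z4: "integrable M (\<lambda>w. Z w ^ 4)"
    by (rule moment4_limit(1)[OF limJ Jm Zm J4 EJ4])
  have EZ4: "(\<integral>w. Z w ^ 4 \<partial>M) \<le> 8 * (3 * K ^ 4 * (t - s)\<^sup>2)"
    by (rule moment4_limit(2)[OF limJ Jm Zm J4 EJ4])
  then show "(\<integral>w. Z w ^ 4 \<partial>M) \<le> 24 * K ^ 4 * (t - s)\<^sup>2"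
    by simp
  define U where "U k w = Z w - J k w" for k w
  have Um [measurable]: "U k \<in> borel_measurable M" for k
    unfolding U_def by measurable
  have U4_le: "U k w ^ 4 \<le> 8 * Z w ^ 4 + 8 * J k w ^ 4" for k w
    using power4_add_le[of "Z w" "- J k w"] by (simp add: U_def)
  have U4: "integrable M (\<lambda>w. U k w ^ 4)" for k
  proof (rule Bochner_Integration.integrable_bound)
    show "integrable M (\<lambda>w. 8 * Z w ^ 4 + 8 * J k w ^ 4)"
      using Z4 J4 by simp
    show "AE w in M. norm (U k w ^ 4) \<le> norm (8 * Z w ^ 4 + 8 * J k w ^ 4)"
      using U4_le by (auto simp: abs_of_nonneg)
  qed measurable
  have EU4_le: "(\<integral>w. U k w ^ 4 \<partial>M) \<le> 8 * (\<integral>w. Z w ^ 4 \<partial>M) + 8 * (\<integral>w. J k w ^ 4 \<partial>M)" for k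
    using integral_mono[OF U4[of k] _ U4_le] Z4 J4 by simp
  \<comment> \<open>In units of \<open>K ^ 4 * (t - s)\<^sup>2\<close>: 8 * 24 for \<open>Z\<close>
    and 8 * 3 for \<open>J k\<close> add up to 9 * 24.\<close>
  have EU4: "(\<integral>w. U k w ^ 4 \<partial>M) \<le> 9 * (8 * (3 * K ^ 4 * (t - s)\<^sup>2))" for k
    using EU4_le[of k] EZ4 EJ4[of k] by linarith
  have "null_in_prob U"
    using null_in_prob_uminus[OF limJ] by (simp add: U_def[abs_def])
  then have EU2: "(\<lambda>k. \<integral>w. (U k w)\<^sup>2 \<partial>M) \<longlonglongrightarrow> 0"
    by (rule expectation_sq_tendsto_0[OF _ Um U4 EU4])
  have Q_nonneg: "0 \<le> Q k w" for k w
    by (simp add: Q_def)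
  have Q_le: "Q k w \<le> 4 * K\<^sup>2 * (t - s)" if "w \<in> space M" for k w
    using enn2real_mono[OF err_le[OF that, of k]] st by (simp add: Q_def)
  have Q_int: "integrable M (Q k)" for k
    using Q_nonneg Q_le by (intro integrable_const_bound[where B = "4 * K\<^sup>2 * (t - s)"]) auto
  \<comment> \<open>\<open>expectation_sq_tendsto_0\<close> is applied to sqrt Q, whose fourth power
    is Q^2 and hence bounded.\<close>
  have EQ: "(\<lambda>k. \<integral>w. Q k w \<partial>M) \<longlonglongrightarrow> 0"
  proof -
    have sq4: "sqrt (Q k w) ^ 4 = (Q k w)\<^sup>2" for k w
      using power_mult[of "sqrt (Q k w)" 2 2] Q_nonneg by simp
    have le: "(Q k w)\<^sup>2 \<le> (4 * K\<^sup>2 * (t - s))\<^sup>2" if "w \<in> space M" for k w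
      using Q_le[OF that] Q_nonneg by (intro power_mono)
    have int: "integrable M (\<lambda>w. (Q k w)\<^sup>2)" for k
      using le by (intro integrable_const_bound[where B = "(4 * K\<^sup>2 * (t - s))\<^sup>2"]) auto
    have "(\<integral>w. (Q k w)\<^sup>2 \<partial>M) \<le> (\<integral>w. (4 * K\<^sup>2 * (t - s))\<^sup>2 \<partial>M)" for k
      using le int by (intro integral_mono) auto
    then have "(\<lambda>k. \<integral>w. (sqrt (Q k w))\<^sup>2 \<partial>M) \<longlonglongrightarrow> 0"
      using err int by (intro expectation_sq_tendsto_0) (auto simp: sq4 Q_def[symmetric] prob_space)
    then show ?thesis
      using Q_nonneg by simp
  qed
  have p0: "s \<le> p k 0" for k
    using pst[of 0 k] by simp
  note U2 = integrable_power_le_4[OF Um U4, of 2, simplified]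
  note Z2 = integrable_power_le_4[OF Zm Z4, of 2, simplified]
  note J2 = integrable_power_le_4[OF Jm J4, of 2, simplified]
  note Z1 = integrable_power_le_4[OF Zm Z4, of 1, simplified]
  note J1 = integrable_power_le_4[OF Jm J4, of 1, simplified]
  {
    fix \<zeta> :: "'a \<Rightarrow> real" and c :: real
    assume \<zeta>: "\<zeta> \<in> borel_measurable (F s)" "\<And>w. w \<in> space M \<Longrightarrow> \<bar>\<zeta> w\<bar> \<le> c"
    have \<zeta>m: "\<zeta> \<in> borel_measurable M"
      by (rule measurable_F_M[OF \<zeta>(1)])
    have int: "integrable M (\<lambda>w. \<zeta> w * X w)" if "integrable M X" for X
      using integrable_mult_bounded[OF that \<zeta>m \<zeta>(2)] by (simp add: mult.commute)
    have "\<bar>\<integral>w. \<zeta> w * Z w \<partial>M\<bar> \<le> 0 + \<delta>" if \<delta>: "0 < \<delta>" for \<delta> :: real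
    proof -
      \<comment> \<open>Replacing \<open>Z\<close> by \<open>J k\<close>, which is orthogonal to
        \<zeta>, leaves \<open>U k\<close>. Young's inequality with parameter \<delta> bounds the
        remaining term by the L2 norm, which tends to 0.\<close>
      have "\<bar>\<integral>w. \<zeta> w * Z w \<partial>M\<bar> \<le> \<delta> + c\<^sup>2 / (4 * \<delta>) * (\<integral>w. (U k w)\<^sup>2 \<partial>M)" for k
      proof -
        have "(\<integral>w. \<zeta> w * J k w \<partial>M) = 0"
          unfolding J_def by (rule stoch_sum_weighted(1)[OF si p0 \<zeta>])
        then have "(\<integral>w. \<zeta> w * Z w \<partial>M) = (\<integral>w. \<zeta> w * Z w - \<zeta> w * J k w \<partial>M)"
          using int[OF Z1] int[OF J1] by simp
        also have "\<dots> = (\<integral>w. \<zeta> w * U k w \<partial>M)"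
          by (simp add: U_def right_diff_distrib)
        also have "\<bar>\<dots>\<bar> \<le> (\<integral>w. \<bar>\<zeta> w * U k w\<bar> \<partial>M)"
          by (rule integral_abs_bound)
        also have "\<dots> \<le> (\<integral>w. \<delta> + c\<^sup>2 / (4 * \<delta>) * (U k w)\<^sup>2 \<partial>M)"
        proof (rule integral_mono)
          show "integrable M (\<lambda>w. \<bar>\<zeta> w * U k w\<bar>)"
            using int[of "U k"] Z1 J1 by (simp add: U_def[abs_def])
          show "integrable M (\<lambda>w. \<delta> + c\<^sup>2 / (4 * \<delta>) * (U k w)\<^sup>2)"
            using U2 by simp
          fix w assume "w \<in> space M"
          then have "\<bar>\<zeta> w * U k w\<bar> \<le> c * \<bar>U k w\<bar>"
            unfolding abs_mult by (intro mult_right_mono \<zeta>(2)) auto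
          also have "\<dots> \<le> \<delta> + c\<^sup>2 / (4 * \<delta>) * (U k w)\<^sup>2"
          proof -
            have "0 \<le> (2 * \<delta> - c * \<bar>U k w\<bar>)\<^sup>2 / (4 * \<delta>)"
              using \<delta> by simp
            also have "\<dots> = \<delta> - c * \<bar>U k w\<bar> + c\<^sup>2 / (4 * \<delta>) * (U k w)\<^sup>2"
              using \<delta> by (simp add: power2_diff power_mult_distrib field_simps) (simp add: power2_eq_square)
            finally show ?thesis
              by simp
          qed
          finally show "\<bar>\<zeta> w * U k w\<bar> \<le> \<delta> + c\<^sup>2 / (4 * \<delta>) * (U k w)\<^sup>2" .
        qed
        also have "\<dots> = \<delta> + c\<^sup>2 / (4 * \<delta>) * (\<integral>w. (U k w)\<^sup>2 \<partial>M)"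
          using U2 by (simp add: prob_space)
        finally show ?thesis .
      qed
      moreover have "(\<lambda>k. \<delta> + c\<^sup>2 / (4 * \<delta>) * (\<integral>w. (U k w)\<^sup>2 \<partial>M)) \<longlonglongrightarrow> \<delta> + c\<^sup>2 / (4 * \<delta>) * 0"
        by (intro tendsto_intros EU2)
      ultimately have "\<bar>\<integral>w. \<zeta> w * Z w \<partial>M\<bar> \<le> \<delta> + c\<^sup>2 / (4 * \<delta>) * 0"
        by (intro LIMSEQ_le_const) auto
      then show ?thesis
        by simp
    qed
    then have "\<bar>\<integral>w. \<zeta> w * Z w \<partial>M\<bar> \<le> 0"
      by (rule field_le_epsilon)
    then show "(\<integral>w. \<zeta> w * Z w \<partial>M) = 0"
      by simp
  }
  {
    fix \<zeta> :: "'a \<Rightarrow> real" and c b :: real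
    assume \<zeta>: "\<zeta> \<in> borel_measurable (F s)" "\<And>w. w \<in> space M \<Longrightarrow> 0 \<le> \<zeta> w \<and> \<zeta> w \<le> c"
      and b: "\<And>r. r \<in> {s..t} \<Longrightarrow> (\<integral>w. \<zeta> w * (Y r w)\<^sup>2 \<partial>M) \<le> b"
    have \<zeta>m [measurable]: "\<zeta> \<in> borel_measurable M"
      by (rule measurable_F_M[OF \<zeta>(1)])
    have \<zeta>_abs: "\<bar>\<zeta> w\<bar> \<le> c" if "w \<in> space M" for w
      using \<zeta>(2)[OF that] by simp
    have int: "integrable M (\<lambda>w. \<zeta> w * X w)" if "integrable M X" for X
      using integrable_mult_bounded[OF that \<zeta>m \<zeta>_abs] by (simp add: mult.commute)
    obtain w0 where "w0 \<in> space M"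
      using not_empty by blast
    then have c: "0 \<le> c"
      using \<zeta>(2)[of w0] by linarith
    \<comment> \<open>The bound at the single time \<open>s\<close> already forces \<open>b\<close>
      to be nonnegative.\<close>
    have "0 \<le> (\<integral>w. \<zeta> w * (Y s w)\<^sup>2 \<partial>M)"
      using \<zeta>(2) by (intro integral_nonneg_AE AE_I2) auto
    also have "\<dots> \<le> b"
      using b st by simp
    finally have b0: "0 \<le> b" .
    have Ypair [measurable]: "(\<lambda>(w, r). Y r w) \<in> borel_measurable (M \<Otimes>\<^sub>M lborel)"
      using Y unfolding jointly_measurable_def
      by (simp cong: measurable_cong_sets sets_pair_measure_cong)
    have Yr [measurable]: "Y r \<in> borel_measurable M" for r
      using measurable_compose[OF measurable_Pair2' Y[unfolded jointly_measurable_def], of r]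
      by (simp add: comp_def)
    interpret P: pair_sigma_finite M lborel ..
    have Y2: "(\<integral>\<^sup>+w. ennreal (\<zeta> w) * (\<integral>\<^sup>+r\<in>{s..t}. ennreal ((Y r w)\<^sup>2) \<partial>lborel) \<partial>M) \<le> ennreal (b * (t - s))"
    proof -
      have "(\<integral>\<^sup>+w. ennreal (\<zeta> w) * (\<integral>\<^sup>+r\<in>{s..t}. ennreal ((Y r w)\<^sup>2) \<partial>lborel) \<partial>M)
          = (\<integral>\<^sup>+w. (\<integral>\<^sup>+r. ennreal (\<zeta> w * (Y r w)\<^sup>2) * indicator {s..t} r \<partial>lborel) \<partial>M)"
      proof (rule nn_integral_cong)
        fix w assume w: "w \<in> space M"
        have [measurable]: "(\<lambda>r. Y r w) \<in> borel_measurable lborel"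
          using measurable_jointly_right[OF Y w] by simp
        show "ennreal (\<zeta> w) * (\<integral>\<^sup>+r\<in>{s..t}. ennreal ((Y r w)\<^sup>2) \<partial>lborel)
            = (\<integral>\<^sup>+r. ennreal (\<zeta> w * (Y r w)\<^sup>2) * indicator {s..t} r \<partial>lborel)"
          using \<zeta>(2)[OF w] by (simp add: nn_integral_cmult[symmetric] ennreal_mult mult.assoc)
      qed
      also have "\<dots> = (\<integral>\<^sup>+r. (\<integral>\<^sup>+w. ennreal (\<zeta> w * (Y r w)\<^sup>2) * indicator {s..t} r \<partial>M) \<partial>lborel)"
        by (rule P.Fubini'[symmetric]) measurable
      also have "\<dots> \<le> (\<integral>\<^sup>+r. ennreal b * indicator {s..t} r \<partial>lborel)"
      proof (rule nn_integral_mono)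
        fix r
        show "(\<integral>\<^sup>+w. ennreal (\<zeta> w * (Y r w)\<^sup>2) * indicator {s..t} r \<partial>M) \<le> ennreal b * indicator {s..t} r"
        proof (cases "r \<in> {s..t}")
          case True
          have "(Y r w)\<^sup>2 \<le> K\<^sup>2" if "w \<in> space M" for w
            using power_mono[OF K(2)[OF True that], of 2] by simp
          then have "integrable M (\<lambda>w. (Y r w)\<^sup>2)"
            by (intro integrable_const_bound[where B = "K\<^sup>2"]) auto
          from int[OF this] have "(\<integral>\<^sup>+w. ennreal (\<zeta> w * (Y r w)\<^sup>2) \<partial>M) = ennreal (\<integral>w. \<zeta> w * (Y r w)\<^sup>2 \<partial>M)"
            using \<zeta>(2) by (intro nn_integral_eq_integral AE_I2) auto
          also have "\<dots> \<le> ennreal b"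
            by (rule ennreal_leI[OF b[OF True]])
          finally show ?thesis
            using True by simp
        qed simp
      qed
      also have "\<dots> = ennreal (b * (t - s))"
        using st b0 by (simp add: nn_integral_cmult ennreal_mult)
      finally show ?thesis .
    qed
    let ?b = "b * (t - s)"
    \<comment> \<open>The factor 1 + \<kappa> is paid twice, for replacing \<open>Z\<close> by
      \<open>J k\<close> and the simple process by \<open>Y\<close>. The weighted form of Young's
      inequality keeps the main term nearly unchanged, so \<kappa> tending to 0 restores the
      constant 1.\<close>
    have bound: "(\<integral>w. \<zeta> w * (Z w)\<^sup>2 \<partial>M) \<le> (1 + \<kappa>)\<^sup>2 * ?b" if \<kappa>: "0 < \<kappa>" for \<kappa> :: real
    proof -
      let ?q = "\<lambda>k. quad_sum (m k) (p k) (\<xi> k)"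
      let ?\<kappa> = "1 + 1 / \<kappa>"
      have quad: "(\<integral>w. \<zeta> w * ?q k w \<partial>M)
          \<le> (1 + \<kappa>) * ?b + ?\<kappa> * c * (\<integral>w. Q k w \<partial>M)" for k
      proof -
        let ?E = "\<lambda>w. sq_error (m k) (p k) (\<xi> k) Y s t w"
        let ?Y = "\<lambda>w. \<integral>\<^sup>+r\<in>{s..t}. ennreal ((Y r w)\<^sup>2) \<partial>lborel"
        have [measurable]: "?Y \<in> borel_measurable M" "?E \<in> borel_measurable M"
          by (rule measurable_nn_integral_sq[OF Y], rule measurable_sq_error[OF si Y])
        have pt: "ennreal (?q k w) \<le> ennreal (1 + \<kappa>) * ?Y w + ennreal ?\<kappa> * ?E w"
          if w: "w \<in> space M" for w
        proof -
          let ?P = "\<lambda>r. simple_process (m k) (p k) (\<xi> k) r w"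
          have [measurable]: "(\<lambda>r. Y r w) \<in> borel_measurable lborel" "?P \<in> borel_measurable lborel"
            using measurable_jointly_right[OF Y w] measurable_simple_process_right by simp_all
          have "ennreal (?q k w) = (\<integral>\<^sup>+r. ennreal ((?P r)\<^sup>2) \<partial>lborel)"
            by (rule nn_integral_simple_process_sq[OF si, symmetric])
          also have "\<dots> \<le> (\<integral>\<^sup>+r. ennreal (1 + \<kappa>) * (ennreal ((Y r w)\<^sup>2) * indicator {s..t} r)
              + ennreal ?\<kappa> * (ennreal ((?P r - Y r w)\<^sup>2) * indicator {s..t} r) \<partial>lborel)"
          proof (rule nn_integral_mono)
            fix r
            show "ennreal ((?P r)\<^sup>2) \<le> ennreal (1 + \<kappa>) * (ennreal ((Y r w)\<^sup>2) * indicator {s..t} r)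
              + ennreal ?\<kappa> * (ennreal ((?P r - Y r w)\<^sup>2) * indicator {s..t} r)"
            proof (cases "r \<in> {s..t}")
              case True
              have "ennreal ((?P r)\<^sup>2) \<le> ennreal ((1 + \<kappa>) * (Y r w)\<^sup>2 + ?\<kappa> * (?P r - Y r w)\<^sup>2)"
                using sq_add_le_weighted[OF \<kappa>, of "Y r w" "?P r - Y r w"] by (intro ennreal_leI) simp
              also have "\<dots> = ennreal (1 + \<kappa>) * ennreal ((Y r w)\<^sup>2) + ennreal ?\<kappa> * ennreal ((?P r - Y r w)\<^sup>2)"
                using \<kappa> by (simp add: ennreal_plus ennreal_mult del: ennreal_plus[symmetric])
              finally show ?thesis
                using True by simp
            next
              case False
              then show ?thesis
                using simple_process_outside[of "m k" s "p k" t r "\<xi> k" w] pst[of _ k] by simp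
            qed
          qed
          also have "\<dots> = ennreal (1 + \<kappa>) * ?Y w + ennreal ?\<kappa> * ?E w"
            by (subst nn_integral_add; simp add: nn_integral_cmult)
          finally show ?thesis .
        qed
        have "ennreal (\<integral>w. \<zeta> w * ?q k w \<partial>M)
            = (\<integral>\<^sup>+w. ennreal (\<zeta> w * ?q k w) \<partial>M)"
          using int[OF integrable_quad_sum[OF si]] \<zeta>(2) quad_sum_nonneg[OF si]
          by (intro nn_integral_eq_integral[symmetric] AE_I2) auto
        also have "\<dots> \<le> (\<integral>\<^sup>+w. ennreal (1 + \<kappa>) * (ennreal (\<zeta> w) * ?Y w)
            + ennreal (?\<kappa> * c) * ?E w \<partial>M)"
        proof (rule nn_integral_mono)
          fix w assume w: "w \<in> space M"
          have "ennreal (\<zeta> w * ?q k w)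
              \<le> ennreal (\<zeta> w) * (ennreal (1 + \<kappa>) * ?Y w + ennreal ?\<kappa> * ?E w)"
            using \<zeta>(2)[OF w] quad_sum_nonneg[OF si] by (simp only: ennreal_mult) (intro mult_left_mono pt[OF w], simp)
          also have "\<dots> = ennreal (1 + \<kappa>) * (ennreal (\<zeta> w) * ?Y w) + ennreal ?\<kappa> * ennreal (\<zeta> w) * ?E w"
            by (simp add: distrib_left mult_ac)
          also have "\<dots> \<le> ennreal (1 + \<kappa>) * (ennreal (\<zeta> w) * ?Y w) + ennreal ?\<kappa> * ennreal c * ?E w"
            using \<zeta>(2)[OF w] by (intro add_mono mult_right_mono mult_left_mono ennreal_leI) auto
          also have "ennreal ?\<kappa> * ennreal c = ennreal (?\<kappa> * c)"
            using \<kappa> c by (simp add: ennreal_mult)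
          finally show "ennreal (\<zeta> w * ?q k w) \<le> ennreal (1 + \<kappa>) * (ennreal (\<zeta> w) * ?Y w)
            + ennreal (?\<kappa> * c) * ?E w" .
        qed
        also have "\<dots> = ennreal (1 + \<kappa>) * (\<integral>\<^sup>+w. ennreal (\<zeta> w) * ?Y w \<partial>M)
            + ennreal (?\<kappa> * c) * (\<integral>\<^sup>+w. ?E w \<partial>M)"
          by (subst nn_integral_add; simp add: nn_integral_cmult)
        also have "(\<integral>\<^sup>+w. ?E w \<partial>M) = ennreal (\<integral>w. Q k w \<partial>M)"
        proof -
          have "(\<integral>\<^sup>+w. ?E w \<partial>M) = (\<integral>\<^sup>+w. ennreal (Q k w) \<partial>M)"
          proof (rule nn_integral_cong)
            fix w assume "w \<in> space M"
            from err_le[OF this, of k] show "?E w = ennreal (Q k w)"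
              unfolding Q_def by (intro ennreal_enn2real[symmetric]) (auto intro: le_less_trans)
          qed
          also have "\<dots> = ennreal (\<integral>w. Q k w \<partial>M)"
            using Q_int Q_nonneg by (intro nn_integral_eq_integral) auto
          finally show ?thesis .
        qed
        also have "ennreal (1 + \<kappa>) * (\<integral>\<^sup>+w. ennreal (\<zeta> w) * ?Y w \<partial>M)
            + ennreal (?\<kappa> * c) * ennreal (\<integral>w. Q k w \<partial>M)
            \<le> ennreal (1 + \<kappa>) * ennreal ?b + ennreal (?\<kappa> * c) * ennreal (\<integral>w. Q k w \<partial>M)"
          by (intro add_mono mult_left_mono Y2) auto
        also have "\<dots> = ennreal ((1 + \<kappa>) * ?b + ?\<kappa> * c * (\<integral>w. Q k w \<partial>M))"
        proof -
          have "0 \<le> (\<integral>w. Q k w \<partial>M)"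
            using Q_nonneg by simp
          then show ?thesis
            using \<kappa> c b0 st by (simp add: ennreal_plus ennreal_mult del: ennreal_plus[symmetric])
        qed
        finally show ?thesis
          using \<kappa> c b0 st Q_nonneg by (subst (asm) ennreal_le_iff) (auto intro!: add_nonneg_nonneg mult_nonneg_nonneg integral_nonneg_AE)
      qed
      have "(\<integral>w. \<zeta> w * (Z w)\<^sup>2 \<partial>M) \<le> (1 + \<kappa>) * ((1 + \<kappa>) * ?b + ?\<kappa> * c * (\<integral>w. Q k w \<partial>M))
          + ?\<kappa> * c * (\<integral>w. (U k w)\<^sup>2 \<partial>M)" for k
      proof -
        have "(\<integral>w. \<zeta> w * (Z w)\<^sup>2 \<partial>M) \<le> (\<integral>w. (1 + \<kappa>) * (\<zeta> w * (J k w)\<^sup>2) + ?\<kappa> * c * (U k w)\<^sup>2 \<partial>M)"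
        proof (rule integral_mono)
          show "integrable M (\<lambda>w. \<zeta> w * (Z w)\<^sup>2)"
            by (rule int[OF Z2])
          show "integrable M (\<lambda>w. (1 + \<kappa>) * (\<zeta> w * (J k w)\<^sup>2) + ?\<kappa> * c * (U k w)\<^sup>2)"
            using int[OF J2] U2 by simp
          fix w assume w: "w \<in> space M"
          have "\<zeta> w * (Z w)\<^sup>2 \<le> \<zeta> w * ((1 + \<kappa>) * (J k w)\<^sup>2 + ?\<kappa> * (U k w)\<^sup>2)"
            using sq_add_le_weighted[OF \<kappa>, of "J k w" "U k w"] \<zeta>(2)[OF w]
            by (intro mult_left_mono) (auto simp: U_def)
          also have "\<dots> = (1 + \<kappa>) * (\<zeta> w * (J k w)\<^sup>2) + ?\<kappa> * \<zeta> w * (U k w)\<^sup>2"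
            by (simp add: algebra_simps)
          also have "\<dots> \<le> (1 + \<kappa>) * (\<zeta> w * (J k w)\<^sup>2) + ?\<kappa> * c * (U k w)\<^sup>2"
            using \<zeta>(2)[OF w] \<kappa> by (intro add_left_mono mult_right_mono mult_left_mono) auto
          finally show "\<zeta> w * (Z w)\<^sup>2 \<le> (1 + \<kappa>) * (\<zeta> w * (J k w)\<^sup>2) + ?\<kappa> * c * (U k w)\<^sup>2" .
        qed
        also have "\<dots> = (1 + \<kappa>) * (\<integral>w. \<zeta> w * (J k w)\<^sup>2 \<partial>M) + ?\<kappa> * c * (\<integral>w. (U k w)\<^sup>2 \<partial>M)"
          using int[OF J2] U2 by simp
        also have "(\<integral>w. \<zeta> w * (J k w)\<^sup>2 \<partial>M) = (\<integral>w. \<zeta> w * ?q k w \<partial>M)"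
          unfolding J_def using \<zeta>(2) by (intro stoch_sum_weighted(2)[OF si p0 \<zeta>(1) \<zeta>_abs]) auto
        finally show ?thesis
          using mult_left_mono[OF quad[of k], of "1 + \<kappa>"] \<kappa> by linarith
      qed
      moreover have "(\<lambda>k. (1 + \<kappa>) * ((1 + \<kappa>) * ?b + ?\<kappa> * c * (\<integral>w. Q k w \<partial>M))
          + ?\<kappa> * c * (\<integral>w. (U k w)\<^sup>2 \<partial>M))
        \<longlonglongrightarrow> (1 + \<kappa>) * ((1 + \<kappa>) * ?b + ?\<kappa> * c * 0) + ?\<kappa> * c * 0"
        by (intro tendsto_intros EU2 EQ)
      ultimately have "(\<integral>w. \<zeta> w * (Z w)\<^sup>2 \<partial>M)
          \<le> (1 + \<kappa>) * ((1 + \<kappa>) * ?b + ?\<kappa> * c * 0) + ?\<kappa> * c * 0"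
        by (intro LIMSEQ_le_const) auto
      then show ?thesis
        by (simp add: power2_eq_square mult.assoc)
    qed
    have "(\<lambda>n. (1 + inverse (real (Suc n)))\<^sup>2 * ?b) \<longlonglongrightarrow> (1 + 0)\<^sup>2 * ?b"
      by (intro tendsto_intros LIMSEQ_inverse_real_of_nat)
    then have "(\<integral>w. \<zeta> w * (Z w)\<^sup>2 \<partial>M) \<le> (1 + 0)\<^sup>2 * ?b"
      by (rule LIMSEQ_le_const) (use bound in auto)
    then show "(\<integral>w. \<zeta> w * (Z w)\<^sup>2 \<partial>M) \<le> ?b"
      by simp
  }
qed

end

section \<open>An upper bound from Taylor expansion along partitions\<close>

lemma taylor3_le:
  fixes \<phi> \<phi>1 \<phi>2 \<phi>3 :: "real \<Rightarrow> real"
  assumes "\<And>x. (\<phi> has_real_derivative \<phi>1 x) (at x)" "\<And>x. (\<phi>1 has_real_derivative \<phi>2 x) (at x)"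
    "\<And>x. (\<phi>2 has_real_derivative \<phi>3 x) (at x)" and L: "\<And>x. \<bar>\<phi>3 x\<bar> \<le> L"
  shows "\<phi> b \<le> \<phi> a + \<phi>1 a * (b - a) + \<phi>2 a / 2 * (b - a)\<^sup>2 + L / 6 * \<bar>b - a\<bar> ^ 3"
proof (cases "a = b")
  case False
  define d where "d = (\<lambda>m :: nat. if m = 0 then \<phi> else if m = 1 then \<phi>1 else if m = 2 then \<phi>2 else \<phi>3)"
  have "\<exists>t. (if b < a then b < t \<and> t < a else a < t \<and> t < b) \<and>
      \<phi> b = (\<Sum>m<3. d m a / fact m * (b - a) ^ m) + d 3 t / fact 3 * (b - a) ^ 3"
  proof (rule Taylor[where a = "min a b" and b = "max a b"])
    show "\<forall>m t. m < 3 \<and> min a b \<le> t \<and> t \<le> max a b \<longrightarrow> DERIV (d m) t :> d (Suc m) t"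
      using assms(1-3) by (auto simp: d_def less_Suc_eq numeral_3_eq_3)
  qed (use False in \<open>auto simp: d_def\<close>)
  then obtain t where "\<phi> b = (\<Sum>m<3. d m a / fact m * (b - a) ^ m) + d 3 t / fact 3 * (b - a) ^ 3"
    by blast
  also have "\<dots> = \<phi> a + \<phi>1 a * (b - a) + \<phi>2 a / 2 * (b - a)\<^sup>2 + \<phi>3 t * (b - a) ^ 3 / 6"
    by (simp add: d_def numeral_3_eq_3 fact_numeral power2_eq_square)
  also have "\<phi>3 t * (b - a) ^ 3 \<le> L * \<bar>b - a\<bar> ^ 3"
  proof -
    have "\<phi>3 t * (b - a) ^ 3 \<le> \<bar>\<phi>3 t\<bar> * \<bar>b - a\<bar> ^ 3"
      by (metis abs_ge_self abs_mult power_abs)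
    also have "\<dots> \<le> L * \<bar>b - a\<bar> ^ 3"
      using L by (intro mult_right_mono) auto
    finally show ?thesis .
  qed
  finally show ?thesis
    by simp
qed simp

lemma lipschitz_of_derivative_bound:
  fixes f f' :: "real \<Rightarrow> real"
  assumes "\<And>x. (f has_real_derivative f' x) (at x)" "\<And>x. \<bar>f' x\<bar> \<le> L"
  shows "\<bar>f x - f y\<bar> \<le> L * \<bar>x - y\<bar>"
  using field_differentiable_bound[of UNIV f f' L x y] assms by auto

lemma measurable_of_derivative:
  fixes f f' :: "real \<Rightarrow> real"
  assumes "\<And>x. (f has_real_derivative f' x) (at x)"
  shows "f \<in> borel_measurable borel"
  using assms by (intro borel_measurable_continuous_onI continuous_at_imp_continuous_on) (auto intro: DERIV_isCont)

text \<open>The interface between stochastic integration and the estimates: \<open>D\<close> is the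
  integral of \<open>G\<close>, known only through moments of its increments. \<open>K\<close>
  enters only remainders that vanish under refinement, so the final constants are free of
  it.\<close>

locale bounded_ito_process = brownian_motion M F B
  for M :: "'a measure" and F B +
  fixes D G :: "real \<Rightarrow> 'a \<Rightarrow> real" and K :: real
  assumes adapted_D: "0 \<le> t \<Longrightarrow> D t \<in> borel_measurable (F t)"
    and D_0: "AE w in M. D 0 w = 0"
    and K_nonneg: "0 \<le> K"
    and measurable_G: "0 \<le> t \<Longrightarrow> G t \<in> borel_measurable M"
    and G_le: "0 \<le> t \<Longrightarrow> w \<in> space M \<Longrightarrow> \<bar>G t w\<bar> \<le> K"
    and increment4: "0 \<le> s \<Longrightarrow> s \<le> t \<Longrightarrow> integrable M (\<lambda>w. (D t w - D s w) ^ 4)"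
      "0 \<le> s \<Longrightarrow> s \<le> t \<Longrightarrow> (\<integral>w. (D t w - D s w) ^ 4 \<partial>M) \<le> 24 * K ^ 4 * (t - s)\<^sup>2"
    and increment_orthogonal: "0 \<le> s \<Longrightarrow> s \<le> t \<Longrightarrow> \<zeta> \<in> borel_measurable (F s) \<Longrightarrow>
      (\<And>w. w \<in> space M \<Longrightarrow> \<bar>\<zeta> w\<bar> \<le> c) \<Longrightarrow> (\<integral>w. \<zeta> w * (D t w - D s w) \<partial>M) = 0"
    and increment_sq: "0 \<le> s \<Longrightarrow> s \<le> t \<Longrightarrow> \<zeta> \<in> borel_measurable (F s) \<Longrightarrow>
      (\<And>w. w \<in> space M \<Longrightarrow> 0 \<le> \<zeta> w \<and> \<zeta> w \<le> c) \<Longrightarrow>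
      (\<And>r. r \<in> {s..t} \<Longrightarrow> (\<integral>w. \<zeta> w * (G r w)\<^sup>2 \<partial>M) \<le> b) \<Longrightarrow>
      (\<integral>w. \<zeta> w * (D t w - D s w)\<^sup>2 \<partial>M) \<le> b * (t - s)"
begin

lemma measurable_D: "0 \<le> t \<Longrightarrow> D t \<in> borel_measurable M"
  by (rule measurable_F_M[OF adapted_D])

lemma measurable_increment: "0 \<le> s \<Longrightarrow> 0 \<le> t \<Longrightarrow> (\<lambda>w. D t w - D s w) \<in> borel_measurable M"
  by (intro borel_measurable_diff measurable_D)

lemma integrable_increment:
  assumes "0 \<le> s" "s \<le> t" "j \<le> 4"
  shows "integrable M (\<lambda>w. (D t w - D s w) ^ j)"
  using assms by (intro integrable_power_le_4[OF measurable_increment increment4(1)]) auto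

lemma integrable_D4:
  assumes "0 \<le> t"
  shows "integrable M (\<lambda>w. D t w ^ 4)"
proof (rule integrable_cong_AE_imp[OF increment4(1)[OF order_refl assms]])
  show "(\<lambda>w. D t w ^ 4) \<in> borel_measurable M"
    using measurable_D[OF assms] by measurable
  show "AE w in M. (D t w - D 0 w) ^ 4 = D t w ^ 4"
    using D_0 by eventually_elim simp
qed

lemma integrable_D_power: "0 \<le> t \<Longrightarrow> j \<le> 4 \<Longrightarrow> integrable M (\<lambda>w. D t w ^ j)"
  by (rule integrable_power_le_4[OF measurable_D integrable_D4])

lemma expectation_G_sq_le:
  assumes "0 \<le> r"
  shows "integrable M (\<lambda>w. (G r w)\<^sup>2)" "(\<integral>w. (G r w)\<^sup>2 \<partial>M) \<le> K\<^sup>2"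
proof -
  have le: "(G r w)\<^sup>2 \<le> K\<^sup>2" if "w \<in> space M" for w
    using power_mono[OF G_le[OF assms that], of 2] by simp
  show int: "integrable M (\<lambda>w. (G r w)\<^sup>2)"
    using le measurable_G[OF assms] by (intro integrable_const_bound[where B = "K\<^sup>2"]) auto
  have "(\<integral>w. (G r w)\<^sup>2 \<partial>M) \<le> (\<integral>w. K\<^sup>2 \<partial>M)"
    using le int by (intro integral_mono) auto
  then show "(\<integral>w. (G r w)\<^sup>2 \<partial>M) \<le> K\<^sup>2"
    by (simp add: prob_space)
qed

lemma increment_sq_le:
  assumes "0 \<le> s" "s \<le> t" "\<And>r. r \<in> {s..t} \<Longrightarrow> (\<integral>w. (G r w)\<^sup>2 \<partial>M) \<le> b"
  shows "(\<integral>w. (D t w - D s w)\<^sup>2 \<partial>M) \<le> b * (t - s)"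
  using increment_sq[OF assms(1,2), of "\<lambda>_. 1" 1 b] assms(3) by simp

lemma increment_sq_le_K:
  assumes "0 \<le> s" "s \<le> t"
  shows "(\<integral>w. (D t w - D s w)\<^sup>2 \<partial>M) \<le> K\<^sup>2 * (t - s)"
  using assms by (intro increment_sq_le expectation_G_sq_le) auto

text \<open>Young's inequality with weight sqrt h takes the place of the Cauchy-Schwarz inequality;
  it turns the second moment of order h into a first moment of order sqrt h.\<close>

lemma increment_abs_le:
  assumes "0 \<le> s" "s \<le> r" "r - s \<le> h" "0 < h"
  shows "(\<integral>w. \<bar>D r w - D s w\<bar> \<partial>M) \<le> (K\<^sup>2 + 1) / 2 * sqrt h"
proof -
  have pt: "\<bar>x\<bar> \<le> x\<^sup>2 / (2 * sqrt h) + sqrt h / 2" for x :: real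
  proof -
    have "0 \<le> (\<bar>x\<bar> - sqrt h)\<^sup>2 / (2 * sqrt h)"
      using assms by simp
    also have "\<dots> = x\<^sup>2 / (2 * sqrt h) - \<bar>x\<bar> + sqrt h / 2"
      using assms by (simp add: power2_diff field_simps)
    finally show ?thesis
      by simp
  qed
  have int: "integrable M (\<lambda>w. (D r w - D s w)\<^sup>2)" "integrable M (\<lambda>w. D r w - D s w)"
    using integrable_increment[OF assms(1,2), of 2] integrable_increment[OF assms(1,2), of 1] by auto
  have "(\<integral>w. \<bar>D r w - D s w\<bar> \<partial>M) \<le> (\<integral>w. (D r w - D s w)\<^sup>2 / (2 * sqrt h) + sqrt h / 2 \<partial>M)"
    using int by (intro integral_mono pt) auto
  also have "\<dots> = (\<integral>w. (D r w - D s w)\<^sup>2 \<partial>M) / (2 * sqrt h) + sqrt h / 2"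
    using int by (simp add: prob_space)
  also have "(\<integral>w. (D r w - D s w)\<^sup>2 \<partial>M) / (2 * sqrt h) \<le> K\<^sup>2 * h / (2 * sqrt h)"
  proof (rule divide_right_mono)
    have "(\<integral>w. (D r w - D s w)\<^sup>2 \<partial>M) \<le> K\<^sup>2 * (r - s)"
      by (rule increment_sq_le_K[OF assms(1,2)])
    also have "\<dots> \<le> K\<^sup>2 * h"
      using assms(3) by (intro mult_left_mono) auto
    finally show "(\<integral>w. (D r w - D s w)\<^sup>2 \<partial>M) \<le> K\<^sup>2 * h" .
  qed (use assms in simp)
  also have "K\<^sup>2 * h / (2 * sqrt h) = K\<^sup>2 / 2 * sqrt h"
    using assms(4) by (simp add: field_simps)
  finally show ?thesis
    by (simp add: algebra_simps add_divide_distrib)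
qed

text \<open>Interpolation by Young's inequality between the fourth moment, of order h^2, and the
  second, of order h; the weight sqrt h gives both terms the order h sqrt h.\<close>

lemma increment_cube_le:
  assumes "0 \<le> s" "s < t"
  shows "integrable M (\<lambda>w. \<bar>D t w - D s w\<bar> ^ 3)"
    and "(\<integral>w. \<bar>D t w - D s w\<bar> ^ 3 \<partial>M) \<le> (24 * K ^ 4 + K\<^sup>2) / 2 * ((t - s) * sqrt (t - s))"
proof -
  let ?h = "t - s"
  have h: "0 < ?h"
    using assms by simp
  have pt: "\<bar>x\<bar> ^ 3 \<le> x ^ 4 / (2 * sqrt ?h) + sqrt ?h / 2 * x\<^sup>2" for x :: real
  proof -
    have "0 \<le> (\<bar>x\<bar> - sqrt ?h)\<^sup>2 * x\<^sup>2 / (2 * sqrt ?h)"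
      using h by simp
    also have "\<dots> = (\<bar>x\<bar>\<^sup>2 * x\<^sup>2 - 2 * \<bar>x\<bar> * sqrt ?h * x\<^sup>2 + (sqrt ?h * sqrt ?h) * x\<^sup>2) / (2 * sqrt ?h)"
      by (simp add: power2_diff power2_eq_square algebra_simps)
    also have "\<dots> = x ^ 4 / (2 * sqrt ?h) - \<bar>x\<bar> * x\<^sup>2 + sqrt ?h / 2 * x\<^sup>2"
      using h by (simp add: field_simps power4_eq_xxxx power2_eq_square del: real_sqrt_mult_self)
    also have "\<bar>x\<bar> * x\<^sup>2 = \<bar>x\<bar> ^ 3"
      by (metis power2_abs power3_eq_cube power2_eq_square mult.assoc)
    finally show ?thesis
      by simp
  qed
  have int: "integrable M (\<lambda>w. (D t w - D s w) ^ j)" if "j \<le> 4" for j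
    using assms that by (intro integrable_increment) auto
  show int3: "integrable M (\<lambda>w. \<bar>D t w - D s w\<bar> ^ 3)"
    using integrable_abs[OF int[of 3]] by (simp add: power_abs)
  have "(\<integral>w. \<bar>D t w - D s w\<bar> ^ 3 \<partial>M)
      \<le> (\<integral>w. (D t w - D s w) ^ 4 / (2 * sqrt ?h) + sqrt ?h / 2 * (D t w - D s w)\<^sup>2 \<partial>M)"
    using int[of 4] int[of 2] int3 by (intro integral_mono pt) auto
  also have "\<dots> = (\<integral>w. (D t w - D s w) ^ 4 \<partial>M) / (2 * sqrt ?h) + sqrt ?h / 2 * (\<integral>w. (D t w - D s w)\<^sup>2 \<partial>M)"
    using int[of 4] int[of 2] by simp
  also have "\<dots> \<le> 24 * K ^ 4 * ?h\<^sup>2 / (2 * sqrt ?h) + sqrt ?h / 2 * (K\<^sup>2 * ?h)"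
    using assms by (intro add_mono divide_right_mono mult_left_mono increment4(2) increment_sq_le_K) auto
  also have "?h\<^sup>2 = ?h * (sqrt ?h * sqrt ?h)"
    using h by (simp add: power2_eq_square)
  also have "24 * K ^ 4 * (?h * (sqrt ?h * sqrt ?h)) / (2 * sqrt ?h) + sqrt ?h / 2 * (K\<^sup>2 * ?h)
      = (24 * K ^ 4 + K\<^sup>2) / 2 * (?h * sqrt ?h)"
    using h by (simp add: field_simps del: real_sqrt_mult_self)
  finally show "(\<integral>w. \<bar>D t w - D s w\<bar> ^ 3 \<partial>M) \<le> (24 * K ^ 4 + K\<^sup>2) / 2 * (?h * sqrt ?h)" .
qed

text \<open>The weights \<open>\<phi>1 (D s)\<close> and the running maxima are unbounded but square
  integrable; cutting them off at n and dominated convergence reduce to bounded weights.\<close>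

lemma increment_orthogonal_L2:
  assumes st: "0 \<le> s" "s \<le> t" and \<zeta>: "\<zeta> \<in> borel_measurable (F s)" "integrable M (\<lambda>w. (\<zeta> w)\<^sup>2)"
  shows "integrable M (\<lambda>w. \<zeta> w * (D t w - D s w))" "(\<integral>w. \<zeta> w * (D t w - D s w) \<partial>M) = 0"
proof -
  have m [measurable]: "\<zeta> \<in> borel_measurable M"
    by (rule measurable_F_M[OF \<zeta>(1)])
  have [measurable]: "D s \<in> borel_measurable M" "D t \<in> borel_measurable M"
    using st by (auto intro: measurable_D)
  show int: "integrable M (\<lambda>w. \<zeta> w * (D t w - D s w))"
  proof (rule Bochner_Integration.integrable_bound)
    show "integrable M (\<lambda>w. (\<zeta> w)\<^sup>2 + (D t w - D s w)\<^sup>2)"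
      using \<zeta>(2) integrable_increment[OF st, of 2] by simp
    show "AE w in M. norm (\<zeta> w * (D t w - D s w)) \<le> norm ((\<zeta> w)\<^sup>2 + (D t w - D s w)\<^sup>2)"
    proof (intro AE_I2)
      fix w
      have "0 \<le> (\<bar>\<zeta> w\<bar> - \<bar>D t w - D s w\<bar>)\<^sup>2"
        by simp
      then have "2 * \<bar>\<zeta> w * (D t w - D s w)\<bar> \<le> (\<zeta> w)\<^sup>2 + (D t w - D s w)\<^sup>2"
        by (simp only: power2_diff power2_abs abs_mult)
      then show "norm (\<zeta> w * (D t w - D s w)) \<le> norm ((\<zeta> w)\<^sup>2 + (D t w - D s w)\<^sup>2)"
        by simp
    qed
  qed measurable
  define \<zeta>' where "\<zeta>' n w = of_bool (\<bar>\<zeta> w\<bar> \<le> real n) * \<zeta> w" for n w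
  have "(\<lambda>n. \<integral>w. \<zeta>' n w * (D t w - D s w) \<partial>M) \<longlonglongrightarrow> (\<integral>w. \<zeta> w * (D t w - D s w) \<partial>M)"
  proof (rule integral_dominated_convergence)
    show "integrable M (\<lambda>w. \<bar>\<zeta> w * (D t w - D s w)\<bar>)"
      using int by simp
    show "AE w in M. (\<lambda>n. \<zeta>' n w * (D t w - D s w)) \<longlonglongrightarrow> \<zeta> w * (D t w - D s w)"
    proof (intro AE_I2 tendsto_eventually)
      fix w
      obtain N where "\<bar>\<zeta> w\<bar> \<le> real N"
        using real_arch_simple by blast
      then have "\<forall>n\<ge>N. \<zeta>' n w * (D t w - D s w) = \<zeta> w * (D t w - D s w)"
        by (auto simp: \<zeta>'_def)
      then show "\<forall>\<^sub>F n in sequentially. \<zeta>' n w * (D t w - D s w) = \<zeta> w * (D t w - D s w)"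
        unfolding eventually_sequentially by blast
    qed
    show "AE w in M. norm (\<zeta>' n w * (D t w - D s w)) \<le> \<bar>\<zeta> w * (D t w - D s w)\<bar>" for n
      by (auto simp: \<zeta>'_def)
    show "(\<lambda>w. \<zeta>' n w * (D t w - D s w)) \<in> borel_measurable M" for n
      unfolding \<zeta>'_def by measurable
  qed measurable
  moreover have "(\<integral>w. \<zeta>' n w * (D t w - D s w) \<partial>M) = 0" for n
  proof (rule increment_orthogonal[OF st])
    show "\<zeta>' n \<in> borel_measurable (F s)"
      unfolding \<zeta>'_def using \<zeta>(1) by measurable
    show "\<bar>\<zeta>' n w\<bar> \<le> real n" for w
      by (auto simp: \<zeta>'_def)
  qed
  ultimately show "(\<integral>w. \<zeta> w * (D t w - D s w) \<partial>M) = 0"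
    by (simp add: LIMSEQ_const_iff)
qed

context
  fixes \<phi> \<phi>1 \<phi>2 \<phi>3 :: "real \<Rightarrow> real" and L C :: real
  assumes d1: "\<And>x. (\<phi> has_real_derivative \<phi>1 x) (at x)"
    and d2: "\<And>x. (\<phi>1 has_real_derivative \<phi>2 x) (at x)"
    and d3: "\<And>x. (\<phi>2 has_real_derivative \<phi>3 x) (at x)"
    and L: "\<And>x. \<bar>\<phi>3 x\<bar> \<le> L" and C: "\<And>x. 0 \<le> \<phi>2 x" "\<And>x. \<phi>2 x \<le> C"
begin

lemma integrable_phi1_sq:
  assumes "0 \<le> t"
  shows "integrable M (\<lambda>w. (\<phi>1 (D t w))\<^sup>2)"
proof (rule Bochner_Integration.integrable_bound)
  show "integrable M (\<lambda>w. 2 * (\<phi>1 0)\<^sup>2 + 2 * C\<^sup>2 * (D t w)\<^sup>2)"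
    using integrable_D_power[OF assms, of 2] by simp
  show "(\<lambda>w. (\<phi>1 (D t w))\<^sup>2) \<in> borel_measurable M"
    using measurable_compose[OF measurable_D[OF assms] measurable_of_derivative[OF d2]] by measurable
  show "AE w in M. norm ((\<phi>1 (D t w))\<^sup>2) \<le> norm (2 * (\<phi>1 0)\<^sup>2 + 2 * C\<^sup>2 * (D t w)\<^sup>2)"
  proof (intro AE_I2)
    fix w
    have "\<bar>\<phi>1 (D t w) - \<phi>1 0\<bar> \<le> C * \<bar>D t w - 0\<bar>"
      using C by (intro lipschitz_of_derivative_bound[OF d2]) (simp add: abs_of_nonneg)
    then have "(\<phi>1 (D t w) - \<phi>1 0)\<^sup>2 \<le> (C * \<bar>D t w\<bar>)\<^sup>2"
      by (intro abs_le_square_iff[THEN iffD1]) (simp add: order_trans[OF _ abs_ge_self])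
    moreover have "(\<phi>1 (D t w))\<^sup>2 \<le> 2 * (\<phi>1 0)\<^sup>2 + 2 * (\<phi>1 (D t w) - \<phi>1 0)\<^sup>2"
      using sq_add_le_weighted[of 1 "\<phi>1 0" "\<phi>1 (D t w) - \<phi>1 0"] by simp
    ultimately show "norm ((\<phi>1 (D t w))\<^sup>2) \<le> norm (2 * (\<phi>1 0)\<^sup>2 + 2 * C\<^sup>2 * (D t w)\<^sup>2)"
      by (simp add: power_mult_distrib)
  qed
qed

text \<open>Mean value inequality on the interval from -\<bar>x\<bar> to \<bar>x\<bar>, where the
  derivative is at most \<bar>\<phi>1 0\<bar> + C \<bar>x\<bar>; hence C rather than C / 2. It
  serves integrability.\<close>

lemma taylor2_abs_le: "\<bar>\<phi> x\<bar> \<le> \<bar>\<phi> 0\<bar> + \<bar>\<phi>1 0\<bar> * \<bar>x\<bar> + C * x\<^sup>2"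
proof -
  have "\<bar>\<phi> x - \<phi> 0\<bar> \<le> (\<bar>\<phi>1 0\<bar> + C * \<bar>x\<bar>) * \<bar>x - 0\<bar>"
  proof -
    have "\<bar>\<phi>1 z\<bar> \<le> \<bar>\<phi>1 0\<bar> + C * \<bar>x\<bar>" if "z \<in> {- \<bar>x\<bar>..\<bar>x\<bar>}" for z
    proof -
      have "\<bar>\<phi>1 z - \<phi>1 0\<bar> \<le> C * \<bar>z - 0\<bar>"
        using C by (intro lipschitz_of_derivative_bound[OF d2]) (simp add: abs_of_nonneg)
      also have "\<dots> \<le> C * \<bar>x\<bar>"
        using that C order_trans[OF C(1) C(2)] by (intro mult_left_mono) auto
      finally show ?thesis
        by linarith
    qed
    moreover have "x \<in> {- \<bar>x\<bar>..\<bar>x\<bar>}"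
      using abs_ge_self[of x] abs_ge_minus_self[of x] by auto
    ultimately show ?thesis
      using field_differentiable_bound[of "{- \<bar>x\<bar>..\<bar>x\<bar>}" \<phi> \<phi>1 "\<bar>\<phi>1 0\<bar> + C * \<bar>x\<bar>" x 0]
        has_field_derivative_at_within[OF d1] by auto
  qed
  then show ?thesis
    by (simp add: algebra_simps power2_eq_square abs_mult_self_eq)
qed

lemma integrable_phi:
  assumes "0 \<le> t"
  shows "integrable M (\<lambda>w. \<phi> (D t w))"
proof (rule Bochner_Integration.integrable_bound)
  show "integrable M (\<lambda>w. \<bar>\<phi> 0\<bar> + \<bar>\<phi>1 0\<bar> * \<bar>D t w\<bar> + C * (D t w)\<^sup>2)"
    using integrable_D_power[OF assms, of 2] integrable_D_power[OF assms, of 1] by simp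
  show "(\<lambda>w. \<phi> (D t w)) \<in> borel_measurable M"
    by (rule measurable_compose[OF measurable_D[OF assms] measurable_of_derivative[OF d1]])
  show "AE w in M. norm (\<phi> (D t w)) \<le> norm (\<bar>\<phi> 0\<bar> + \<bar>\<phi>1 0\<bar> * \<bar>D t w\<bar> + C * (D t w)\<^sup>2)"
    using taylor2_abs_le by (auto intro: order_trans[OF _ abs_ge_self])
qed

text \<open>The weight has to be frozen at \<open>s\<close> to be measurable there, while
  \<open>c\<close> bounds the product only at equal times. Moving the weight from \<open>r\<close>
  to \<open>s\<close> costs L K^2 times the mean increment, of order sqrt (t - s).\<close>

lemma expectation_phi2_sq_le:
  assumes c: "\<And>r w. 0 \<le> r \<Longrightarrow> w \<in> space M \<Longrightarrow> \<phi>2 (D r w) * (G r w)\<^sup>2 \<le> c"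
    and st: "0 \<le> s" "s < t" and r: "r \<in> {s..t}"
  shows "(\<integral>w. \<phi>2 (D s w) * (G r w)\<^sup>2 \<partial>M) \<le> c + L * K\<^sup>2 * ((K\<^sup>2 + 1) / 2 * sqrt (t - s))"
proof -
  have r0: "0 \<le> r" "s \<le> r" "r - s \<le> t - s"
    using st r by auto
  have L0: "0 \<le> L"
    using L[of 0] by linarith
  have int: "integrable M (\<lambda>w. D r w - D s w)"
    using integrable_increment[OF st(1) r0(2), of 1] by simp
  have "(\<integral>w. \<phi>2 (D s w) * (G r w)\<^sup>2 \<partial>M) \<le> (\<integral>w. c + L * K\<^sup>2 * \<bar>D r w - D s w\<bar> \<partial>M)"
  proof (rule integral_mono)
    show "integrable M (\<lambda>w. \<phi>2 (D s w) * (G r w)\<^sup>2)"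
    proof -
      have "integrable M (\<lambda>w. (G r w)\<^sup>2 * \<phi>2 (D s w))"
      proof (rule integrable_mult_bounded[OF expectation_G_sq_le(1)[OF r0(1)]])
        show "(\<lambda>w. \<phi>2 (D s w)) \<in> borel_measurable M"
          by (rule measurable_compose[OF measurable_D[OF st(1)] measurable_of_derivative[OF d3]])
        show "\<bar>\<phi>2 (D s w)\<bar> \<le> C" for w
          using C by (simp add: abs_of_nonneg)
      qed
      then show ?thesis
        by (simp add: mult.commute)
    qed
    show "integrable M (\<lambda>w. c + L * K\<^sup>2 * \<bar>D r w - D s w\<bar>)"
      using int by simp
    fix w assume w: "w \<in> space M"
    have "\<bar>\<phi>2 (D s w) - \<phi>2 (D r w)\<bar> \<le> L * \<bar>D s w - D r w\<bar>"
      by (rule lipschitz_of_derivative_bound[OF d3 L])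
    then have "\<phi>2 (D s w) \<le> \<phi>2 (D r w) + L * \<bar>D r w - D s w\<bar>"
      by (simp add: abs_minus_commute)
    then have "\<phi>2 (D s w) * (G r w)\<^sup>2 \<le> (\<phi>2 (D r w) + L * \<bar>D r w - D s w\<bar>) * (G r w)\<^sup>2"
      by (rule mult_right_mono) simp
    also have "\<dots> = \<phi>2 (D r w) * (G r w)\<^sup>2 + L * \<bar>D r w - D s w\<bar> * (G r w)\<^sup>2"
      by (simp add: algebra_simps)
    also have "\<dots> \<le> c + L * \<bar>D r w - D s w\<bar> * K\<^sup>2"
      using power_mono[OF G_le[OF r0(1) w], of 2] L0 by (intro add_mono c mult_left_mono r0(1) w) auto
    finally show "\<phi>2 (D s w) * (G r w)\<^sup>2 \<le> c + L * K\<^sup>2 * \<bar>D r w - D s w\<bar>"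
      by (simp add: mult_ac)
  qed
  also have "\<dots> = c + L * K\<^sup>2 * (\<integral>w. \<bar>D r w - D s w\<bar> \<partial>M)"
    using int by (simp add: prob_space)
  also have "\<dots> \<le> c + L * K\<^sup>2 * ((K\<^sup>2 + 1) / 2 * sqrt (t - s))"
    using L0 st by (intro add_left_mono mult_left_mono increment_abs_le[OF st(1) r0(2,3)]) auto
  finally show ?thesis .
qed

text \<open>In the third-order Taylor expansion at \<open>D s\<close> the linear term has mean zero,
  the quadratic one gives c / 2 per unit of time up to the freezing error, and the cubic one is of
  the same order as that error after multiplication by t - s.\<close>

lemma expectation_phi_step:
  assumes c: "\<And>r w. 0 \<le> r \<Longrightarrow> w \<in> space M \<Longrightarrow> \<phi>2 (D r w) * (G r w)\<^sup>2 \<le> c"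
    and st: "0 \<le> s" "s < t"
  shows "(\<integral>w. \<phi> (D t w) \<partial>M) - (\<integral>w. \<phi> (D s w) \<partial>M) \<le> c / 2 * (t - s)
    + (L * K\<^sup>2 * (K\<^sup>2 + 1) / 4 + L * (24 * K ^ 4 + K\<^sup>2) / 12) * ((t - s) * sqrt (t - s))"
proof -
  let ?d = "\<lambda>w. D t w - D s w"
  have st': "0 \<le> t" "s \<le> t"
    using st by auto
  have L0: "0 \<le> L"
    using L[of 0] by linarith
  have mF: "(\<lambda>w. \<phi>1 (D s w)) \<in> borel_measurable (F s)" "(\<lambda>w. \<phi>2 (D s w)) \<in> borel_measurable (F s)"
    by (rule measurable_compose[OF adapted_D[OF st(1)] measurable_of_derivative[OF d2]],
        rule measurable_compose[OF adapted_D[OF st(1)] measurable_of_derivative[OF d3]])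
  note i1 = increment_orthogonal_L2[OF st(1) st'(2) mF(1) integrable_phi1_sq[OF st(1)]]
  have i2: "integrable M (\<lambda>w. \<phi>2 (D s w) * (?d w)\<^sup>2)"
  proof -
    have "integrable M (\<lambda>w. (?d w)\<^sup>2 * \<phi>2 (D s w))"
      using C by (intro integrable_mult_bounded[of _ _ C] integrable_increment st st' measurable_F_M[OF mF(2)])
        (auto simp: abs_of_nonneg)
    then show ?thesis
      by (simp add: mult.commute)
  qed
  have E2: "(\<integral>w. \<phi>2 (D s w) * (?d w)\<^sup>2 \<partial>M) \<le> (c + L * K\<^sup>2 * ((K\<^sup>2 + 1) / 2 * sqrt (t - s))) * (t - s)"
    by (rule increment_sq[OF st(1) st'(2) mF(2) _ expectation_phi2_sq_le[OF c st]]) (use C in auto)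
  note i3 = increment_cube_le[OF st]
  have "(\<integral>w. \<phi> (D t w) \<partial>M)
      \<le> (\<integral>w. \<phi> (D s w) + \<phi>1 (D s w) * ?d w + 1 / 2 * (\<phi>2 (D s w) * (?d w)\<^sup>2) + L / 6 * \<bar>?d w\<bar> ^ 3 \<partial>M)"
  proof (rule integral_mono)
    show "integrable M (\<lambda>w. \<phi> (D s w) + \<phi>1 (D s w) * ?d w + 1 / 2 * (\<phi>2 (D s w) * (?d w)\<^sup>2) + L / 6 * \<bar>?d w\<bar> ^ 3)"
      by (intro Bochner_Integration.integrable_add integrable_mult_right i1 i2 i3 integrable_phi st)
    show "\<phi> (D t w) \<le> \<phi> (D s w) + \<phi>1 (D s w) * ?d w + 1 / 2 * (\<phi>2 (D s w) * (?d w)\<^sup>2) + L / 6 * \<bar>?d w\<bar> ^ 3" for w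
      using taylor3_le[OF d1 d2 d3 L, of "D t w" "D s w"] by simp
  qed (rule integrable_phi[OF st'(1)])
  also have "\<dots> = (\<integral>w. \<phi> (D s w) \<partial>M) + 1 / 2 * (\<integral>w. \<phi>2 (D s w) * (?d w)\<^sup>2 \<partial>M) + L / 6 * (\<integral>w. \<bar>?d w\<bar> ^ 3 \<partial>M)"
    using integrable_phi[OF st(1)] i1 i2 i3(1) by simp
  also have "\<dots> \<le> (\<integral>w. \<phi> (D s w) \<partial>M) + 1 / 2 * ((c + L * K\<^sup>2 * ((K\<^sup>2 + 1) / 2 * sqrt (t - s))) * (t - s))
      + L / 6 * ((24 * K ^ 4 + K\<^sup>2) / 2 * ((t - s) * sqrt (t - s)))"
    using L0 by (intro add_mono mult_left_mono E2 i3(2)) auto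
  also have "\<dots> = (\<integral>w. \<phi> (D s w) \<partial>M) + (c / 2 * (t - s)
    + (L * K\<^sup>2 * (K\<^sup>2 + 1) / 4 + L * (24 * K ^ 4 + K\<^sup>2) / 12) * ((t - s) * sqrt (t - s)))"
    by (simp add: field_simps)
  finally show ?thesis
    by simp
qed

text \<open>Summing the one-step estimates over \<open>n\<close> equal steps, the remainders add up to \<open>O(n\<^sup>-\<^sup>1\<^sup>/\<^sup>2)\<close>.\<close>

lemma expectation_phi_le:
  assumes c: "\<And>r w. 0 \<le> r \<Longrightarrow> w \<in> space M \<Longrightarrow> \<phi>2 (D r w) * (G r w)\<^sup>2 \<le> c" and t: "0 \<le> t"
  shows "(\<integral>w. \<phi> (D t w) \<partial>M) \<le> \<phi> 0 + c / 2 * t"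
proof -
  define f where "f r = (\<integral>w. \<phi> (D r w) \<partial>M)" for r
  define R where "R = L * K\<^sup>2 * (K\<^sup>2 + 1) / 4 + L * (24 * K ^ 4 + K\<^sup>2) / 12"
  have f0: "f 0 = \<phi> 0"
  proof -
    have "f 0 = (\<integral>w. \<phi> 0 \<partial>M)"
      unfolding f_def
    proof (rule integral_cong_AE)
      show "AE w in M. \<phi> (D 0 w) = \<phi> 0"
        using D_0 by eventually_elim simp
      show "(\<lambda>w. \<phi> (D 0 w)) \<in> borel_measurable M"
        by (rule measurable_compose[OF measurable_D[OF order_refl] measurable_of_derivative[OF d1]])
    qed simp
    then show ?thesis
      by (simp add: prob_space)
  qed
  show ?thesis
  proof (cases "t = 0")
    case True
    then show ?thesis
      using f0 by (simp add: f_def)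
  next
    case False
    have le: "f t \<le> f 0 + c / 2 * t + R * t * sqrt (t / real (Suc n))" for n
    proof -
      let ?h = "t / real (Suc n)"
      have h: "0 < ?h"
        using t False by simp
      have "f t - f 0 = (\<Sum>i<Suc n. f (real (Suc i) * ?h) - f (real i * ?h))"
        by (subst sum_lessThan_telescope) simp
      also have "\<dots> \<le> (\<Sum>i<Suc n. c / 2 * ?h + R * (?h * sqrt ?h))"
      proof (rule sum_mono)
        fix i
        have "real (Suc i) * x - real i * x = x" for x
          by (simp add: algebra_simps)
        from this[of ?h] have step: "real (Suc i) * ?h - real i * ?h = ?h" .
        have pos: "0 \<le> real i * ?h"
          using h by (intro mult_nonneg_nonneg) auto
        have less: "real i * ?h < real (Suc i) * ?h"
          using h step by linarith
        show "f (real (Suc i) * ?h) - f (real i * ?h) \<le> c / 2 * ?h + R * (?h * sqrt ?h)"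
          using expectation_phi_step[OF c pos less] unfolding step f_def R_def .
      qed
      also have "\<dots> = real (Suc n) * (c / 2 * ?h + R * (?h * sqrt ?h))"
        by simp
      also have "\<dots> = c / 2 * (real (Suc n) * ?h) + R * (real (Suc n) * ?h) * sqrt ?h"
        by (simp only: algebra_simps)
      also have "real (Suc n) * ?h = t"
        by simp
      finally show ?thesis
        by simp
    qed
    have "(\<lambda>n. f 0 + c / 2 * t + R * t * sqrt (t / real (Suc n))) \<longlonglongrightarrow> f 0 + c / 2 * t + R * t * sqrt 0"
      by (intro tendsto_intros LIMSEQ_Suc[OF lim_const_over_n])
    then have "f t \<le> f 0 + c / 2 * t + R * t * sqrt 0"
      by (rule LIMSEQ_le_const) (use le in auto)
    then show ?thesis
      using f0 by (simp add: f_def)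
  qed
qed

end

end

section \<open>Maximal inequality and reduction of the equations\<close>

fun running_max :: "(nat \<Rightarrow> real) \<Rightarrow> nat \<Rightarrow> real" where
  "running_max d 0 = \<bar>d 0\<bar>"
| "running_max d (Suc n) = max (running_max d n) \<bar>d (Suc n)\<bar>"

lemma abs_le_running_max: "k \<le> n \<Longrightarrow> \<bar>d k\<bar> \<le> running_max d n"
  by (induction n) (auto simp: le_Suc_eq)

lemma running_max_nonneg: "0 \<le> running_max d n"
  using order_trans[OF abs_ge_zero abs_le_running_max[OF order_refl]] .

lemma running_max_sq_le: "(running_max d n)\<^sup>2 \<le> (\<Sum>k\<le>n. (d k)\<^sup>2)"
proof (induction n)
  case (Suc n)
  have "(running_max d (Suc n))\<^sup>2 \<le> (running_max d n)\<^sup>2 + (d (Suc n))\<^sup>2"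
    by (simp add: max_def)
  then show ?case
    using Suc by simp
qed simp

text \<open>A pathwise form of Doob's maximal inequality: along a martingale, the sum on the right has
  mean zero.\<close>

lemma running_max_pathwise:
  "(running_max d n)\<^sup>2 \<le> 4 * (d n)\<^sup>2
    - 4 * (\<Sum>k<n. running_max d k * sgn (d k) * (d (Suc k) - d k))"
proof -
  let ?M = "running_max d"
  \<comment> \<open>The left side is the inductive potential: with the absolute value fixed it does
    not grow when the maximum is updated, so only changes of the absolute value count.\<close>
  have "(?M n)\<^sup>2 / 2 - ?M n * \<bar>d n\<bar> \<le> - (\<Sum>k<n. ?M k * sgn (d k) * (d (Suc k) - d k))"
  proof (induction n)
    case 0
    then show ?case
      by (simp add: power2_eq_square)
  next
    case (Suc n)
    have "(?M (Suc n))\<^sup>2 / 2 - ?M (Suc n) * \<bar>d (Suc n)\<bar> \<le> (?M n)\<^sup>2 / 2 - ?M n * \<bar>d (Suc n)\<bar>"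
    proof (cases "\<bar>d (Suc n)\<bar> \<le> ?M n")
      case False
      have "(?M n - \<bar>d (Suc n)\<bar>)\<^sup>2 = (?M n)\<^sup>2 - 2 * (?M n * \<bar>d (Suc n)\<bar>) + (d (Suc n))\<^sup>2"
        by (simp add: power2_diff)
      then have "?M n * \<bar>d (Suc n)\<bar> - (d (Suc n))\<^sup>2 / 2 \<le> (?M n)\<^sup>2 / 2"
        using zero_le_power2[of "?M n - \<bar>d (Suc n)\<bar>"] by linarith
      moreover have "?M (Suc n) = \<bar>d (Suc n)\<bar>"
        using False by simp
      ultimately show ?thesis
        by (simp add: power2_eq_square)
    qed (simp add: max_def)
    \<comment> \<open>The sign is a subgradient of the absolute value at \<open>d n\<close>.\<close>
    moreover have "?M n * (sgn (d n) * (d (Suc n) - d n)) \<le> ?M n * (\<bar>d (Suc n)\<bar> - \<bar>d n\<bar>)"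
      by (intro mult_left_mono running_max_nonneg) (auto simp: sgn_if)
    ultimately show ?case
      using Suc by (simp add: algebra_simps)
  qed
  \<comment> \<open>Half of the quadratic term is absorbed here; multiplying the remaining quarter
    by 4 yields Doob's constant.\<close>
  moreover have "?M n * \<bar>d n\<bar> \<le> (?M n)\<^sup>2 / 4 + (d n)\<^sup>2"
    using zero_le_power2[of "?M n / 2 - \<bar>d n\<bar>"] by (simp add: power2_diff power_divide)
  ultimately show ?thesis
    by linarith
qed

context bounded_ito_process
begin

lemma running_max_expectation:
  assumes t: "\<And>k. 0 \<le> t k" "\<And>k. t k \<le> t (Suc k)"
  shows "integrable M (\<lambda>w. (running_max (\<lambda>k. D (t k) w) n)\<^sup>2)"
    and "(\<integral>w. (running_max (\<lambda>k. D (t k) w) n)\<^sup>2 \<partial>M) \<le> 4 * (\<integral>w. (D (t n) w)\<^sup>2 \<partial>M)"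
proof -
  let ?M = "\<lambda>n w. running_max (\<lambda>k. D (t k) w) n"
  have mF: "?M n \<in> borel_measurable (F (t n))" for n
  proof (induction n)
    case 0
    then show ?case
      using adapted_D[OF t(1)[of 0]] by simp
  next
    case (Suc n)
    have "(\<lambda>w. max (?M n w) \<bar>D (t (Suc n)) w\<bar>) \<in> borel_measurable (F (t (Suc n)))"
      using measurable_F_mono[OF Suc t(2)] adapted_D[OF t(1)[of "Suc n"]] by measurable
    then show ?case
      by simp
  qed
  have mM: "?M n \<in> borel_measurable M" for n
    by (rule measurable_F_M[OF mF])
  have D2: "integrable M (\<lambda>w. (D (t k) w)\<^sup>2)" for k
    by (rule integrable_D_power[OF t(1)]) simp
  show int: "integrable M (\<lambda>w. (?M n w)\<^sup>2)" for n
  proof (rule Bochner_Integration.integrable_bound)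
    show "integrable M (\<lambda>w. \<Sum>k\<le>n. (D (t k) w)\<^sup>2)"
      by (intro Bochner_Integration.integrable_sum D2)
    show "(\<lambda>w. (?M n w)\<^sup>2) \<in> borel_measurable M"
      using mM by measurable
    show "AE w in M. norm ((?M n w)\<^sup>2) \<le> norm (\<Sum>k\<le>n. (D (t k) w)\<^sup>2)"
      using running_max_sq_le by (intro AE_I2) (simp add: order_trans[OF _ abs_ge_self])
  qed
  let ?\<zeta> = "\<lambda>k w. ?M k w * sgn (D (t k) w)"
  have \<zeta>F: "?\<zeta> k \<in> borel_measurable (F (t k))" for k
    unfolding sgn_if using mF[of k] adapted_D[OF t(1)[of k]] by measurable
  have \<zeta>2: "integrable M (\<lambda>w. (?\<zeta> k w)\<^sup>2)" for k
  proof (rule Bochner_Integration.integrable_bound[OF int[of k]])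
    show "(\<lambda>w. (?\<zeta> k w)\<^sup>2) \<in> borel_measurable M"
      using measurable_F_M[OF \<zeta>F[of k]] by measurable
    show "AE w in M. norm ((?\<zeta> k w)\<^sup>2) \<le> norm ((?M k w)\<^sup>2)"
      by (auto simp: sgn_if power_mult_distrib)
  qed
  note orth = increment_orthogonal_L2[OF t(1) t(2) \<zeta>F \<zeta>2]
  have "(\<integral>w. (?M n w)\<^sup>2 \<partial>M)
      \<le> (\<integral>w. 4 * (D (t n) w)\<^sup>2 - 4 * (\<Sum>k<n. ?\<zeta> k w * (D (t (Suc k)) w - D (t k) w)) \<partial>M)"
  proof (rule integral_mono)
    show "integrable M (\<lambda>w. 4 * (D (t n) w)\<^sup>2 - 4 * (\<Sum>k<n. ?\<zeta> k w * (D (t (Suc k)) w - D (t k) w)))"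
      by (intro Bochner_Integration.integrable_diff integrable_mult_right Bochner_Integration.integrable_sum
          D2 orth(1))
  qed (rule int, rule running_max_pathwise)
  also have "\<dots> = (\<integral>w. 4 * (D (t n) w)\<^sup>2 \<partial>M) - (\<integral>w. 4 * (\<Sum>k<n. ?\<zeta> k w * (D (t (Suc k)) w - D (t k) w)) \<partial>M)"
    by (intro Bochner_Integration.integral_diff integrable_mult_right Bochner_Integration.integrable_sum
          D2 orth(1))
  also have "(\<integral>w. 4 * (\<Sum>k<n. ?\<zeta> k w * (D (t (Suc k)) w - D (t k) w)) \<partial>M) = 0"
    using orth by (simp add: Bochner_Integration.integral_sum)
  finally show "(\<integral>w. (?M n w)\<^sup>2 \<partial>M) \<le> 4 * (\<integral>w. (D (t n) w)\<^sup>2 \<partial>M)"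
    by simp
qed

text \<open>By path continuity the squared supremum is at most the liminf of the squared maxima over
  equidistant grids, and Fatou's lemma applies to these measurable functions. The grids are not
  nested, hence a liminf instead of a monotone limit.\<close>

lemma expectation_sup_sq_le:
  assumes cont: "AE w in M. continuous_on {0..} (\<lambda>t. D t w)" and T: "0 < T"
  shows "(\<integral>\<^sup>+w. (SUP t\<in>{0..T}. ennreal \<bar>D t w\<bar>)\<^sup>2 \<partial>M) \<le> ennreal (4 * (\<integral>w. (D T w)\<^sup>2 \<partial>M))"
proof -
  let ?S = "\<lambda>w. SUP t\<in>{0..T}. ennreal \<bar>D t w\<bar>"
  let ?R = "ennreal (4 * (\<integral>w. (D T w)\<^sup>2 \<partial>M))"
  define t where "t n k = real k * T / real (Suc n)" for n k :: nat
  define R where "R n w = (running_max (\<lambda>k. D (t n k) w) (Suc n))\<^sup>2" for n w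
  have t: "0 \<le> t n k" "t n k \<le> t n (Suc k)" "t n (Suc n) = T" for n k
    using T by (auto simp: t_def intro!: divide_right_mono)
  have Rint: "integrable M (R n)" "(\<integral>w. R n w \<partial>M) \<le> 4 * (\<integral>w. (D T w)\<^sup>2 \<partial>M)" for n
    unfolding R_def[abs_def] using running_max_expectation[of "t n" "Suc n"] t(1,2)[of n] t(3)[of n]
    by simp_all
  have Rm: "R n \<in> borel_measurable M" for n
    by (rule borel_measurable_integrable[OF Rint(1)])
  have ER: "(\<integral>\<^sup>+w. ennreal (R n w) \<partial>M) \<le> ?R" for n
  proof -
    have "(\<integral>\<^sup>+w. ennreal (R n w) \<partial>M) = ennreal (\<integral>w. R n w \<partial>M)"
      by (intro nn_integral_eq_integral Rint(1)) (simp add: R_def)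
    also have "\<dots> \<le> ?R"
      by (rule ennreal_leI[OF Rint(2)])
    finally show ?thesis .
  qed
  have "AE w in M. (?S w)\<^sup>2 \<le> liminf (\<lambda>n. ennreal (R n w))"
    using cont
  proof eventually_elim
    fix w assume c: "continuous_on {0..} (\<lambda>t. D t w)"
    have pt: "ennreal ((D u w)\<^sup>2) \<le> liminf (\<lambda>n. ennreal (R n w))" if u: "u \<in> {0..T}" for u
    proof -
      \<comment> \<open>The index of the last grid point at or before \<open>u\<close>.\<close>
      define k where "k n = nat \<lfloor>u * real (Suc n) / T\<rfloor>" for n
      have k0: "real (k n) = real_of_int \<lfloor>u * real (Suc n) / T\<rfloor>" for n
        using u T by (simp add: k_def)
      have le: "t n (k n) \<le> u" "u - T / real (Suc n) \<le> t n (k n)" for n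
      proof -
        have "real (k n) \<le> u * real (Suc n) / T" "u * real (Suc n) / T - 1 \<le> real (k n)"
          unfolding k0 by linarith+
        then have "real (k n) * T \<le> u * real (Suc n)" "u * real (Suc n) \<le> T + real (k n) * T"
          using T by (simp_all add: field_simps del: of_nat_Suc)
        then have "real (k n) * T / real (Suc n) \<le> u" "u \<le> (T + real (k n) * T) / real (Suc n)"
          by (simp_all add: pos_divide_le_eq pos_le_divide_eq del: of_nat_Suc)
        then show "t n (k n) \<le> u" "u - T / real (Suc n) \<le> t n (k n)"
          unfolding t_def by (simp_all only: add_divide_distrib diff_le_eq add.commute)
      qed
      have "(\<lambda>n. t n (k n)) \<longlonglongrightarrow> u"
      proof (rule tendsto_sandwich)
        show "(\<lambda>n. u - T / real (Suc n)) \<longlonglongrightarrow> u"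
          using tendsto_diff[OF tendsto_const LIMSEQ_Suc[OF lim_const_over_n[of T]], of u] by simp
      qed (use le in auto)
      then have "(\<lambda>n. D (t n (k n)) w) \<longlonglongrightarrow> D u w"
        using c t(1) u by (intro continuous_on_tendsto_compose[OF c]) auto
      then have "(\<lambda>n. ennreal ((D (t n (k n)) w)\<^sup>2)) \<longlonglongrightarrow> ennreal ((D u w)\<^sup>2)"
        by (intro tendsto_ennrealI tendsto_power)
      then have "ennreal ((D u w)\<^sup>2) = liminf (\<lambda>n. ennreal ((D (t n (k n)) w)\<^sup>2))"
        by (intro lim_imp_Liminf[symmetric]) auto
      also have "\<dots> \<le> liminf (\<lambda>n. ennreal (R n w))"
      proof (intro Liminf_mono always_eventually allI ennreal_leI)
        fix n
        have "t n (k n) \<le> t n (Suc n)"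
          using le(1)[of n] u t(3) by simp
        then have "k n \<le> Suc n"
          using T by (simp add: t_def field_simps del: of_nat_Suc)
        from abs_le_running_max[OF this, of "\<lambda>k. D (t n k) w"]
        show "(D (t n (k n)) w)\<^sup>2 \<le> R n w"
          unfolding R_def using abs_le_square_iff running_max_nonneg by (metis abs_of_nonneg)
      qed
      finally show ?thesis .
    qed
    show "(?S w)\<^sup>2 \<le> liminf (\<lambda>n. ennreal (R n w))"
    proof (cases "liminf (\<lambda>n. ennreal (R n w))")
      case (real r)
      have "ennreal \<bar>D u w\<bar> \<le> ennreal (sqrt r)" if "u \<in> {0..T}" for u
        using pt[OF that] real by (intro ennreal_leI real_le_rsqrt) (simp add: ennreal_le_iff)
      then have "?S w \<le> ennreal (sqrt r)"
        by (rule SUP_least)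
      then have "(?S w)\<^sup>2 \<le> (ennreal (sqrt r))\<^sup>2"
        by (intro power_mono) auto
      also have "\<dots> = ennreal r"
        using real by (simp add: ennreal_power)
      finally show ?thesis
        using real by simp
    qed simp
  qed
  then have "(\<integral>\<^sup>+w. (?S w)\<^sup>2 \<partial>M) \<le> (\<integral>\<^sup>+w. liminf (\<lambda>n. ennreal (R n w)) \<partial>M)"
    by (rule nn_integral_mono_AE)
  also have "\<dots> \<le> liminf (\<lambda>n. \<integral>\<^sup>+w. ennreal (R n w) \<partial>M)"
    using Rm by (intro nn_integral_liminf) measurable
  also have "\<dots> \<le> liminf (\<lambda>n. ?R)"
    using ER by (intro Liminf_mono always_eventually) auto
  also have "\<dots> = ?R"
    by (simp add: Liminf_const)
  finally show ?thesis .
qed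

end

section \<open>From the two equations to one bounded Ito process\<close>

lemma (in brownian_motion) jointly_measurable_stopped:
  assumes "progressively_measurable F Y" "0 \<le> u"
  shows "jointly_measurable (\<lambda>r. Y (max 0 (min u r)))"
proof -
  have "(\<lambda>w. w) \<in> measurable M (F u)"
    using measurable_F_M[OF measurable_ident[unfolded id_def]] by simp
  \<comment> \<open>Progressive measurability speaks only of times in \<open>{0..u}\<close>;
    clamping the time argument extends the process measurably to the whole axis without changing it
    on that interval.\<close>
  moreover have "(\<lambda>r. max 0 (min u r)) \<in> measurable borel (restrict_space borel {0..u})"
    using assms(2) by (intro measurable_restrict_space2) auto
  ultimately have "(\<lambda>(w, r). (max 0 (min u r), w)) \<in> measurable (M \<Otimes>\<^sub>M borel) (restrict_space borel {0..u} \<Otimes>\<^sub>M F u)"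
    by measurable
  moreover have "(\<lambda>(s, w). Y s w) \<in> borel_measurable (restrict_space borel {0..u} \<Otimes>\<^sub>M F u)"
    using assms unfolding progressively_measurable_def by blast
  ultimately have "(\<lambda>x. case (case x of (w, r) \<Rightarrow> (max 0 (min u r), w)) of (s, w) \<Rightarrow> Y s w)
      \<in> borel_measurable (M \<Otimes>\<^sub>M borel)"
    by (rule measurable_compose)
  then show ?thesis
    unfolding jointly_measurable_def by (simp add: case_prod_beta)
qed

text \<open>The common start \<open>x0\<close> makes the difference vanish at time 0. The integrand
  is approximated in its version clamped at \<open>t\<close>, which agrees with the original one on
  \<open>{s..t}\<close>.\<close>

lemma (in brownian_motion) sde_difference:
  assumes X: "sde_solution M F B \<sigma> x0 X" and X': "sde_solution M F B \<sigma>' x0 X'"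
    and \<sigma>: "\<sigma> \<in> borel_measurable borel" "\<sigma>' \<in> borel_measurable borel"
    and bound: "\<And>x. \<bar>\<sigma> x\<bar> \<le> S" "\<And>x. \<bar>\<sigma>' x\<bar> \<le> S'"
  shows "bounded_ito_process M F B (\<lambda>t w. X t w - X' t w) (\<lambda>t w. \<sigma> (X t w) - \<sigma>' (X' t w)) (S + S')"
proof -
  let ?D = "\<lambda>t w. X t w - X' t w"
    and ?G = "\<lambda>t w. \<sigma> (X t w) - \<sigma>' (X' t w)"
  let ?Y = "\<lambda>t r w. ?G (max 0 (min t r)) w"
  have aX: "X t \<in> borel_measurable (F t)" "X' t \<in> borel_measurable (F t)" if "0 \<le> t" for t
    using X X' that by (auto simp: sde_solution_def)
  have mX: "X t \<in> borel_measurable M" "X' t \<in> borel_measurable M" if "0 \<le> t" for t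
    using aX[OF that] measurable_F_M by auto
  have ito: "has_ito_integral M F B t (\<lambda>s w. \<sigma> (X s w)) (\<lambda>w. X t w - X 0 w)"
    "has_ito_integral M F B t (\<lambda>s w. \<sigma>' (X' s w)) (\<lambda>w. X' t w - X' 0 w)" if "0 \<le> t" for t
    using X X' that by (auto simp: sde_solution_def)
  have G: "\<bar>?G t w\<bar> \<le> S + S'" for t w
    using bound(1)[of "X t w"] bound(2)[of "X' t w"] by linarith
  have K: "0 \<le> S + S'"
    using order_trans[OF abs_ge_zero G] .
  have approx: "approximable s t (?Y t)
      (\<lambda>w. ?D t w - ?D s w)"
    and jm: "jointly_measurable (?Y t)"
    if st: "0 \<le> s" "s \<le> t" for s t
  proof -
    have t0: "0 \<le> t"
      using st by simp
    have jX: "jointly_measurable (\<lambda>r w. \<sigma> (X (max 0 (min t r)) w))"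
      and jX': "jointly_measurable (\<lambda>r w. \<sigma>' (X' (max 0 (min t r)) w))"
      using ito[OF t0] jointly_measurable_stopped[OF _ t0] unfolding has_ito_integral_def by blast+
    show "jointly_measurable (?Y t)"
      by (rule jointly_measurable_diff[OF jX jX'])
    have "approximable s t (\<lambda>r w. \<sigma> (X (max 0 (min t r)) w)) (\<lambda>w. (X t w - X 0 w) - (X s w - X 0 w))"
      by (rule approximable_increment[OF ito(1)[OF t0] ito(1)[OF st(1)] st jX]) auto
    moreover have "approximable s t (\<lambda>r w. \<sigma>' (X' (max 0 (min t r)) w)) (\<lambda>w. (X' t w - X' 0 w) - (X' s w - X' 0 w))"
      by (rule approximable_increment[OF ito(2)[OF t0] ito(2)[OF st(1)] st jX']) auto
    ultimately have "approximable s t (?Y t)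
        (\<lambda>w. ((X t w - X 0 w) - (X s w - X 0 w)) - ((X' t w - X' 0 w) - (X' s w - X' 0 w)))"
      using st t0 by (intro approximable_diff jX jX' borel_measurable_diff mX) auto
    then show "approximable s t (?Y t)
      (\<lambda>w. ?D t w - ?D s w)"
      by (simp add: algebra_simps)
  qed
  have stop: "max 0 (min t r) = r" if "0 \<le> s" "r \<in> {s..t}" for r s t :: real
    using that by auto
  have Zm: "(\<lambda>w. ?D t w - ?D s w) \<in> borel_measurable M" if "0 \<le> s" "s \<le> t" for s t
    using that by (intro borel_measurable_diff mX) auto
  note moments = approximable_moments[OF approx Zm jm K G]
  show ?thesis
  proof unfold_locales
    show "?D t \<in> borel_measurable (F t)" if "0 \<le> t" for t
      using aX[OF that] by measurable
    have "AE w in M. X 0 w = x0" "AE w in M. X' 0 w = x0"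
      using X X' by (auto simp: sde_solution_def)
    then show "AE w in M. ?D 0 w = 0"
      by eventually_elim simp
    show "?G t \<in> borel_measurable M" if "0 \<le> t" for t
      using mX[OF that] \<sigma> by measurable
    show "integrable M (\<lambda>w. (?D t w - ?D s w) ^ 4)" if "0 \<le> s" "s \<le> t" for s t
      by (rule moments(1)) (use that in simp_all)
    show "(\<integral>w. (?D t w - ?D s w) ^ 4 \<partial>M) \<le> 24 * (S + S') ^ 4 * (t - s)\<^sup>2"
      if "0 \<le> s" "s \<le> t" for s t
      by (rule moments(2)) (use that in simp_all)
    show "(\<integral>w. \<zeta> w * (?D t w - ?D s w) \<partial>M) = 0"
      if "0 \<le> s" "s \<le> t" "\<zeta> \<in> borel_measurable (F s)" "\<And>w. w \<in> space M \<Longrightarrow> \<bar>\<zeta> w\<bar> \<le> c" for s t \<zeta> c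
      by (rule moments(3)[where c = c]) (use that in simp_all)
    show "(\<integral>w. \<zeta> w * (?D t w - ?D s w)\<^sup>2 \<partial>M) \<le> b * (t - s)"
      if that: "0 \<le> s" "s \<le> t" "\<zeta> \<in> borel_measurable (F s)" "\<And>w. w \<in> space M \<Longrightarrow> 0 \<le> \<zeta> w \<and> \<zeta> w \<le> c"
        and G_bound: "\<And>r. r \<in> {s..t} \<Longrightarrow> (\<integral>w. \<zeta> w * (?G r w)\<^sup>2 \<partial>M) \<le> b" for s t \<zeta> c b
    proof (rule moments(4)[where c = c])
      show "(\<integral>w. \<zeta> w * (?Y t r w)\<^sup>2 \<partial>M) \<le> b"
        if "r \<in> {s..t}" for r
        unfolding stop[OF \<open>0 \<le> s\<close> that] using G_bound[OF that] .
    qed (use that in simp_all)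
  qed (use K G in auto)
qed

section \<open>Smooth approximations of the absolute value\<close>

lemma sqrt_sq_add_props:
  fixes x e :: real
  assumes "0 < e"
  shows "\<bar>x\<bar> \<le> sqrt (x\<^sup>2 + e\<^sup>2)" "e \<le> sqrt (x\<^sup>2 + e\<^sup>2)" "0 < sqrt (x\<^sup>2 + e\<^sup>2)"
    "sqrt (x\<^sup>2 + e\<^sup>2) * sqrt (x\<^sup>2 + e\<^sup>2) = x\<^sup>2 + e\<^sup>2" "(sqrt (x\<^sup>2 + e\<^sup>2))\<^sup>2 = x\<^sup>2 + e\<^sup>2"
proof -
  have "0 < x\<^sup>2 + e\<^sup>2"
    using assms by (simp add: add_nonneg_pos)
  then show "0 < sqrt (x\<^sup>2 + e\<^sup>2)" "sqrt (x\<^sup>2 + e\<^sup>2) * sqrt (x\<^sup>2 + e\<^sup>2) = x\<^sup>2 + e\<^sup>2"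
      "(sqrt (x\<^sup>2 + e\<^sup>2))\<^sup>2 = x\<^sup>2 + e\<^sup>2"
    by simp_all
  show "\<bar>x\<bar> \<le> sqrt (x\<^sup>2 + e\<^sup>2)" "e \<le> sqrt (x\<^sup>2 + e\<^sup>2)"
    by (auto intro: real_le_rsqrt)
qed

lemma sqrt_sq_add_deriv:
  fixes x e :: real
  assumes "0 < e"
  shows "((\<lambda>x. sqrt (x\<^sup>2 + e\<^sup>2)) has_real_derivative x / sqrt (x\<^sup>2 + e\<^sup>2)) (at x)"
proof -
  have "0 < x\<^sup>2 + e\<^sup>2"
    using assms by (simp add: add_nonneg_pos)
  then show ?thesis
    by (auto intro!: derivative_eq_intros simp: divide_simps)
qed

lemma inverse_sqrt_sq_add_deriv:
  fixes x e :: real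
  assumes e: "0 < e"
  shows "((\<lambda>x. 1 / sqrt (x\<^sup>2 + e\<^sup>2)) has_real_derivative - x / sqrt (x\<^sup>2 + e\<^sup>2) ^ 3) (at x)"
proof -
  let ?u = "\<lambda>x. sqrt (x\<^sup>2 + e\<^sup>2)"
  have u: "?u x \<noteq> 0"
    using sqrt_sq_add_props(3)[OF e, of x] by (rule less_imp_neq[symmetric])
  have deriv: "((\<lambda>x. inverse (?u x)) has_real_derivative - (inverse (?u x) * (x / ?u x) * inverse (?u x))) (at x)"
    by (rule DERIV_inverse'[OF sqrt_sq_add_deriv[OF e] u])
  have eq: "- (inverse w * (x / w) * inverse w) = - x / w ^ 3" if "w \<noteq> 0" for w
    using that by (simp add: field_simps power3_eq_cube)
  from deriv[unfolded eq[OF u]] show ?thesis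
    by (simp only: inverse_eq_divide)
qed

lemma arsinh_scaled_deriv:
  fixes x e :: real
  assumes e: "0 < e"
  shows "((\<lambda>x. arsinh (x / e)) has_real_derivative 1 / sqrt (x\<^sup>2 + e\<^sup>2)) (at x)"
proof -
  have "sqrt ((x / e)\<^sup>2 + 1) = sqrt ((x\<^sup>2 + e\<^sup>2) / e\<^sup>2)"
    using e by (simp add: power_divide add_divide_distrib)
  also have "\<dots> = sqrt (x\<^sup>2 + e\<^sup>2) / e"
    using e by (simp add: real_sqrt_divide)
  finally have eq: "sqrt ((x / e)\<^sup>2 + 1) = sqrt (x\<^sup>2 + e\<^sup>2) / e" .
  have "((\<lambda>x. arsinh (x / e)) has_real_derivative 1 / sqrt ((x / e)\<^sup>2 + 1) * (1 / e)) (at x)"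
    by (rule DERIV_chain2[OF arsinh_real_has_field_derivative DERIV_cdivide[OF DERIV_ident]])
  then show ?thesis
    using e sqrt_sq_add_props(3)[OF e, of x] by (simp add: eq)
qed

text \<open>The second derivative of \<open>log_test e L\<close> is \<open>1 / (L * sqrt (x\<^sup>2 + e\<^sup>2))\<close>, which compensates the
  linear growth of the squared modulus of continuity for \<open>H = 1/2\<close>. With \<open>L = - ln e\<close> the function
  still dominates \<open>\<bar>x\<bar> / 2\<close> up to an error of order \<open>sqrt e\<close>.\<close>

definition log_test :: "real \<Rightarrow> real \<Rightarrow> real \<Rightarrow> real" where
  "log_test e L x = (x * arsinh (x / e) - sqrt (x\<^sup>2 + e\<^sup>2) + e) / L"

lemma log_test_deriv:
  assumes e: "0 < e" and L: "0 < L"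
  shows "(log_test e L has_real_derivative arsinh (x / e) / L) (at x)"
    and "((\<lambda>x. arsinh (x / e) / L) has_real_derivative 1 / sqrt (x\<^sup>2 + e\<^sup>2) / L) (at x)"
    and "((\<lambda>x. 1 / sqrt (x\<^sup>2 + e\<^sup>2) / L) has_real_derivative - x / sqrt (x\<^sup>2 + e\<^sup>2) ^ 3 / L) (at x)"
proof -
  let ?u = "sqrt (x\<^sup>2 + e\<^sup>2)"
  have "((\<lambda>x. x * arsinh (x / e) - sqrt (x\<^sup>2 + e\<^sup>2) + e) has_real_derivative
      (1 * arsinh (x / e) + 1 / ?u * x) - x / ?u + 0) (at x)"
    by (intro DERIV_add DERIV_diff DERIV_mult DERIV_ident DERIV_const arsinh_scaled_deriv[OF e]
        sqrt_sq_add_deriv[OF e])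
  then have "((\<lambda>x. x * arsinh (x / e) - sqrt (x\<^sup>2 + e\<^sup>2) + e) has_real_derivative arsinh (x / e)) (at x)"
    by simp
  then show "(log_test e L has_real_derivative arsinh (x / e) / L) (at x)"
    unfolding log_test_def[abs_def] by (rule DERIV_cdivide)
  show "((\<lambda>x. arsinh (x / e) / L) has_real_derivative 1 / sqrt (x\<^sup>2 + e\<^sup>2) / L) (at x)"
    by (rule DERIV_cdivide[OF arsinh_scaled_deriv[OF e]])
  show "((\<lambda>x. 1 / sqrt (x\<^sup>2 + e\<^sup>2) / L) has_real_derivative - x / sqrt (x\<^sup>2 + e\<^sup>2) ^ 3 / L) (at x)"
    by (rule DERIV_cdivide[OF inverse_sqrt_sq_add_deriv[OF e]])
qed

text \<open>Up to sqrt e the claim is nonnegativity of the test function. Beyond, its slope is at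
  least 1/2, because arsinh (z / e) \<ge> ln (z / e) \<ge> - ln e / 2.\<close>

lemma log_test_lower:
  assumes e: "0 < e" "e < 1"
  shows "\<bar>x\<bar> \<le> sqrt e + 2 * log_test e (- ln e) x"
proof -
  define L where "L = - ln e"
  have L: "0 < L"
    using e by (simp add: L_def)
  have even: "log_test e L (- y) = log_test e L y" for y
    by (simp add: log_test_def)
  have nonneg: "0 \<le> log_test e L y" if "0 \<le> y" for y
  proof -
    have "log_test e L 0 \<le> log_test e L y"
    proof (rule DERIV_nonneg_imp_nondecreasing[OF that])
      fix z assume "0 \<le> z" "z \<le> y"
      then have "arsinh 0 \<le> arsinh (z / e)"
        using e by (intro strict_mono_leD[OF strict_monoI[OF arsinh_real_strict_mono]]) auto
      then have "0 \<le> arsinh (z / e) / L"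
        using L by simp
      then show "\<exists>d. DERIV (log_test e L) z :> d \<and> 0 \<le> d"
        using log_test_deriv(1)[OF e(1) L] by blast
    qed
    then show ?thesis
      using e by (simp add: log_test_def)
  qed
  have pos: "y \<le> sqrt e + 2 * log_test e L y" if y: "0 \<le> y" for y
  proof (cases "y \<le> sqrt e")
    case True
    then show ?thesis
      using nonneg[OF y] by simp
  next
    case False
    have "log_test e L (sqrt e) - sqrt e / 2 \<le> log_test e L y - y / 2"
    proof (rule DERIV_nonneg_imp_nondecreasing[where f = "\<lambda>y. log_test e L y - y / 2"])
      show "sqrt e \<le> y"
        using False by simp
      fix z assume z: "sqrt e \<le> z" "z \<le> y"
      have "0 < z"
        using z e by (meson less_le_trans real_sqrt_gt_zero)
      have "L / 2 = ln (sqrt e / e)"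
        using e by (simp add: ln_div ln_sqrt L_def)
      also have "\<dots> \<le> ln (z / e + sqrt ((z / e)\<^sup>2 + 1))"
        using z e \<open>0 < z\<close> by (subst ln_le_cancel_iff) (auto intro!: add_pos_pos add_increasing2 divide_right_mono)
      finally have "1 / 2 \<le> arsinh (z / e) / L"
        using L by (simp add: arsinh_real_def pos_le_divide_eq)
      moreover have "DERIV (\<lambda>y. log_test e L y - y / 2) z :> arsinh (z / e) / L - 1 / 2"
        by (intro DERIV_diff DERIV_cdivide DERIV_ident log_test_deriv(1)[OF e(1) L])
      ultimately show "\<exists>d. DERIV (\<lambda>y. log_test e L y - y / 2) z :> d \<and> 0 \<le> d"
        by (intro exI[of _ "arsinh (z / e) / L - 1 / 2"]) simp
    qed
    moreover have "0 \<le> log_test e L (sqrt e)"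
      using e by (intro nonneg) simp
    ultimately show ?thesis
      by simp
  qed
  show ?thesis
    using pos[of "\<bar>x\<bar>"] even[of x] unfolding L_def[symmetric] by (cases "0 \<le> x") auto
qed

section \<open>First and second moments of the difference\<close>

context bounded_ito_process
begin

text \<open>The test function is sqrt (x^2 + e^2); it dominates \<bar>x\<bar>, equals e at 0, and
  its second derivative e^2 / u^3 is concentrated where \<bar>x\<bar> is of order e.\<close>

lemma expectation_abs_le_power:
  assumes H: "1 / 2 < H" "H \<le> 1" and A: "0 \<le> A" and d: "0 < d" "d \<le> 1"
    and G: "\<And>r w. 0 \<le> r \<Longrightarrow> w \<in> space M \<Longrightarrow> (G r w)\<^sup>2 \<le> 2 * A * \<bar>D r w\<bar> powr (2 * H) + 2 * d\<^sup>2"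
    and t: "0 \<le> t" "t \<le> T"
  shows "(\<integral>w. \<bar>D t w\<bar> \<partial>M) \<le> (1 + T * (A + 1)) * d powr (2 - 1 / H)"
proof -
  \<comment> \<open>With this width the Hoelder part e powr (2H - 1) and the uniform part d^2 / e
    are both equal to d powr (2 - 1/H), and the smoothing error e is no larger because H \<le>
    1.\<close>
  define e where "e = d powr (1 / H)"
  have e: "0 < e"
    using d by (simp add: e_def)
  let ?u = "\<lambda>x. sqrt (x\<^sup>2 + e\<^sup>2)"
  note u = sqrt_sq_add_props[OF e]
  have d1: "(?u has_real_derivative x / ?u x) (at x)" for x
    by (rule sqrt_sq_add_deriv[OF e])
  have d2: "((\<lambda>x. x / ?u x) has_real_derivative e\<^sup>2 / ?u x ^ 3) (at x)" for x
  proof -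
    have "((\<lambda>x. x * (1 / ?u x)) has_real_derivative 1 * (1 / ?u x) + x * (- x / ?u x ^ 3)) (at x)"
      by (rule DERIV_cong[OF DERIV_mult[OF DERIV_ident inverse_sqrt_sq_add_deriv[OF e]]]) simp
    moreover have "1 * (1 / ?u x) + x * (- x / ?u x ^ 3) = e\<^sup>2 / ?u x ^ 3"
    proof -
      have "1 / ?u x = (?u x)\<^sup>2 / ?u x ^ 3"
        using u(3)[of x] by (simp add: power2_eq_square power3_eq_cube del: real_sqrt_mult_self)
      then show ?thesis
        unfolding u(5) by (simp add: power2_eq_square diff_divide_distrib[symmetric])
    qed
    ultimately show ?thesis
      by simp
  qed
  have d3: "((\<lambda>x. e\<^sup>2 / ?u x ^ 3) has_real_derivative e\<^sup>2 * (- 3 * x / ?u x ^ 5)) (at x)" for x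
  proof -
    have "((\<lambda>x. e\<^sup>2 * (1 / ?u x) ^ 3) has_real_derivative
        e\<^sup>2 * (of_nat 3 * (- x / ?u x ^ 3 * (1 / ?u x) ^ (3 - Suc 0)))) (at x)"
      by (intro DERIV_cmult DERIV_power inverse_sqrt_sq_add_deriv[OF e])
    moreover have "e\<^sup>2 * (of_nat 3 * (- x / w ^ 3 * (1 / w) ^ (3 - Suc 0))) = e\<^sup>2 * (- 3 * x / w ^ 5)" for w
      by (simp add: power_divide power_add[symmetric])
    ultimately show ?thesis
      by (simp only: power_divide power_one times_divide_eq_right mult_1_right)
  qed
  have b3: "\<bar>e\<^sup>2 * (- 3 * x / ?u x ^ 5)\<bar> \<le> 3 * e\<^sup>2 / e ^ 4" for x
  proof -
    have "\<bar>e\<^sup>2 * (- 3 * x / ?u x ^ 5)\<bar> = 3 * e\<^sup>2 * (\<bar>x\<bar> / ?u x ^ 5)"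
      using u(3)[of x] by (simp add: abs_mult abs_divide)
    also have "\<dots> \<le> 3 * e\<^sup>2 * (?u x / ?u x ^ 5)"
      using u[of x] by (intro mult_left_mono divide_right_mono) auto
    also have "?u x / ?u x ^ 5 = 1 / ?u x ^ 4"
      using u(3)[of x] by (simp add: eval_nat_numeral del: real_sqrt_mult_self)
    also have "3 * e\<^sup>2 * (1 / ?u x ^ 4) \<le> 3 * e\<^sup>2 * (1 / e ^ 4)"
      using u[of x] e by (intro mult_left_mono divide_left_mono power_mono mult_pos_pos zero_less_power) auto
    finally show ?thesis
      by simp
  qed
  have b2: "0 \<le> e\<^sup>2 / ?u x ^ 3" "e\<^sup>2 / ?u x ^ 3 \<le> e\<^sup>2 / e ^ 3" for x
    using u[of x] e by (auto intro!: divide_left_mono power_mono mult_pos_pos)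
  let ?\<rho> = "d powr (2 - 1 / H)"
  have \<rho>: "e powr (2 * H - 1) = ?\<rho>" "d\<^sup>2 / e = ?\<rho>" "e \<le> ?\<rho>"
  proof -
    show "e powr (2 * H - 1) = ?\<rho>"
      using H d by (simp add: e_def powr_powr diff_divide_distrib)
    show "d\<^sup>2 / e = ?\<rho>"
      using d by (simp add: e_def powr_diff)
    show "e \<le> ?\<rho>"
      unfolding e_def using H d by (intro powr_mono') (auto simp: field_simps)
  qed
  have c: "e\<^sup>2 / ?u (D r w) ^ 3 * (G r w)\<^sup>2 \<le> 2 * A * ?\<rho> + 2 * ?\<rho>"
    if "0 \<le> r" "w \<in> space M" for r w
  proof -
    let ?x = "D r w"
    let ?v = "?u ?x"
    note v = u[of ?x]
    have "\<bar>?x\<bar> powr (2 * H) \<le> ?v powr (2 * H)"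
      using v H by (intro powr_mono2) auto
    also have "\<dots> = ?v ^ 3 * ?v powr (2 * H - 3)"
      using v(3) by (simp add: powr_diff powr_numeral)
    \<comment> \<open>The exponent 2H - 3 is negative, so the lower bound e for the root gives an
      upper bound for its power.\<close>
    also have "\<dots> \<le> ?v ^ 3 * e powr (2 * H - 3)"
      using v e H by (intro mult_left_mono powr_mono2') auto
    also have "e powr (2 * H - 3) = ?\<rho> / e\<^sup>2"
    proof -
      have "e powr (2 * H - 3) = e powr (2 * H - 1 - 2)"
        by simp
      also have "\<dots> = e powr (2 * H - 1) / e\<^sup>2"
        using e by (subst powr_diff) (simp add: powr_numeral)
      finally show ?thesis
        by (simp add: \<rho>)
    qed
    finally have 1: "e\<^sup>2 / ?v ^ 3 * \<bar>?x\<bar> powr (2 * H) \<le> ?\<rho>"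
      using v(3) e by (simp add: field_simps)
    have "e\<^sup>2 / ?v ^ 3 * d\<^sup>2 \<le> e\<^sup>2 / e ^ 3 * d\<^sup>2"
      using b2(2)[of ?x] by (intro mult_right_mono) auto
    also have "\<dots> = d\<^sup>2 / e"
      using e by (simp add: power2_eq_square power3_eq_cube)
    finally have 2: "e\<^sup>2 / ?v ^ 3 * d\<^sup>2 \<le> ?\<rho>"
      using \<rho>(2) by simp
    have "e\<^sup>2 / ?v ^ 3 * (G r w)\<^sup>2 \<le> e\<^sup>2 / ?v ^ 3 * (2 * A * \<bar>?x\<bar> powr (2 * H) + 2 * d\<^sup>2)"
      by (intro mult_left_mono G that b2)
    also have "\<dots> = 2 * A * (e\<^sup>2 / ?v ^ 3 * \<bar>?x\<bar> powr (2 * H)) + 2 * (e\<^sup>2 / ?v ^ 3 * d\<^sup>2)"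
      by (simp add: algebra_simps)
    also have "\<dots> \<le> 2 * A * ?\<rho> + 2 * ?\<rho>"
      using A by (intro add_mono mult_left_mono 1 2) auto
    finally show ?thesis .
  qed
  have "(\<integral>w. \<bar>D t w\<bar> \<partial>M) \<le> (\<integral>w. ?u (D t w) \<partial>M)"
    using integrable_D_power[OF t(1), of 1] u(1)
    by (intro integral_mono integrable_phi[OF d1 d2 d3 b3 b2 t(1)]) auto
  also have "\<dots> \<le> ?u 0 + (2 * A * ?\<rho> + 2 * ?\<rho>) / 2 * t"
    by (rule expectation_phi_le[OF d1 d2 d3 b3 b2 c t(1)])
  also have "\<dots> = e + t * (A + 1) * ?\<rho>"
    using e by (simp add: field_simps)
  also have "\<dots> \<le> ?\<rho> + T * (A + 1) * ?\<rho>"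
    using \<rho>(3) t A by (intro add_mono mult_right_mono) auto
  finally show ?thesis
    by (simp add: algebra_simps)
qed

text \<open>The smoothing width is \<open>d\<close> itself. Since d^2 \<le> d \<le> u with u = sqrt
  (x^2 + d^2), the squared integrand is at most (2 A + 2) u, and the second derivative 1 / (L u)
  cancels u.\<close>

lemma expectation_abs_le_log:
  assumes A: "0 \<le> A" and d: "0 < d" "d < 1"
    and G: "\<And>r w. 0 \<le> r \<Longrightarrow> w \<in> space M \<Longrightarrow> (G r w)\<^sup>2 \<le> 2 * A * \<bar>D r w\<bar> + 2 * d\<^sup>2"
    and t: "0 \<le> t" "t \<le> T"
  shows "(\<integral>w. \<bar>D t w\<bar> \<partial>M) \<le> sqrt d + 2 * T * (A + 1) / (- ln d)"
proof -
  define L where "L = - ln d"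
  have L: "0 < L"
    using d by (simp add: L_def)
  let ?u = "\<lambda>x. sqrt (x\<^sup>2 + d\<^sup>2)"
  note u = sqrt_sq_add_props[OF d(1)]
  note der = log_test_deriv[OF d(1) L]
  have b3: "\<bar>- x / ?u x ^ 3 / L\<bar> \<le> 1 / d\<^sup>2 / L" for x
  proof -
    have "\<bar>- x / ?u x ^ 3 / L\<bar> = \<bar>x\<bar> / ?u x ^ 3 / L"
      using u(3)[of x] L by (simp add: abs_divide)
    also have "\<dots> \<le> ?u x / ?u x ^ 3 / L"
      using u[of x] L by (intro divide_right_mono) auto
    also have "?u x / ?u x ^ 3 = 1 / (?u x)\<^sup>2"
      using u(3)[of x] by (simp add: eval_nat_numeral del: real_sqrt_mult_self)
    also have "1 / (?u x)\<^sup>2 / L \<le> 1 / d\<^sup>2 / L"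
      using u[of x] d L by (intro divide_right_mono divide_left_mono power_mono mult_pos_pos zero_less_power) auto
    finally show ?thesis .
  qed
  have b2: "0 \<le> 1 / ?u x / L" "1 / ?u x / L \<le> 1 / d / L" for x
    using u[of x] d L by (auto intro!: divide_right_mono divide_left_mono mult_pos_pos)
  have c: "1 / ?u (D r w) / L * (G r w)\<^sup>2 \<le> (2 * A + 2) / L"
    if "0 \<le> r" "w \<in> space M" for r w
  proof -
    let ?v = "?u (D r w)"
    note v = u[of "D r w"]
    have "(G r w)\<^sup>2 \<le> 2 * A * \<bar>D r w\<bar> + 2 * d\<^sup>2"
      by (rule G[OF that])
    also have "d\<^sup>2 \<le> d * 1"
      unfolding power2_eq_square using d by (intro mult_left_mono) auto
    also have "2 * A * \<bar>D r w\<bar> + 2 * (d * 1) \<le> 2 * A * ?v + 2 * ?v"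
      using v A by (intro add_mono mult_left_mono) auto
    finally have "(G r w)\<^sup>2 \<le> (2 * A + 2) * ?v"
      by (simp add: algebra_simps)
    then have "1 / ?v / L * (G r w)\<^sup>2 \<le> 1 / ?v / L * ((2 * A + 2) * ?v)"
      using b2(1) by (rule mult_left_mono)
    moreover have "1 / w / L * ((2 * A + 2) * w) = (2 * A + 2) / L" if "0 < w" for w
      using that L by (simp add: field_simps)
    ultimately show ?thesis
      using v(3) by metis
  qed
  have int: "integrable M (\<lambda>w. log_test d L (D t w))"
    by (rule integrable_phi[OF der b3 b2 t(1)])
  have "(\<integral>w. \<bar>D t w\<bar> \<partial>M) \<le> (\<integral>w. sqrt d + 2 * log_test d L (D t w) \<partial>M)"
    using integrable_D_power[OF t(1), of 1] int log_test_lower[OF d]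
    by (intro integral_mono) (auto simp: L_def)
  also have "\<dots> = sqrt d + 2 * (\<integral>w. log_test d L (D t w) \<partial>M)"
    using int by (simp add: prob_space)
  also have "(\<integral>w. log_test d L (D t w) \<partial>M) \<le> log_test d L 0 + (2 * A + 2) / L / 2 * t"
    by (rule expectation_phi_le[OF der b3 b2 c t(1)])
  also have "log_test d L 0 = 0"
    using d by (simp add: log_test_def)
  also have "0 + (2 * A + 2) / L / 2 * t = t * (A + 1) / L"
    using L by (simp add: field_simps)
  also have "t * (A + 1) / L \<le> T * (A + 1) / L"
    using t A L by (intro divide_right_mono mult_right_mono) auto
  finally show ?thesis
    by (simp add: L_def)
qed

lemma expectation_sq_le:
  assumes A: "0 \<le> A" and T: "0 < T"
    and G: "\<And>r w. 0 \<le> r \<Longrightarrow> w \<in> space M \<Longrightarrow> (G r w)\<^sup>2 \<le> 2 * A * \<bar>D r w\<bar> + 2 * d\<^sup>2"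
    and m: "\<And>t. 0 \<le> t \<Longrightarrow> t \<le> T \<Longrightarrow> (\<integral>w. \<bar>D t w\<bar> \<partial>M) \<le> m"
  shows "(\<integral>w. (D T w)\<^sup>2 \<partial>M) \<le> (2 * A * m + 2 * d\<^sup>2) * T"
proof -
  have "(\<integral>w. (D T w)\<^sup>2 \<partial>M) = (\<integral>w. (D T w - D 0 w)\<^sup>2 \<partial>M)"
  proof (rule integral_cong_AE)
    show "AE w in M. (D T w)\<^sup>2 = (D T w - D 0 w)\<^sup>2"
      using D_0 by eventually_elim simp
  qed (use T in \<open>auto intro!: borel_measurable_power measurable_D measurable_increment\<close>)
  also have "\<dots> \<le> (2 * A * m + 2 * d\<^sup>2) * (T - 0)"
  proof (rule increment_sq_le)
    fix r assume r: "r \<in> {0..T}"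
    then have r0: "0 \<le> r"
      by simp
    have "(\<integral>w. (G r w)\<^sup>2 \<partial>M) \<le> (\<integral>w. 2 * A * \<bar>D r w\<bar> + 2 * d\<^sup>2 \<partial>M)"
      using integrable_D_power[OF r0, of 1]
      by (intro integral_mono G expectation_G_sq_le(1) r0) auto
    also have "\<dots> = 2 * A * (\<integral>w. \<bar>D r w\<bar> \<partial>M) + 2 * d\<^sup>2"
      using integrable_D_power[OF r0, of 1] by (simp add: prob_space)
    also have "\<dots> \<le> 2 * A * m + 2 * d\<^sup>2"
      using m[of r] r A by (intro add_mono mult_left_mono) auto
    finally show "(\<integral>w. (G r w)\<^sup>2 \<partial>M) \<le> 2 * A * m + 2 * d\<^sup>2" .
  qed (use T in auto)
  finally show ?thesis
    by simp
qed

end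

section \<open>Constants, rates and the final estimate\<close>

lemma sup_norm_leD:
  assumes "sup_norm f = ennreal c" "0 \<le> c"
  shows "\<bar>f x\<bar> \<le> c"
proof -
  have "ennreal \<bar>f x\<bar> \<le> ennreal c"
    unfolding assms(1)[symmetric] sup_norm_def by (rule SUP_upper) simp
  then show ?thesis
    using assms(2) by (simp add: ennreal_le_iff)
qed

text \<open>Hoelder continuity is given only up to distance 1; beyond, the difference is at most 2
  S, and the powers of the distance are at least 1. The linear form follows from 2 H \<ge>
  1.\<close>

lemma holder_sq_le:
  fixes \<sigma> :: "real \<Rightarrow> real"
  assumes H: "1 / 2 \<le> H" and S: "\<And>x. \<bar>\<sigma> x\<bar> \<le> S" and c: "0 \<le> c"
    and holder: "\<And>x y. \<bar>x - y\<bar> \<le> 1 \<Longrightarrow> \<bar>\<sigma> x - \<sigma> y\<bar> \<le> c * \<bar>x - y\<bar> powr H"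
  shows "(\<sigma> x - \<sigma> y)\<^sup>2 \<le> (c\<^sup>2 + 4 * S\<^sup>2) * \<bar>x - y\<bar> powr (2 * H)" (is ?A)
    and "(\<sigma> x - \<sigma> y)\<^sup>2 \<le> (c\<^sup>2 + 4 * S\<^sup>2) * \<bar>x - y\<bar>" (is ?B)
proof -
  have "?A \<and> ?B"
  proof (cases "\<bar>x - y\<bar> \<le> 1")
    case True
    have "(\<sigma> x - \<sigma> y)\<^sup>2 \<le> (c * \<bar>x - y\<bar> powr H)\<^sup>2"
      using power_mono[OF holder[OF True], of 2] by simp
    also have "\<dots> = c\<^sup>2 * \<bar>x - y\<bar> powr (2 * H)"
      by (simp add: power_mult_distrib power2_eq_square powr_add[symmetric])
    also have "\<dots> \<le> (c\<^sup>2 + 4 * S\<^sup>2) * \<bar>x - y\<bar> powr (2 * H)"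
      by (intro mult_right_mono) auto
    finally have A: ?A .
    have "\<bar>x - y\<bar> powr (2 * H) \<le> \<bar>x - y\<bar> powr 1"
      using H True by (intro powr_mono') auto
    then have "(c\<^sup>2 + 4 * S\<^sup>2) * \<bar>x - y\<bar> powr (2 * H) \<le> (c\<^sup>2 + 4 * S\<^sup>2) * \<bar>x - y\<bar>"
      by (intro mult_left_mono) auto
    with A show ?thesis
      by linarith
  next
    case False
    have "\<bar>\<sigma> x - \<sigma> y\<bar> \<le> 2 * S"
      using S[of x] S[of y] by linarith
    from power_mono[OF this, of 2] have "(\<sigma> x - \<sigma> y)\<^sup>2 \<le> 4 * S\<^sup>2"
      by (simp add: power_mult_distrib)
    also have "\<dots> \<le> (c\<^sup>2 + 4 * S\<^sup>2) * 1"
      by simp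
    finally have le: "(\<sigma> x - \<sigma> y)\<^sup>2 \<le> (c\<^sup>2 + 4 * S\<^sup>2) * 1" .
    have "1 \<le> \<bar>x - y\<bar> powr (2 * H)"
      using False H by (intro ge_one_powr_ge_zero) auto
    then show ?thesis
      using False by (intro conjI order_trans[OF le] mult_left_mono) auto
  qed
  then show ?A ?B
    by auto
qed

text \<open>Doob's factor 4 times T (2 A m + 2 d^2), with the first-moment bound m at most 2 + 2 T
  (A + 1) and d^2 at most 2, both in units of the rate actually obtained. A further factor 2 pays
  for the passage to the stated rate when H = 1/2.\<close>

definition stability_const :: "real \<Rightarrow> real \<Rightarrow> real" where
  "stability_const A T = 8 * T * (2 * A * (2 + 2 * T * (A + 1)) + 4)"

lemma stability_const_pos: "0 < T \<Longrightarrow> 0 \<le> A \<Longrightarrow> 0 < stability_const A T"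
  unfolding stability_const_def by (intro mult_pos_pos add_nonneg_pos mult_nonneg_nonneg add_nonneg_nonneg) auto

text \<open>Below the threshold, L = - ln d exceeds (ln 2) / 2 and so 1/4; hence sqrt L \<ge> 1/2
  and 1/L \<le> 2 / sqrt L. The bound on sqrt d is ln y \<le> y - 1 at y = 1 / sqrt d.\<close>

lemma stability_rate_half:
  assumes d: "0 < d" "d < 2 powr (- (1 / 2))"
  shows "1 / (- ln d) \<le> 2 * stability_rate (1 / 2) d"
    and "sqrt d \<le> 2 / (- ln d)" and "0 < - ln d" and "d < 1"
proof -
  define L where "L = - ln d"
  have "ln d < ln (2 powr (- (1 / 2)))"
    using d by (simp only: ln_less_cancel_iff powr_gt_zero)
  also have "\<dots> = - (ln 2 / 2)"
    by (simp add: ln_powr)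
  finally have L4: "1 / 4 \<le> L"
    using ln2_ge_two_thirds by (simp add: L_def)
  then have L: "0 < L"
    by simp
  show "0 < - ln d"
    using L by (simp add: L_def)
  then show d1: "d < 1"
    using d by simp
  have "(1 / 2)\<^sup>2 \<le> L"
    using L4 by (simp add: power2_eq_square)
  then have "1 / 2 \<le> sqrt L"
    by (rule real_le_rsqrt)
  then have "1 * sqrt L \<le> 2 * sqrt L * sqrt L"
    using L by (intro mult_right_mono) auto
  also have "\<dots> = 2 * L"
    using L by simp
  finally have "sqrt L \<le> 2 * L"
    by simp
  then have "1 / L \<le> 2 * (1 / sqrt L)"
    using L by (simp add: field_simps)
  also have "1 / sqrt L = stability_rate (1 / 2) d"
    using d L by (simp add: stability_rate_def L_def[symmetric] powr_minus_divide powr_half_sqrt)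
  finally show "1 / (- ln d) \<le> 2 * stability_rate (1 / 2) d"
    by (simp add: L_def)
  have "ln (1 / sqrt d) \<le> 1 / sqrt d - 1"
    using d by (intro ln_le_minus_one) simp
  then have "L / 2 \<le> 1 / sqrt d"
    using d by (simp add: ln_div ln_sqrt L_def)
  then have "sqrt d * L \<le> 2"
    using d by (simp add: field_simps)
  then show "sqrt d \<le> 2 / (- ln d)"
    using L unfolding L_def[symmetric] by (simp add: pos_le_divide_eq)
qed

text \<open>Here \<open>d\<close> is any positive upper bound for the distance of the coefficients,
  not necessarily the smallest one; this freedom later covers distance 0.\<close>

lemma (in brownian_motion) sde_stability:
  assumes H: "1 / 2 \<le> H" "H \<le> 1" and T: "0 < T" and c: "0 \<le> c"
    and X: "sde_solution M F B \<sigma> x0 X" and X': "sde_solution M F B \<sigma>' x0 X'"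
    and \<sigma>: "\<sigma> \<in> borel_measurable borel" "\<sigma>' \<in> borel_measurable borel"
    and S: "\<And>x. \<bar>\<sigma> x\<bar> \<le> S"
    and holder: "\<And>x y. \<bar>x - y\<bar> \<le> 1 \<Longrightarrow> \<bar>\<sigma> x - \<sigma> y\<bar> \<le> c * \<bar>x - y\<bar> powr H"
    and close: "\<And>x. \<bar>\<sigma> x - \<sigma>' x\<bar> \<le> d" and d: "0 < d" "d < 2 powr (- H)"
  shows "(\<integral>\<^sup>+w. (SUP t\<in>{0..T}. ennreal \<bar>X t w - X' t w\<bar>)\<^sup>2 \<partial>M)
    \<le> ennreal (stability_const (c\<^sup>2 + 4 * S\<^sup>2) T * stability_rate H d)"
proof -
  define A where "A = c\<^sup>2 + 4 * S\<^sup>2"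
  have A: "0 \<le> A"
    by (simp add: A_def)
  have S': "\<bar>\<sigma>' x\<bar> \<le> S + d" for x
    using S[of x] close[of x] by linarith
  interpret bounded_ito_process M F B "\<lambda>t w. X t w - X' t w" "\<lambda>t w. \<sigma> (X t w) - \<sigma>' (X' t w)" "S + (S + d)"
    by (rule sde_difference[OF X X' \<sigma> S S'])
  have G_split: "(\<sigma> x - \<sigma>' y)\<^sup>2 \<le> 2 * (\<sigma> x - \<sigma> y)\<^sup>2 + 2 * d\<^sup>2" for x y
  proof -
    have "(\<sigma> x - \<sigma>' y)\<^sup>2 \<le> 2 * (\<sigma> x - \<sigma> y)\<^sup>2 + 2 * (\<sigma> y - \<sigma>' y)\<^sup>2"
      using sq_add_le_weighted[of 1 "\<sigma> x - \<sigma> y" "\<sigma> y - \<sigma>' y"] by simp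
    moreover have "(\<sigma> y - \<sigma>' y)\<^sup>2 \<le> d\<^sup>2"
      using power_mono[OF close[of y], of 2] by simp
    ultimately show ?thesis
      by linarith
  qed
  have G: "(\<sigma> x - \<sigma>' y)\<^sup>2 \<le> 2 * A * \<bar>x - y\<bar> powr (2 * H) + 2 * d\<^sup>2"
    "(\<sigma> x - \<sigma>' y)\<^sup>2 \<le> 2 * A * \<bar>x - y\<bar> + 2 * d\<^sup>2" for x y
    using G_split[of x y] holder_sq_le[OF H(1) S c holder, of x y] unfolding A_def by linarith+
  have "AE w in M. continuous_on {0..} (\<lambda>t. X t w)" "AE w in M. continuous_on {0..} (\<lambda>t. X' t w)"
    using X X' by (auto simp: sde_solution_def)
  then have cont: "AE w in M. continuous_on {0..} (\<lambda>t. X t w - X' t w)"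
    by eventually_elim (rule continuous_on_diff)
  have sup: "(\<integral>\<^sup>+w. (SUP t\<in>{0..T}. ennreal \<bar>X t w - X' t w\<bar>)\<^sup>2 \<partial>M)
      \<le> ennreal (4 * ((2 * A * m + 2 * d\<^sup>2) * T))"
    if "\<And>t. 0 \<le> t \<Longrightarrow> t \<le> T \<Longrightarrow> (\<integral>w. \<bar>X t w - X' t w\<bar> \<partial>M) \<le> m" for m
    using expectation_sup_sq_le[OF cont T] expectation_sq_le[OF A T G(2) that]
    by (elim order_trans) (intro ennreal_leI mult_left_mono; simp)
  show ?thesis
  proof (cases "H = 1 / 2")
    case True
    have dH: "d < 2 powr (- (1 / 2))"
      using d(2) unfolding True by simp
    define L where "L = - ln d"
    note rate = stability_rate_half[OF d(1) dH, folded L_def]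
    have m: "(\<integral>w. \<bar>X t w - X' t w\<bar> \<partial>M) \<le> (2 + 2 * T * (A + 1)) / L" if "0 \<le> t" "t \<le> T" for t
    proof -
      have "(\<integral>w. \<bar>X t w - X' t w\<bar> \<partial>M) \<le> sqrt d + 2 * T * (A + 1) / L"
        unfolding L_def by (rule expectation_abs_le_log[OF A d(1) rate(4) G(2) that])
      also have "\<dots> \<le> 2 / L + 2 * T * (A + 1) / L"
        using rate(2) by simp
      finally show ?thesis
        by (simp add: add_divide_distrib)
    qed
    have "d\<^sup>2 \<le> d"
      using d(1) rate(4) by (simp add: power2_eq_square mult_left_le)
    also have "d = sqrt d * sqrt d"
      using d by simp
    also have "\<dots> \<le> 1 * sqrt d"
      using d rate(4) by (intro mult_right_mono) auto
    finally have d2: "d\<^sup>2 \<le> 2 / L"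
      using rate(2) by simp
    have "4 * ((2 * A * ((2 + 2 * T * (A + 1)) / L) + 2 * d\<^sup>2) * T)
        \<le> 4 * ((2 * A * ((2 + 2 * T * (A + 1)) / L) + 2 * (2 / L)) * T)"
      using d2 T by (intro mult_left_mono mult_right_mono add_left_mono) auto
    also have "\<dots> = stability_const A T / 2 * (1 / L)"
      by (simp add: stability_const_def algebra_simps add_divide_distrib)
    also have "\<dots> \<le> stability_const A T / 2 * (2 * stability_rate H d)"
      using rate(1) stability_const_pos[OF T A] unfolding True by (intro mult_left_mono) auto
    finally show ?thesis
      using order_trans[OF sup[OF m] ennreal_leI] unfolding A_def[symmetric] by simp
  next
    case False
    then have H': "1 / 2 < H"
      using H by simp
    have "2 powr (- H) \<le> 2 powr 0"
      using H by (intro powr_mono) auto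
    then have d1: "d \<le> 1"
      using d by simp
    define r where "r = d powr (2 - 1 / H)"
    have m: "(\<integral>w. \<bar>X t w - X' t w\<bar> \<partial>M) \<le> (1 + T * (A + 1)) * r" if "0 \<le> t" "t \<le> T" for t
      unfolding r_def by (rule expectation_abs_le_power[OF H' H(2) A d(1) d1 G(1) that])
    have "d\<^sup>2 = d powr 2"
      using d by (simp add: powr_numeral)
    also have "\<dots> \<le> r"
      unfolding r_def using d d1 H by (intro powr_mono') auto
    finally have d2: "d\<^sup>2 \<le> r" .
    \<comment> \<open>\<open>r\<close> is the square of the rate, and for d \<le> 1 the smaller
      exponent gives the larger power.\<close>
    have r: "0 \<le> r" "r \<le> stability_rate H d"
      using d d1 H H' False unfolding r_def stability_rate_def by (auto intro!: powr_mono' simp: field_simps)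
    have "4 * ((2 * A * ((1 + T * (A + 1)) * r) + 2 * d\<^sup>2) * T)
        \<le> 4 * ((2 * A * ((2 + 2 * T * (A + 1)) * r) + 4 * r) * T)"
      using d2 T A r by (intro mult_left_mono mult_right_mono add_mono) auto
    also have "\<dots> = stability_const A T / 2 * r"
      by (simp add: stability_const_def algebra_simps)
    also have "\<dots> \<le> stability_const A T * stability_rate H d"
      using r stability_const_pos[OF T A] by (intro mult_mono) auto
    finally show ?thesis
      using order_trans[OF sup[OF m] ennreal_leI] unfolding A_def[symmetric] by simp
  qed
qed

text \<open>The shift by 3 keeps the arguments below 1/2, hence below 2 powr (- H) for every H \<le>
  1.\<close>

lemma stability_rate_tendsto_0:
  assumes "1 / 2 \<le> H"
  shows "(\<lambda>n. stability_rate H (1 / real (n + 3))) \<longlonglongrightarrow> 0"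
proof (cases "H = 1 / 2")
  case True
  have "(\<lambda>n. (- ln (1 / real (n + 3))) powr (- 1 / 2)) \<longlonglongrightarrow> 0"
    by real_asymp
  then show ?thesis
    using True by (simp add: stability_rate_def)
next
  case False
  then have "0 < 1 - 1 / (2 * H)"
    using assms by simp
  moreover have "(\<lambda>n. 1 / real (n + 3)) \<longlonglongrightarrow> 0"
    by real_asymp
  ultimately have "(\<lambda>n. (1 / real (n + 3)) powr (1 - 1 / (2 * H))) \<longlonglongrightarrow> 0 powr (1 - 1 / (2 * H))"
    by (intro tendsto_powr') auto
  then show ?thesis
    using False by (simp add: stability_rate_def)
qed

text \<open>At distance 0 the logarithm and the smoothing width degenerate. The bound then holds
  with every e = 1 / (n + 3) in place of d, and the limit gives 0, the value of
  \<open>stability_rate\<close> at 0.\<close>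

lemma (in brownian_motion) sde_stability_sup_norm:
  assumes H: "1 / 2 \<le> H" "H \<le> 1" and T: "0 < T" and c: "0 \<le> c"
    and X: "sde_solution M F B \<sigma> x0 X" and X': "sde_solution M F B \<sigma>' x0 X'"
    and \<sigma>: "\<sigma> \<in> borel_measurable borel" "\<sigma>' \<in> borel_measurable borel"
    and S: "sup_norm \<sigma> = ennreal S" and S0: "0 \<le> S"
    and holder: "\<And>x y. \<bar>x - y\<bar> \<le> 1 \<Longrightarrow> \<bar>\<sigma> x - \<sigma> y\<bar> \<le> c * \<bar>x - y\<bar> powr H"
    and \<Delta>: "sup_norm (\<lambda>x. \<sigma> x - \<sigma>' x) < ennreal (2 powr (- H))"
  shows "(\<integral>\<^sup>+w. (SUP t\<in>{0..T}. ennreal \<bar>X t w - X' t w\<bar>)\<^sup>2 \<partial>M)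
    \<le> ennreal (stability_const (c\<^sup>2 + 4 * S\<^sup>2) T * stability_rate H (enn2real (sup_norm (\<lambda>x. \<sigma> x - \<sigma>' x))))"
    (is "?I \<le> _")
proof -
  let ?C = "stability_const (c\<^sup>2 + 4 * S\<^sup>2) T"
  define d where "d = enn2real (sup_norm (\<lambda>x. \<sigma> x - \<sigma>' x))"
  have norm: "sup_norm (\<lambda>x. \<sigma> x - \<sigma>' x) = ennreal d"
    unfolding d_def using \<Delta> by (intro ennreal_enn2real[symmetric]) (auto intro: less_trans)
  have d0: "0 \<le> d"
    by (simp add: d_def)
  have d_less: "d < 2 powr (- H)"
    using \<Delta> d0 unfolding norm by (simp add: ennreal_less_iff)
  have close: "\<bar>\<sigma> x - \<sigma>' x\<bar> \<le> d" for x
    by (rule sup_norm_leD[OF norm d0])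
  have stab: "?I
      \<le> ennreal (?C * stability_rate H e)" if "0 < e" "d \<le> e" "e < 2 powr (- H)" for e
  proof (rule sde_stability[OF H T c X X' \<sigma> sup_norm_leD[OF S S0] holder])
    show "\<bar>\<sigma> x - \<sigma>' x\<bar> \<le> e" for x
      using close[of x] that(2) by simp
  qed (use that in auto)
  show ?thesis
  proof (cases "d = 0")
    case False
    then show ?thesis
      using stab[of d] d0 d_less unfolding d_def[symmetric] by simp
  next
    case True
    have "2 powr (- 1) \<le> 2 powr (- H)"
      using H by (intro powr_mono) auto
    then have half: "1 / 2 \<le> 2 powr (- H)"
      by (simp add: powr_minus_divide)
    have less: "1 / real (n + 3) < 2 powr (- H)" for n
    proof (rule less_le_trans[OF _ half])
      show "1 / real (n + 3) < 1 / 2"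
        by (intro divide_strict_left_mono) auto
    qed
    have le: "?I
        \<le> ennreal (?C * stability_rate H (1 / real (n + 3)))" for n
      using True by (intro stab less) auto
    have "(\<lambda>n. ennreal (?C * stability_rate H (1 / real (n + 3)))) \<longlonglongrightarrow> ennreal (?C * 0)"
      by (intro tendsto_ennrealI tendsto_mult tendsto_const stability_rate_tendsto_0 H)
    then have "?I \<le> ennreal (?C * 0)"
      by (rule LIMSEQ_le_const) (use le in auto)
    moreover have "stability_rate H d = 0"
      using True by (simp add: stability_rate_def)
    ultimately show ?thesis
      unfolding d_def[symmetric] by simp
  qed
qed

text \<open>The constant is fixed before the probability space, the coefficients and the solutions;
  the parameter \<open>S\<close> carries the supremum norm of \<sigma> into it.\<close>

theorem theorem1p1:
  fixes H c_H S :: real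
  assumes "1/2 \<le> H" and "H \<le> 1" and "c_H > 0" and "S \<ge> 0"
  shows "\<forall>T>0. \<exists>C>0.
    \<forall>(M :: 'a measure) F B x0 \<sigma> \<sigma>n X Xn.
      brownian_motion M F B \<longrightarrow>
      x0 > 0 \<longrightarrow>
      \<sigma> \<in> borel_measurable borel \<longrightarrow>
      (\<forall>n::nat. \<sigma>n n \<in> borel_measurable borel) \<longrightarrow>
      sup_norm \<sigma> = ennreal S \<longrightarrow>
      (\<forall>x y. \<bar>x - y\<bar> \<le> 1 \<longrightarrow> \<bar>\<sigma> x - \<sigma> y\<bar> \<le> c_H * \<bar>x - y\<bar> powr H) \<longrightarrow>
      sde_solution M F B \<sigma> x0 X \<longrightarrow>
      (\<forall>n. strong_sde_solution M F B (\<sigma>n n) x0 (Xn n)) \<longrightarrow>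
      (\<forall>n. let \<Delta> = sup_norm (\<lambda>x. \<sigma> x - \<sigma>n n x) in
        \<Delta> < ennreal (2 powr (- H)) \<longrightarrow>
        (\<integral>\<^sup>+\<omega>. (SUP t\<in>{0..T}. ennreal \<bar>X t \<omega> - Xn n t \<omega>\<bar>)\<^sup>2 \<partial>M)
          \<le> ennreal (C * stability_rate H (enn2real \<Delta>)))"
  unfolding Let_def
  by (intro allI impI, rule exI, rule conjI,
      rule stability_const_pos[where A = "c_H\<^sup>2 + 4 * S\<^sup>2"], assumption, simp, intro allI impI,
      rule brownian_motion.sde_stability_sup_norm)
    (use assms in \<open>auto simp: strong_sde_solution_def\<close>)

end
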